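(* Let $\mu\in(0,2)$, $\nu\in\mathbb{R}$ and $\tau_0>0$. Let $x:[\tau_0,\infty)\to\mathbb{R}$ be either $x(t)=\widetilde{J}_{\nu,\mu}(t)$ or $x(t)=\widetilde{Y}_{\nu,\mu}(t)$, and let the continuous function $\varphi(t)$ be given by $\tan\varphi(t)=\frac{\dot x(t)}{x(t)}$ for $t\in[\tau_0,\infty)$ (with values in $\mathbb{R}\cup\{\infty\}$). Then the planar curve $$\Gamma=\{(x(t),\dot x(t)) : t\in[\tau_0,\infty)\}$$ is a spiral near the origin $r=g(\varphi)$, $\varphi\in(-\infty,-\phi_0]$ for some $\phi_0>0$, in polar coordinates, satisfying $g(\varphi)\simeq|\varphi|^{-\frac{2-\mu}{2}}$ as $\varphi\to-\infty$. The phase dimension of $x$ is $$\dim_{ph}(x)=\dim_B\Gamma=\frac{4}{4-\mu}.$$ Moreover, the spiral $\Gamma$ (near the origin) is a wavy spiral if and only if $\nu\neq0$.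
   Context: Generalized Bessel functions: for $\nu,\mu\in\mathbb{R}$ put $\widetilde\nu=\sqrt{\left(\frac{\mu-1}{2}\right)^2+\nu^2}$ and, for $t>0$, $$\widetilde{J}_{\nu,\mu}(t)=t^{\frac{\mu-1}{2}}J_{\widetilde\nu}(t),\qquad \widetilde{Y}_{\nu,\mu}(t)=t^{\frac{\mu-1}{2}}Y_{\widetilde\nu}(t),$$ where $J_{\widetilde\nu},Y_{\widetilde\nu}$ are the Bessel functions of the first and second kind of order $\widetilde\nu$. They are two linearly independent solutions of $t^2x''(t)+t(2-\mu)x'(t)+(t^2-\nu^2)x(t)=0$. Box dimension: for bounded $A\subset\mathbb{R}^N$ let $A_\varepsilon=\{y\in\mathbb{R}^N: d(y,A)<\varepsilon\}$, and let $|A_\varepsilon|$ denote its Lebesgue measure. For $s\ge0$ let $\mathcal{M}_*^s(A)=\liminf_{\varepsilon\to0}|A_\varepsilon|/\varepsilon^{N-s}$ and $\mathcal{M}^{*s}(A)=\limsup_{\varepsilon\to0}|A_\varepsilon|/\varepsilon^{N-s}$. Then $\underline{\dim}_BA=\inf\{s\ge0:\mathcal{M}_*^s(A)=0\}$ and $\overline{\dim}_BA=\inf\{s\ge0:\mathcal{M}^{*s}(A)=0\}$; if they coincide the common value is $\dim_BA$. Phase dimension: for $x:[t_0,\infty)\to\mathbb{R}$ of class $C^1$, $\dim_{ph}(x)$ is the box dimension of the planar curve $\{(x(t),\dot x(t)):t\in[t_0,\infty)\}$. Spiral: a spiral is the graph in polar coordinates of $r=f(\varphi)$, $\varphi\ge\varphi_1>0$,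 where $f:[\varphi_1,\infty)\to(0,\infty)$ satisfies $f(\varphi)\to0$ as $\varphi\to\infty$ and $f$ is radially decreasing, i.e. for any fixed $\varphi\ge\varphi_1$ the function $\mathbb{N}\ni k\mapsto f(\varphi+2k\pi)$ is decreasing. Also called a spiral is the graph in polar coordinates of $r=g(\varphi)$, $\varphi\le\varphi_1'<0$, when $h(\varphi)=g(-\varphi)$, $\varphi\ge|\varphi_1'|$, satisfies the preceding conditions (mirror image in the $x$-axis). A graph $r=f(\varphi)$ is a spiral near the origin if its restriction to $\varphi\ge\varphi_2$ (respectively, to $\varphi\le-\varphi_2$ in the mirrored case) is a spiral for some sufficiently large $\varphi_2$. For the curve $\Gamma$, "near the origin" means that an initial piece of the curve, corresponding to a bounded range of $t$, may be discarded. Wavy function: let $r:[t_0,\infty)\to(0,\infty)$ be $C^1$ with $r'(t_0)\le0$. It is a wavy function if the sequence $(t_n)$ defined inductively by $$t_{2k+1}=\inf\{t:t>t_{2k},\ r'(t)>0\},\qquad t_{2k+2}=\inf\{t:t>t_{2k+1},\ r(t)=r(t_{2k+1})\},\qquad k\in\mathbb{N}_0,$$ is well-defined and satisfies the waviness condition: (i) $(t_n)$ is increasing and $t_n\to\infty$; (ii) there is $\varepsilon>0$ such that $t_{2k+1}-t_{2k}\ge\varepsilon$ for all $k\in\mathbb{N}_0$; (iii) for some $\alpha\in(0,1)$, $\mathrm{osc}_{t\in[t_{2k+1},t_{2k+2}]}r(t)=o(t_{2k+1}^{-\alpha-1})$ as $k\to\infty$, where $\mathrm{osc}_{t\in I}r(t)=\max_{t\in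 I}r(t)-\min_{t\in I}r(t)$. Wavy spiral: a spiral given in polar coordinates by $r=f(\varphi)$ is a wavy spiral if there exists an increasing or decreasing function $\varphi=\varphi(t)$ of class $C^1$ such that $r(t)=f(\varphi(t))$ is a wavy function. Notation: $f\simeq g$ means that there are constants $C,D>0$ with $Cf\le g\le Df$ for all arguments sufficiently large (here: for $\varphi\to-\infty$). *)

theory Defs
  imports "HOL-Analysis.Analysis" "HOL-Library.Landau_Symbols"
begin

text \<open>Bessel functions of real order, for positive argument. Since \<^const>\<open>rGamma\<close> vanishes at
  the non-positive integers, the series is the usual one for every real order, negative integers
  included.\<close>

definition bessel_J :: "real \<Rightarrow> real \<Rightarrow> real" where
  "bessel_J a t = (\<Sum>m. (-1) ^ m * rGamma (a + real m + 1) / fact m * (t / 2) powr (a + 2 * real m))"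

definition bessel_Y_quotient :: "real \<Rightarrow> real \<Rightarrow> real" where
  "bessel_Y_quotient a t = (bessel_J a t * cos (a * pi) - bessel_J (- a) t) / sin (a * pi)"

definition bessel_Y :: "real \<Rightarrow> real \<Rightarrow> real" where
  "bessel_Y a t = (if a \<in> \<int> then Lim (at a) (\<lambda>b. bessel_Y_quotient b t) else bessel_Y_quotient a t)"

definition gen_order :: "real \<Rightarrow> real \<Rightarrow> real" where
  "gen_order \<nu> \<mu> = sqrt (((\<mu> - 1) / 2)\<^sup>2 + \<nu>\<^sup>2)"

definition gen_bessel_J :: "real \<Rightarrow> real \<Rightarrow> real \<Rightarrow> real" where
  "gen_bessel_J \<nu> \<mu> t = t powr ((\<mu> - 1) / 2) * bessel_J (gen_order \<nu> \<mu>) t"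

definition gen_bessel_Y :: "real \<Rightarrow> real \<Rightarrow> real \<Rightarrow> real" where
  "gen_bessel_Y \<nu> \<mu> t = t powr ((\<mu> - 1) / 2) * bessel_Y (gen_order \<nu> \<mu>) t"

text \<open>Derivatives relative to the domain; at the end point of a half-line this is the one-sided
  derivative.\<close>

definition deriv_on :: "real set \<Rightarrow> (real \<Rightarrow> real) \<Rightarrow> real \<Rightarrow> real" where
  "deriv_on S f t = vector_derivative f (at t within S)"

definition C1_on :: "real set \<Rightarrow> (real \<Rightarrow> real) \<Rightarrow> bool" where
  "C1_on S f \<longleftrightarrow> f differentiable_on S \<and> continuous_on S (deriv_on S f)"

text \<open>The set of points at distance less than \<open>\<epsilon>\<close> from \<open>A\<close>. It is not written with
  \<^const>\<open>infdist\<close> because that is 0 for empty \<open>A\<close>. The set is open, so its Lebesgue measure is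
  given by \<^const>\<open>lborel\<close>.\<close>

definition eps_nbhd :: "'a::euclidean_space set \<Rightarrow> real \<Rightarrow> 'a set" where
  "eps_nbhd A \<epsilon> = {y. \<exists>a\<in>A. dist y a < \<epsilon>}"

definition minkowski_ratio :: "'a::euclidean_space set \<Rightarrow> real \<Rightarrow> real \<Rightarrow> ennreal" where
  "minkowski_ratio A s \<epsilon> =
     emeasure lborel (eps_nbhd A \<epsilon>) / ennreal (\<epsilon> powr (real DIM('a) - s))"

definition lower_minkowski_content :: "real \<Rightarrow> 'a::euclidean_space set \<Rightarrow> ennreal" where
  "lower_minkowski_content s A = Liminf (at_right 0) (minkowski_ratio A s)"

definition upper_minkowski_content :: "real \<Rightarrow> 'a::euclidean_space set \<Rightarrow> ennreal" where
  "upper_minkowski_content s A = Limsup (at_right 0) (minkowski_ratio A s)"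

definition lower_box_dim :: "'a::euclidean_space set \<Rightarrow> real" where
  "lower_box_dim A = Inf {s. 0 \<le> s \<and> lower_minkowski_content s A = 0}"

definition upper_box_dim :: "'a::euclidean_space set \<Rightarrow> real" where
  "upper_box_dim A = Inf {s. 0 \<le> s \<and> upper_minkowski_content s A = 0}"

definition has_box_dim :: "'a::euclidean_space set \<Rightarrow> real \<Rightarrow> bool" where
  "has_box_dim A d \<longleftrightarrow> bounded A \<and> lower_box_dim A = d \<and> upper_box_dim A = d"

definition phase_curve :: "real \<Rightarrow> (real \<Rightarrow> real) \<Rightarrow> (real \<times> real) set" where
  "phase_curve t0 x = (\<lambda>t. (x t, deriv_on {t0..} x t)) ` {t0..}"

definition has_phase_dim :: "real \<Rightarrow> (real \<Rightarrow> real) \<Rightarrow> real \<Rightarrow> bool" where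
  "has_phase_dim t0 x d \<longleftrightarrow> C1_on {t0..} x \<and> has_box_dim (phase_curve t0 x) d"

text \<open>The equation \<open>tan \<theta> = q / p\<close> in the reals extended by a point at infinity, which is the
  value on both sides when \<open>p = 0\<close>. (In HOL, \<open>tan \<theta> = 0\<close> when \<open>cos \<theta> = 0\<close>.)\<close>

definition tan_eq_quotient :: "real \<Rightarrow> real \<Rightarrow> real \<Rightarrow> bool" where
  "tan_eq_quotient \<theta> q p \<longleftrightarrow>
     (if p = 0 then cos \<theta> = 0 else cos \<theta> \<noteq> 0 \<and> tan \<theta> = q / p)"

definition polar_point :: "real \<Rightarrow> real \<Rightarrow> real \<times> real" where
  "polar_point r \<theta> = (r * cos \<theta>, r * sin \<theta>)"

definition polar_graph :: "(real \<Rightarrow> real) \<Rightarrow> real set \<Rightarrow> (real \<times> real) set" where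
  "polar_graph f S = (\<lambda>\<theta>. polar_point (f \<theta>) \<theta>) ` S"

definition spiral_pos :: "(real \<Rightarrow> real) \<Rightarrow> real \<Rightarrow> bool" where
  "spiral_pos f \<phi>1 \<longleftrightarrow>
     \<phi>1 > 0 \<and> (\<forall>\<theta>\<ge>\<phi>1. f \<theta> > 0) \<and> (f \<longlongrightarrow> 0) at_top \<and>
     (\<forall>\<theta>\<ge>\<phi>1. \<forall>k l :: nat. k < l \<longrightarrow> f (\<theta> + 2 * real l * pi) < f (\<theta> + 2 * real k * pi))"

text \<open>\<open>is_spiral f S\<close>: the polar graph of \<open>r = f \<theta>\<close> for \<open>\<theta> \<in> S\<close> is a spiral,
  in either orientation.\<close>

definition is_spiral :: "(real \<Rightarrow> real) \<Rightarrow> real set \<Rightarrow> bool" where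
  "is_spiral f S \<longleftrightarrow>
     (\<exists>\<phi>1. S = {\<phi>1..} \<and> spiral_pos f \<phi>1) \<or>
     (\<exists>\<phi>1. S = {..- \<phi>1} \<and> spiral_pos (\<lambda>\<theta>. f (- \<theta>)) \<phi>1)"

definition osc :: "(real \<Rightarrow> real) \<Rightarrow> real set \<Rightarrow> real" where
  "osc r I = Sup (r ` I) - Inf (r ` I)"

text \<open>\<open>wave_sequence t0 r T\<close>: \<open>T\<close> is the sequence defined by the alternating infima, all of them
  taken over nonempty sets (for the empty set, \<^const>\<open>Inf\<close> would be an unspecified real).\<close>

definition wave_sequence :: "real \<Rightarrow> (real \<Rightarrow> real) \<Rightarrow> (nat \<Rightarrow> real) \<Rightarrow> bool" where
  "wave_sequence t0 r T \<longleftrightarrow> T 0 = t0 \<and>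
     (\<forall>k. {t. t > T (2 * k) \<and> deriv_on {t0..} r t > 0} \<noteq> {} \<and>
          T (2 * k + 1) = Inf {t. t > T (2 * k) \<and> deriv_on {t0..} r t > 0} \<and>
          {t. t > T (2 * k + 1) \<and> r t = r (T (2 * k + 1))} \<noteq> {} \<and>
          T (2 * k + 2) = Inf {t. t > T (2 * k + 1) \<and> r t = r (T (2 * k + 1))})"

definition waviness :: "(real \<Rightarrow> real) \<Rightarrow> (nat \<Rightarrow> real) \<Rightarrow> bool" where
  "waviness r T \<longleftrightarrow>
     strict_mono T \<and> filterlim T at_top sequentially \<and>
     (\<exists>\<epsilon>>0. \<forall>k. T (2 * k + 1) - T (2 * k) \<ge> \<epsilon>) \<and>
     (\<exists>\<alpha>\<in>{0<..<1}. (\<lambda>k. osc r {T (2 * k + 1)..T (2 * k + 2)}) \<in>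
        o(\<lambda>k. T (2 * k + 1) powr (- \<alpha> - 1)))"

definition wavy_function :: "real \<Rightarrow> (real \<Rightarrow> real) \<Rightarrow> bool" where
  "wavy_function t0 r \<longleftrightarrow>
     C1_on {t0..} r \<and> (\<forall>t\<ge>t0. r t > 0) \<and> deriv_on {t0..} r t0 \<le> 0 \<and>
     (\<exists>T. wave_sequence t0 r T \<and> waviness r T)"

definition is_wavy_spiral :: "(real \<Rightarrow> real) \<Rightarrow> real set \<Rightarrow> bool" where
  "is_wavy_spiral f S \<longleftrightarrow> is_spiral f S \<and>
     (\<exists>t0 \<psi>. C1_on {t0..} \<psi> \<and>
        (strict_mono_on {t0..} \<psi> \<or> strict_antimono_on {t0..} \<psi>) \<and>
        \<psi> ` {t0..} \<subseteq> S \<and> wavy_function t0 (\<lambda>t. f (\<psi> t)))"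

definition comparable :: "real filter \<Rightarrow> (real \<Rightarrow> real) \<Rightarrow> (real \<Rightarrow> real) \<Rightarrow> bool" where
  "comparable F f g \<longleftrightarrow>
     (\<exists>C>0. \<exists>D>0. eventually (\<lambda>s. C * f s \<le> g s \<and> g s \<le> D * f s) F)"

end

theory Submission
  imports Defs
begin

text \<open>Why the theorem holds. Functions of both kinds are nontrivial solutions \<open>x\<close> of
  \<open>x'' + (a / t) x' + (1 - q / t\<^sup>2) x = 0\<close> with \<open>a = 2 - \<mu>\<close> in \<open>(0, 2)\<close> and \<open>q = \<nu>\<^sup>2\<close>,
  and every such solution has the asserted properties. With \<open>x = r cos \<theta>\<close> and \<open>x' = - r sin \<theta>\<close>, where \<open>\<theta>\<close> is the
  negative of the angle \<open>\<phi>\<close> up to \<open>0\<close> or \<open>pi\<close>, the equation becomes the Pruefer system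
  \<open>r' = - r ((a / t) sin\<^sup>2 \<theta> + (q / t\<^sup>2) sin \<theta> cos \<theta>)\<close>,
  \<open>\<theta>' = 1 - (a / t) sin \<theta> cos \<theta> - (q / t\<^sup>2) cos\<^sup>2 \<theta>\<close>. So \<open>\<theta>\<close> grows like \<open>t\<close>, and averaging
  \<open>sin\<^sup>2 \<theta>\<close> over the rotation gives \<open>r\<close> of order \<open>t powr (- a / 2)\<close>: the function \<open>energy\<close> below
  has derivative \<open>O(1 / t\<^sup>2)\<close>. The same function shows that \<open>r\<close> decreases over every whole number
  of turns, hence the curve is a spiral whose radius is comparable to the stated power of the
  angle.

  For the box dimension (\<open>has_box_dim_curve\<close>) put \<open>e = w powr (- (1 + a / 2))\<close>, the order of the
  distance between consecutive turns at time \<open>w\<close>. After time \<open>w\<close> the turns are so close that their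
  \<open>e\<close>-neighbourhood fills a disc of radius of order \<open>w powr (- a / 2)\<close>; before time \<open>w\<close> the curve has
  length of order \<open>w powr (1 - a / 2)\<close>. Both parts contribute an area of order \<open>w powr (- a)\<close>, that is
  \<open>e powr (2 - 4 / (2 + a))\<close>.

  For the waves, \<open>r'\<close> is a negative multiple of \<open>sin \<theta> sin (\<theta> + \<delta>)\<close> with
  \<open>\<delta> = arctan (q / (a t))\<close> (\<open>dr_product\<close>). If \<open>q = 0\<close>, the radius is strictly decreasing, so it
  never returns to an earlier value and there are no waves. If \<open>q > 0\<close>, then for large \<open>t\<close> the radius grows exactly
  while \<open>\<theta> < m pi < \<theta> + \<delta>\<close> for some \<open>m\<close>, a short piece of each half turn, and the decay over the
  next quarter turn more than compensates this growth (\<open>r_after_wave\<close>).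

  That the Bessel functions solve the equation and are nontrivial is read off from their power
  series. For \<open>Y\<close> of integer order the limit in the order is a derivative: the derivative of \<open>J\<close>
  with respect to its order is again given by a series with a logarithmic factor, and
  differentiating the recurrence of the coefficients gives its differential equation.\<close>

section \<open>Derivatives relative to a half-line\<close>

lemma at_within_atLeast_neq_bot:
  fixes t t0 :: real
  assumes "t0 \<le> t"
  shows "at t within {t0..} \<noteq> bot"
proof
  assume "at t within {t0..} = bot"
  moreover have "at_right t \<le> at t within {t0..}"
    using assms by (intro at_le) auto
  ultimately show False
    using trivial_limit_at_right_real[of t] by (simp add: bot_unique)
qed

lemma deriv_on_atLeast_eqI:
  assumes "t0 \<le> t" "(f has_real_derivative D) (at t within {t0..})"
  shows "deriv_on {t0..} f t = D"
  unfolding deriv_on_def using assms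
  by (intro vector_derivative_within at_within_atLeast_neq_bot)
     (auto simp: has_real_derivative_iff_has_vector_derivative)

lemma C1_on_atLeastI:
  assumes "\<And>t. t0 \<le> t \<Longrightarrow> (f has_real_derivative f' t) (at t within {t0..})"
    and "continuous_on {t0..} f'"
  shows "C1_on {t0..} f"
proof -
  have "continuous_on {t0..} (deriv_on {t0..} f)"
    using assms(2) by (rule continuous_on_eq) (use assms(1) deriv_on_atLeast_eqI in force)
  moreover have "f differentiable_on {t0..}"
    unfolding differentiable_on_def using assms(1)
    by (auto simp: real_differentiable_def)
  ultimately show ?thesis by (simp add: C1_on_def)
qed

lemma at_within_atLeast_interior:
  fixes t t0 :: real
  shows "t0 < t \<Longrightarrow> at t within {t0..} = at t"
  by (rule at_within_interior) simp

section \<open>Box dimension from two-sided bounds on the volume of neighbourhoods\<close>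

lemma open_eps_nbhd: "open (eps_nbhd A e)"
proof -
  have "eps_nbhd A e = (\<Union>a\<in>A. ball a e)"
    by (auto simp: eps_nbhd_def dist_commute)
  then show ?thesis by auto
qed

lemma emeasure_lborel_ball_plane:
  fixes c :: "real \<times> real"
  assumes "0 \<le> r"
  shows "emeasure lborel (ball c r) = ennreal (pi * r\<^sup>2)"
  using emeasure_ball[OF assms, of c] by (simp add: unit_ball_vol_2 power2_eq_square)

text \<open>The exponent of the volume of the neighbourhoods determines the dimension: for
  \<open>s = d + h\<close> the quotient defining the content lies between multiples of \<open>e powr h\<close>, which tends
  to \<open>0\<close> for positive \<open>h\<close> and is at least \<open>1\<close> for negative \<open>h\<close> and \<open>e < 1\<close>.\<close>

lemma has_box_dimI:
  fixes A :: "'a::euclidean_space set"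
  assumes "bounded A" "0 \<le> d" "0 < c" "0 < e0"
    and lower: "\<And>e. 0 < e \<Longrightarrow> e < e0 \<Longrightarrow>
      ennreal (c * e powr (real DIM('a) - d)) \<le> emeasure lborel (eps_nbhd A e)"
    and upper: "\<And>e. 0 < e \<Longrightarrow> e < e0 \<Longrightarrow>
      emeasure lborel (eps_nbhd A e) \<le> ennreal (C * e powr (real DIM('a) - d))"
  shows "has_box_dim A d"
proof -
  let ?n = "real DIM('a)"
  have ev: "eventually (\<lambda>e::real. 0 < e \<and> e < min 1 e0) (at_right 0)"
    unfolding eventually_at_right_field using \<open>0 < e0\<close>
    by (intro exI[of _ "min 1 e0"]) auto
  have ratio: "x * e powr (?n - d) / e powr (?n - s) = x * e powr (s - d)"
    if "0 < e" for e s x :: real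
    using that by (simp add: powr_diff field_simps)
  have up0: "upper_minkowski_content s A = 0" if "d < s" for s
  proof -
    have lim: "((\<lambda>e. ennreal (C * e powr (s - d))) \<longlongrightarrow> ennreal (C * 0)) (at_right 0)"
    proof (intro tendsto_ennrealI tendsto_mult tendsto_const)
      have "((\<lambda>e::real. e powr (s - d)) \<longlongrightarrow> 0 powr (s - d)) (at_right 0)"
        by (rule tendsto_powr') (use that in \<open>auto simp: eventually_at_right_field intro: exI[of _ 1]\<close>)
      then show "((\<lambda>e::real. e powr (s - d)) \<longlongrightarrow> 0) (at_right 0)" by simp
    qed
    have "upper_minkowski_content s A \<le> Limsup (at_right 0) (\<lambda>e. ennreal (C * e powr (s - d)))"
      unfolding upper_minkowski_content_def
    proof (rule Limsup_mono)
      show "eventually (\<lambda>e. minkowski_ratio A s e \<le> ennreal (C * e powr (s - d))) (at_right 0)"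
        using ev
      proof eventually_elim
        case (elim e)
        have "minkowski_ratio A s e \<le> ennreal (C * e powr (?n - d)) / ennreal (e powr (?n - s))"
          unfolding minkowski_ratio_def by (intro divide_right_mono_ennreal upper) (use elim in auto)
        also have "\<dots> = ennreal (C * e powr (s - d))"
        proof (cases "0 \<le> C")
          case True
          then show ?thesis using elim by (subst divide_ennreal) (auto simp: ratio)
        next
          case False
          then show ?thesis using elim by (simp add: ennreal_neg mult_nonpos_nonneg)
        qed
        finally show ?case .
      qed
    qed
    also have "\<dots> = ennreal (C * 0)"
      by (rule lim_imp_Limsup[OF _ lim]) simp
    finally show ?thesis by simp
  qed
  have low: "lower_minkowski_content s A \<noteq> 0" if "s < d" for s
  proof -
    have "ennreal c \<le> Liminf (at_right 0) (minkowski_ratio A s)"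
    proof (rule Liminf_bounded)
      show "eventually (\<lambda>e. ennreal c \<le> minkowski_ratio A s e) (at_right 0)"
        using ev
      proof eventually_elim
        case (elim e)
        have "1 \<le> e powr (s - d)"
          using elim that powr_mono_both'[of "s - d" 0 e e] powr_mono'[of "s - d" 0 e] by simp
        then have "ennreal c \<le> ennreal (c * e powr (s - d))"
          using \<open>0 < c\<close> by (intro ennreal_leI) (simp add: mult_le_cancel_left1)
        also have "\<dots> = ennreal (c * e powr (?n - d)) / ennreal (e powr (?n - s))"
          using elim \<open>0 < c\<close> by (subst divide_ennreal) (auto simp: ratio)
        also have "\<dots> \<le> minkowski_ratio A s e"
          unfolding minkowski_ratio_def by (intro divide_right_mono_ennreal lower) (use elim in auto)
        finally show ?case .
      qed
    qed
    then show ?thesis using \<open>0 < c\<close>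
      by (auto simp: lower_minkowski_content_def)
  qed
  have le: "lower_minkowski_content s A \<le> upper_minkowski_content s A" for s
    unfolding lower_minkowski_content_def upper_minkowski_content_def
    by (rule Liminf_le_Limsup) simp
  have Inf_eq: "Inf {s. 0 \<le> s \<and> F s = 0} = d"
    if "\<And>s. d < s \<Longrightarrow> F s = 0" "\<And>s. s < d \<Longrightarrow> F s \<noteq> 0" for F :: "real \<Rightarrow> ennreal"
  proof (rule cInf_eq)
    fix s assume "s \<in> {s. 0 \<le> s \<and> F s = 0}"
    then show "d \<le> s" using that(2) by force
  next
    fix y assume y: "\<And>s. s \<in> {s. 0 \<le> s \<and> F s = 0} \<Longrightarrow> y \<le> s"
    show "y \<le> d"
      by (rule dense_ge) (use y that(1) \<open>0 \<le> d\<close> in auto)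
  qed
  have "lower_box_dim A = d" unfolding lower_box_dim_def
    by (rule Inf_eq) (use up0 low le in \<open>auto simp: order_antisym\<close>, metis le_zero_eq le up0)
  moreover have "upper_box_dim A = d" unfolding upper_box_dim_def
    by (rule Inf_eq) (use up0 low le in \<open>auto\<close>, metis le_zero_eq le low)
  ultimately show ?thesis using \<open>bounded A\<close> by (simp add: has_box_dim_def)
qed

text \<open>Parameters spaced by \<open>e / L\<close> give points of the arc spaced by at most \<open>e\<close>, so the balls of radius
  \<open>2 * e\<close> about these points cover the neighbourhood.\<close>

lemma emeasure_eps_nbhd_lipschitz_arc:
  fixes F :: "real \<Rightarrow> real \<times> real"
  assumes F: "L-lipschitz_on {p..q} F" and "0 < L" "p \<le> q" "0 < e"
  shows "emeasure lborel (eps_nbhd (F ` {p..q}) e) \<le> ennreal (4 * pi * ((q - p) * L * e + e\<^sup>2))"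
proof -
  define N where "N = nat \<lfloor>(q - p) * L / e\<rfloor>"
  have N: "real N \<le> (q - p) * L / e"
    unfolding N_def using assms by (simp add: of_nat_floor)
  have sub: "eps_nbhd (F ` {p..q}) e \<subseteq> (\<Union>i\<in>{..N}. ball (F (p + real i * e / L)) (2 * e))"
  proof
    fix y assume "y \<in> eps_nbhd (F ` {p..q}) e"
    then obtain u where u: "p \<le> u" "u \<le> q" "dist y (F u) < e"
      by (auto simp: eps_nbhd_def)
    define i where "i = nat \<lfloor>(u - p) * L / e\<rfloor>"
    have nn: "0 \<le> (u - p) * L / e" using u assms by simp
    have i1: "real i \<le> (u - p) * L / e" unfolding i_def using nn by (simp add: of_nat_floor)
    have i2: "(u - p) * L / e < real i + 1"
      unfolding i_def using nn by linarith
    define w where "w = p + real i * e / L"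
    have w1: "w \<le> u" using i1 assms by (simp add: w_def field_simps)
    have "(u - p) * L < (real i + 1) * e" using i2 assms by (simp add: pos_divide_less_eq)
    then have "u - p < (real i + 1) * e / L" using assms by (simp add: pos_less_divide_eq)
    then have w2: "u - w < e / L" by (simp add: w_def add_divide_distrib distrib_right)
    have w3: "p \<le> w" using assms by (simp add: w_def)
    have "dist (F u) (F w) \<le> L * dist u w"
      using lipschitz_onD[OF F, of u w] u w1 w3 by auto
    also have "dist u w = u - w" using w1 by (simp add: dist_real_def)
    also have "L * (u - w) < L * (e / L)" using w2 assms by (intro mult_strict_left_mono)
    also have "\<dots> = e" using assms by simp
    finally have "dist (F w) y < 2 * e"
      using u(3) dist_triangle[of "F w" y "F u"] by (simp add: dist_commute)
    moreover have "i \<le> N" unfolding i_def N_def using u assms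
      by (intro nat_mono floor_mono divide_right_mono mult_right_mono) auto
    ultimately show "y \<in> (\<Union>i\<in>{..N}. ball (F (p + real i * e / L)) (2 * e))"
      by (auto simp: w_def)
  qed
  have "emeasure lborel (eps_nbhd (F ` {p..q}) e) \<le>
      emeasure lborel (\<Union>i\<in>{..N}. ball (F (p + real i * e / L)) (2 * e))"
    by (rule emeasure_mono[OF sub]) auto
  also have "\<dots> \<le> (\<Sum>i\<in>{..N}. emeasure lborel (ball (F (p + real i * e / L)) (2 * e)))"
    by (rule emeasure_subadditive_finite) auto
  also have "\<dots> = ennreal (real (N + 1) * (pi * (2 * e)\<^sup>2))"
    using assms by (simp add: emeasure_lborel_ball_plane ennreal_mult ennreal_of_nat_eq_real_of_nat)
  also have "\<dots> \<le> ennreal (4 * pi * ((q - p) * L * e + e\<^sup>2))"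
  proof (rule ennreal_leI)
    have "real (N + 1) * (pi * (2 * e)\<^sup>2) \<le> ((q - p) * L / e + 1) * (pi * (2 * e)\<^sup>2)"
      using N by (intro mult_right_mono) auto
    also have "\<dots> = 4 * pi * ((q - p) * L * e + e\<^sup>2)"
      using assms by (simp add: field_simps power2_eq_square)
    finally show "real (N + 1) * (pi * (2 * e)\<^sup>2) \<le> 4 * pi * ((q - p) * L * e + e\<^sup>2)" .
  qed
  finally show ?thesis .
qed

section \<open>Amplitude and phase of a damped oscillation\<close>

text \<open>The equation \<open>x'' + (a / t) x' + (1 - q / t\<^sup>2) x = 0\<close> in the polar coordinates
  \<open>x = r cos \<theta>\<close>, \<open>x' = - r sin \<theta>\<close>. The sign makes \<open>\<theta>\<close> increase, as the phase curve turns
  clockwise.\<close>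

locale pruefer_system =
  fixes a q t0 :: real and r \<theta> :: "real \<Rightarrow> real"
  assumes a_pos: "0 < a" and a_less: "a < 2" and q_nonneg: "0 \<le> q" and t0_pos: "0 < t0"
    and r_pos: "\<And>t. t0 \<le> t \<Longrightarrow> 0 < r t"
    and r_deriv: "\<And>t. t0 \<le> t \<Longrightarrow> (r has_real_derivative
      - r t * (a / t * (sin (\<theta> t))\<^sup>2 + q / t\<^sup>2 * (sin (\<theta> t) * cos (\<theta> t)))) (at t within {t0..})"
    and \<theta>_deriv: "\<And>t. t0 \<le> t \<Longrightarrow> (\<theta> has_real_derivative
      1 - a / t * (sin (\<theta> t) * cos (\<theta> t)) - q / t\<^sup>2 * (cos (\<theta> t))\<^sup>2) (at t within {t0..})"
begin

definition dr :: "real \<Rightarrow> real" where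
  "dr t = - r t * (a / t * (sin (\<theta> t))\<^sup>2 + q / t\<^sup>2 * (sin (\<theta> t) * cos (\<theta> t)))"

definition d\<theta> :: "real \<Rightarrow> real" where
  "d\<theta> t = 1 - a / t * (sin (\<theta> t) * cos (\<theta> t)) - q / t\<^sup>2 * (cos (\<theta> t))\<^sup>2"

text \<open>From \<open>t1\<close> on the angular velocity stays between \<open>1 / 2\<close> and \<open>2\<close>; as \<open>t0 < t1\<close>, the derivatives
  there are two-sided, and as \<open>1 < t1\<close>, powers of \<open>1 / t\<close> can be compared.\<close>

definition t1 :: real where
  "t1 = max (t0 + 1) (2 * (a + q))"

lemma t1_bounds: "t0 < t1" "1 < t1" "2 * (a + q) \<le> t1"
  using t0_pos by (auto simp: t1_def)

lemma r_within: "t0 \<le> s \<Longrightarrow> s \<le> t \<Longrightarrow> (r has_real_derivative dr t) (at t within {s..})"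
  using r_deriv[of t] by (auto simp: dr_def intro: DERIV_subset)

lemma \<theta>_within: "t0 \<le> s \<Longrightarrow> s \<le> t \<Longrightarrow> (\<theta> has_real_derivative d\<theta> t) (at t within {s..})"
  using \<theta>_deriv[of t] by (auto simp: d\<theta>_def intro: DERIV_subset)

lemma r_at: "t0 < t \<Longrightarrow> (r has_real_derivative dr t) (at t)"
  using r_within[of t0 t] by (simp add: at_within_atLeast_interior)

lemma \<theta>_at: "t0 < t \<Longrightarrow> (\<theta> has_real_derivative d\<theta> t) (at t)"
  using \<theta>_within[of t0 t] by (simp add: at_within_atLeast_interior)

lemma cont_r: "continuous_on {t0..} r"
  by (rule DERIV_continuous_on[where D = dr]) (simp add: r_within)

lemma cont_\<theta>: "continuous_on {t0..} \<theta>"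
  by (rule DERIV_continuous_on[where D = d\<theta>]) (simp add: \<theta>_within)

lemma cont_dr: "continuous_on {t0..} dr"
  unfolding dr_def using t0_pos by (intro continuous_intros cont_r cont_\<theta>) auto

lemma cont_d\<theta>: "continuous_on {t0..} d\<theta>"
  unfolding d\<theta>_def using t0_pos by (intro continuous_intros cont_\<theta>) auto

lemma abs_sin_cos_le: "\<bar>sin x * cos x\<bar> \<le> (1 :: real)"
  using mult_mono[of "\<bar>sin x\<bar>" 1 "\<bar>cos x\<bar>" 1] by (simp add: abs_mult)

lemma d\<theta>_near_1:
  assumes "t1 \<le> t"
  shows "\<bar>d\<theta> t - 1\<bar> \<le> (a + q) / t"
proof -
  have t: "1 \<le> t" using assms t1_bounds by linarith
  have "\<bar>a / t * (sin (\<theta> t) * cos (\<theta> t))\<bar> \<le> a / t * 1"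
    unfolding abs_mult[of "a / t"] using t a_pos abs_sin_cos_le by (intro mult_mono) auto
  moreover have "\<bar>q / t\<^sup>2 * (cos (\<theta> t))\<^sup>2\<bar> \<le> q / t * 1"
    unfolding abs_mult[of "q / t\<^sup>2"]
  proof (intro mult_mono)
    have "q / t\<^sup>2 \<le> q / t"
      using t q_nonneg self_le_power[of t 2] by (intro divide_left_mono) auto
    then show "\<bar>q / t\<^sup>2\<bar> \<le> q / t" using q_nonneg by simp
    show "\<bar>(cos (\<theta> t))\<^sup>2\<bar> \<le> 1" by (simp add: abs_square_le_1)
  qed (use t q_nonneg in auto)
  ultimately show ?thesis unfolding d\<theta>_def add_divide_distrib by linarith
qed

lemma d\<theta>_bounds:
  assumes "t1 \<le> t"
  shows "1 / 2 \<le> d\<theta> t" "d\<theta> t \<le> 2"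
proof -
  have "(a + q) / t \<le> 1 / 2"
    using assms t1_bounds by (simp add: divide_le_eq)
  then show "1 / 2 \<le> d\<theta> t" "d\<theta> t \<le> 2"
    using d\<theta>_near_1[OF assms] by linarith+
qed

lemma \<theta>_increment:
  assumes "t1 \<le> s" "s \<le> t"
  shows "(t - s) / 2 \<le> \<theta> t - \<theta> s" "\<theta> t - \<theta> s \<le> 2 * (t - s)"
proof -
  have "(t - s) / 2 \<le> \<theta> t - \<theta> s \<and> \<theta> t - \<theta> s \<le> 2 * (t - s)"
  proof (cases "s = t")
    case False
    then have "s < t" using assms by simp
    then obtain z where z: "s < z" "\<theta> t - \<theta> s = (t - s) * d\<theta> z"
      using MVT2[of s t \<theta> d\<theta>] \<theta>_at assms t1_bounds by force
    have "1 / 2 \<le> d\<theta> z" "d\<theta> z \<le> 2" using d\<theta>_bounds[of z] z assms by auto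
    then have "(t - s) * (1 / 2) \<le> (t - s) * d\<theta> z" "(t - s) * d\<theta> z \<le> (t - s) * 2"
      using \<open>s < t\<close> by (intro mult_left_mono; simp)+
    then show ?thesis using z by simp
  qed simp
  then show "(t - s) / 2 \<le> \<theta> t - \<theta> s" "\<theta> t - \<theta> s \<le> 2 * (t - s)" by auto
qed

lemma \<theta>_less: "t1 \<le> s \<Longrightarrow> s < t \<Longrightarrow> \<theta> s < \<theta> t"
  using \<theta>_increment(1)[of s t] by simp

lemma \<theta>_less_iff: "t1 \<le> s \<Longrightarrow> t1 \<le> t \<Longrightarrow> \<theta> s < \<theta> t \<longleftrightarrow> s < t"
  using \<theta>_less[of s t] \<theta>_less[of t s] by (cases s t rule: linorder_cases) auto

lemma \<theta>_surj:
  assumes "t1 \<le> s" "\<theta> s \<le> v"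
  obtains t where "s \<le> t" "t \<le> s + 2 * (v - \<theta> s)" "\<theta> t = v"
proof -
  let ?u = "s + 2 * (v - \<theta> s)"
  have "v \<le> \<theta> ?u" using \<theta>_increment(1)[of s ?u] assms by simp
  moreover have "continuous_on {s..?u} \<theta>"
    by (rule continuous_on_subset[OF cont_\<theta>]) (use assms t1_bounds in auto)
  ultimately show ?thesis using that IVT'[of \<theta> s v ?u] assms by auto
qed

text \<open>Since \<open>sin\<^sup>2 \<theta> = 1 / 2 - cos (2 \<theta>) / 2\<close>, the rate \<open>- (a / t) sin\<^sup>2 \<theta>\<close> of \<open>ln r\<close> splits into the secular
  part \<open>- a / (2 t)\<close> and an oscillating part. The latter has a bounded integral, because it is the
  derivative of \<open>(a / 4) sin (2 \<theta>) / t\<close> up to \<open>O(1 / t\<^sup>2)\<close>. The energy is \<open>ln r\<close> with both parts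
  removed.\<close>

definition energy :: "real \<Rightarrow> real" where
  "energy t = ln (r t) + a / 2 * ln t - a / 4 * sin (2 * \<theta> t) / t"

text \<open>The constant in the bound \<open>K / t\<^sup>2\<close> for the derivative of the energy: the three summands bound the
  \<open>q\<close>-term of \<open>r'\<close>, the deviation of \<open>\<theta>'\<close> from \<open>1\<close>, and the derivative of the factor \<open>1 / t\<close>.\<close>

definition K :: real where
  "K = q + a / 2 * (a + q) + a / 4"

lemma K_pos: "0 < K"
  using a_pos q_nonneg by (simp add: K_def add_nonneg_pos)

lemma energy_deriv:
  assumes "t1 \<le> t"
  obtains D where "(energy has_real_derivative D) (at t)" "\<bar>D\<bar> \<le> K / t\<^sup>2"
proof -
  have t: "t0 < t" "1 \<le> t" "0 < t" using assms t1_bounds by auto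
  define s c where "s = sin (\<theta> t)" and "c = cos (\<theta> t)"
  define D where "D = - (q / t\<^sup>2 * (s * c)) - a / 2 * cos (2 * \<theta> t) / t * (d\<theta> t - 1)
    + a / 4 * sin (2 * \<theta> t) / t\<^sup>2"
  have cos2: "cos (2 * \<theta> t) = 1 - 2 * s\<^sup>2"
    by (simp add: s_def cos_double_sin)
  have "(energy has_real_derivative (dr t / r t + a / 2 * (1 / t)
      - (a / 4 * (cos (2 * \<theta> t) * (2 * d\<theta> t)) * t - a / 4 * sin (2 * \<theta> t)) / t\<^sup>2)) (at t)"
    unfolding energy_def[abs_def] using t r_pos[of t]
    by (auto intro!: derivative_eq_intros r_at \<theta>_at simp: power2_eq_square field_simps)
  moreover have "dr t / r t = - (a / t * s\<^sup>2 + q / t\<^sup>2 * (s * c))"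
    using r_pos[of t] t by (simp add: dr_def s_def c_def)
  moreover have "- (a / t * s\<^sup>2 + q / t\<^sup>2 * (s * c)) + a / 2 * (1 / t)
      - (a / 4 * (cos (2 * \<theta> t) * (2 * d\<theta> t)) * t - a / 4 * sin (2 * \<theta> t)) / t\<^sup>2 = D"
    unfolding D_def cos2 using t by (simp add: field_simps power2_eq_square)
  ultimately have "(energy has_real_derivative D) (at t)" by simp
  moreover have "\<bar>D\<bar> \<le> K / t\<^sup>2"
  proof -
    have 1: "\<bar>q / t\<^sup>2 * (s * c)\<bar> \<le> q / t\<^sup>2 * 1"
      unfolding abs_mult[of "q / t\<^sup>2"] using q_nonneg abs_sin_cos_le
      by (intro mult_mono) (auto simp: s_def c_def)
    have 2: "\<bar>a / 2 * cos (2 * \<theta> t) / t * (d\<theta> t - 1)\<bar> \<le> (a / 2 * 1 / t) * ((a + q) / t)"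
      unfolding abs_mult[of _ "d\<theta> t - 1"] using a_pos q_nonneg t d\<theta>_near_1[OF assms]
      by (intro mult_mono) (auto simp: abs_mult divide_right_mono)
    have 3: "\<bar>a / 4 * sin (2 * \<theta> t) / t\<^sup>2\<bar> \<le> a / 4 * 1 / t\<^sup>2"
      using a_pos by (simp add: abs_mult divide_right_mono)
    have "K / t\<^sup>2 = q / t\<^sup>2 * 1 + (a / 2 * 1 / t) * ((a + q) / t) + a / 4 * 1 / t\<^sup>2"
      using t by (simp add: K_def field_simps power2_eq_square)
    then show ?thesis using 1 2 3 unfolding D_def by linarith
  qed
  ultimately show ?thesis using that by blast
qed

lemma energy_diff:
  assumes "t1 \<le> s" "s \<le> t"
  shows "\<bar>energy t - energy s\<bar> \<le> K * (1 / s - 1 / t)"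
proof -
  have s: "0 < s" using assms t1_bounds by simp
  have up: "energy t + K / t \<le> energy s + K / s"
  proof (rule DERIV_nonpos_imp_nonincreasing[OF assms(2)])
    fix u assume u: "s \<le> u" "u \<le> t"
    then obtain D where D: "(energy has_real_derivative D) (at u)" "\<bar>D\<bar> \<le> K / u\<^sup>2"
      using energy_deriv[of u] assms by auto
    have "((\<lambda>u. energy u + K / u) has_real_derivative D - K / u\<^sup>2) (at u)"
      using u s by (auto intro!: derivative_eq_intros D simp: power2_eq_square)
    then show "\<exists>y. ((\<lambda>u. energy u + K / u) has_real_derivative y) (at u) \<and> y \<le> 0"
      using D by (intro exI conjI) auto
  qed
  have lo: "energy s - K / s \<le> energy t - K / t"
  proof (rule DERIV_nonneg_imp_nondecreasing[OF assms(2)])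
    fix u assume u: "s \<le> u" "u \<le> t"
    then obtain D where D: "(energy has_real_derivative D) (at u)" "\<bar>D\<bar> \<le> K / u\<^sup>2"
      using energy_deriv[of u] assms by auto
    have "((\<lambda>u. energy u - K / u) has_real_derivative D + K / u\<^sup>2) (at u)"
      using u s by (auto intro!: derivative_eq_intros D simp: power2_eq_square)
    then show "\<exists>y. ((\<lambda>u. energy u - K / u) has_real_derivative y) (at u) \<and> 0 \<le> y"
      using D by (intro exI conjI) auto
  qed
  show ?thesis using up lo by (simp add: right_diff_distrib abs_le_iff)
qed

text \<open>The first term is negative once \<open>s\<close> exceeds \<open>2 K / a\<close>; the radius then decreases between any two
  times at which the oscillating terms nearly agree.\<close>

lemma ln_r_drop:
  assumes "t1 \<le> s" "s \<le> t"
  shows "ln (r t) - ln (r s) \<le> (t - s) / t * (K / s - a / 2)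
    + a / 4 * (sin (2 * \<theta> t) / t - sin (2 * \<theta> s) / s)"
proof -
  have s: "0 < s" "0 < t" using assms t1_bounds by auto
  have "(t - s) / t \<le> ln t - ln s"
    using ln_diff_le[of s t] s by (simp add: diff_divide_distrib)
  then have "a / 2 * ((t - s) / t) \<le> a / 2 * (ln t - ln s)"
    using a_pos by (intro mult_left_mono) auto
  moreover have "energy t - energy s \<le> K * (1 / s - 1 / t)"
    using energy_diff[OF assms] by linarith
  moreover have "K * (1 / s - 1 / t) = (t - s) / t * (K / s)"
    using s by (simp add: field_simps)
  moreover have "X * (K / s - a / 2) = X * (K / s) - a / 2 * X" for X
    by (simp add: right_diff_distrib)
  from this[of "(t - s) / t"] have "(t - s) / t * (K / s - a / 2) = (t - s) / t * (K / s) - a / 2 * ((t - s) / t)" .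
  moreover have "a / 4 * (sin (2 * \<theta> t) / t - sin (2 * \<theta> s) / s)
      = a / 4 * sin (2 * \<theta> t) / t - a / 4 * sin (2 * \<theta> s) / s"
    "a / 2 * (ln t - ln s) = a / 2 * ln t - a / 2 * ln s"
    by (simp_all add: right_diff_distrib)
  ultimately show ?thesis unfolding energy_def by linarith
qed

text \<open>Late enough for the secular decrease of \<open>ln r\<close> to dominate both the error in the energy and the
  variation of the factor \<open>1 / t\<close> in its oscillating term.\<close>

definition t2 :: real where
  "t2 = max t1 (2 * (K + a) / a + 1)"

text \<open>After a multiple of \<open>2 * pi\<close> the oscillating term of the energy returns to its value, so
  only the secular decrease remains.\<close>

lemma r_radially_decreasing:
  assumes "t2 \<le> s" "s < t" "\<theta> t = \<theta> s + 2 * pi * real k"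
  shows "r t < r s"
proof -
  have s: "t1 \<le> s" "0 < s" "0 < t" "t0 < s" "t0 < t" using assms t1_bounds by (auto simp: t2_def)
  have sin_eq: "sin (2 * \<theta> t) = sin (2 * \<theta> s)"
  proof -
    have "2 * \<theta> t = 2 * \<theta> s + 2 * real (2 * k) * pi"
      using assms(3) by simp
    then show ?thesis by (simp only: sin_add sin_2npi cos_2npi)
  qed
  have "a / 4 * (sin (2 * \<theta> t) / t - sin (2 * \<theta> s) / s) = a / 4 * (- sin (2 * \<theta> s)) * ((t - s) / (t * s))"
    unfolding sin_eq using s by (simp add: field_simps)
  also have "\<dots> \<le> a / 4 * 1 * ((t - s) / (t * s))"
    using a_pos s assms sin_ge_minus_one[of "2 * \<theta> s"] by (intro mult_right_mono mult_left_mono) auto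
  also have "\<dots> = (t - s) / t * (a / 4 / s)"
    using s by (simp add: field_simps)
  finally have "ln (r t) - ln (r s) \<le> (t - s) / t * ((K + a / 4) / s - a / 2)"
    using ln_r_drop[of s t] s assms by (simp add: algebra_simps add_divide_distrib)
  also have "\<dots> < 0"
  proof (rule mult_pos_neg)
    have "2 * (K + a) / a < s" using assms by (auto simp: t2_def)
    then have "2 * (K + a) < a * s" using a_pos by (simp add: divide_less_eq mult.commute)
    then show "(K + a / 4) / s - a / 2 < 0"
      using s a_pos by (simp add: divide_less_eq field_simps)
    show "0 < (t - s) / t" using assms s by simp
  qed
  finally show ?thesis using r_pos s by simp
qed

lemma r_asymp_late:
  "\<exists>c>0. \<exists>C>0. \<forall>t\<ge>t1. c * t powr (- (a / 2)) \<le> r t \<and> r t \<le> C * t powr (- (a / 2))"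
proof -
  define B where "B = \<bar>energy t1\<bar> + K + a / 4"
  have *: "exp (- B) * t powr (- (a / 2)) \<le> r t \<and> r t \<le> exp B * t powr (- (a / 2))"
    if "t1 \<le> t" for t
  proof -
    have t: "1 \<le> t" "t0 \<le> t" using that t1_bounds by auto
    have "\<bar>energy t - energy t1\<bar> \<le> K * (1 / t1 - 1 / t)" using energy_diff[of t1 t] that by simp
    also have "\<dots> \<le> K * 1"
    proof (rule mult_left_mono)
      show "1 / t1 - 1 / t \<le> 1" using t1_bounds t by (smt (verit) divide_le_eq_1 zero_le_divide_1_iff)
    qed (use K_pos in simp)
    finally have 1: "\<bar>energy t - energy t1\<bar> \<le> K" by simp
    have "\<bar>a / 4 * sin (2 * \<theta> t) / t\<bar> = a / 4 * (\<bar>sin (2 * \<theta> t)\<bar> / t)"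
      using a_pos t by (simp add: abs_mult)
    also have "\<bar>sin (2 * \<theta> t)\<bar> / t \<le> 1"
      using t order_trans[OF abs_sin_le_one t(1), of "2 * \<theta> t"] by (simp add: divide_le_eq)
    finally have 2: "\<bar>a / 4 * sin (2 * \<theta> t) / t\<bar> \<le> a / 4" using a_pos by simp
    have 3: "\<bar>ln (r t) + a / 2 * ln t\<bar> \<le> B"
      using 1 2 unfolding B_def energy_def by linarith
    have r: "r t = exp (ln (r t) + a / 2 * ln t) * t powr (- (a / 2))"
      using r_pos[of t] t by (simp add: powr_def mult_exp_exp)
    have "exp (- B) \<le> exp (ln (r t) + a / 2 * ln t)" "exp (ln (r t) + a / 2 * ln t) \<le> exp B"
      using 3 by (auto simp: abs_le_iff)
    then show ?thesis by (metis r mult_right_mono powr_ge_zero)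
  qed
  show ?thesis using * by (intro exI[of _ "exp (- B)"] exI[of _ "exp B"] conjI) auto
qed

text \<open>The bounds for large times extend to the whole half-line because \<open>r\<close> is positive and continuous on
  the compact remainder. The whole curve needs them, since its dimension is asserted from the
  initial time on.\<close>

lemma r_asymp:
  "\<exists>c>0. \<exists>C>0. \<forall>t\<ge>t0. c * t powr (- (a / 2)) \<le> r t \<and> r t \<le> C * t powr (- (a / 2))"
proof -
  obtain c C where cC: "0 < c" "0 < C"
    "\<And>t. t1 \<le> t \<Longrightarrow> c * t powr (- (a / 2)) \<le> r t"
    "\<And>t. t1 \<le> t \<Longrightarrow> r t \<le> C * t powr (- (a / 2))"
    using r_asymp_late by blast
  let ?f = "\<lambda>t. r t * t powr (a / 2)"
  have cont: "continuous_on {t0..t1} ?f"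
    by (intro continuous_intros continuous_on_subset[OF cont_r]) (use t0_pos in auto)
  have ne: "{t0..t1} \<noteq> {}" using t1_bounds by auto
  obtain m where m: "m \<in> {t0..t1}" "\<And>t. t \<in> {t0..t1} \<Longrightarrow> ?f m \<le> ?f t"
    using continuous_attains_inf[OF compact_Icc ne cont] by blast
  obtain M where M: "M \<in> {t0..t1}" "\<And>t. t \<in> {t0..t1} \<Longrightarrow> ?f t \<le> ?f M"
    using continuous_attains_sup[OF compact_Icc ne cont] by blast
  have pos: "0 < ?f m" "0 < ?f M"
    using r_pos[of m] r_pos[of M] m M t0_pos by auto
  have eq: "r t = ?f t * t powr (- (a / 2))" if "t0 \<le> t" for t
    using that t0_pos by (simp add: powr_minus)
  have bd: "min c (?f m) * t powr (- (a / 2)) \<le> r t \<and> r t \<le> max C (?f M) * t powr (- (a / 2))"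
    if t: "t0 \<le> t" for t
  proof
    show "min c (?f m) * t powr (- (a / 2)) \<le> r t"
    proof (cases "t1 \<le> t")
      case True
      have "min c (?f m) * t powr (- (a / 2)) \<le> c * t powr (- (a / 2))"
        by (intro mult_right_mono) auto
      then show ?thesis using cC(3)[OF True] by linarith
    next
      case False
      then have "min c (?f m) \<le> ?f t" using m(2)[of t] t by auto
      then show ?thesis by (subst eq[OF t], intro mult_right_mono) auto
    qed
    show "r t \<le> max C (?f M) * t powr (- (a / 2))"
    proof (cases "t1 \<le> t")
      case True
      have "C * t powr (- (a / 2)) \<le> max C (?f M) * t powr (- (a / 2))"
        by (intro mult_right_mono) auto
      then show ?thesis using cC(4)[OF True] by linarith
    next
      case False
      then have "?f t \<le> max C (?f M)" using M(2)[of t] t by auto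
      then show ?thesis by (subst eq[OF t], intro mult_right_mono) auto
    qed
  qed
  have "0 < min c (?f m)" "0 < max C (?f M)" using pos cC by auto
  then show ?thesis using bd by blast
qed

lemma abs_dr_le:
  assumes "t0 \<le> t"
  shows "\<bar>dr t\<bar> \<le> r t * ((a + q / t0) / t)"
proof -
  have t: "0 < t" using assms t0_pos by simp
  have "\<bar>a / t * (sin (\<theta> t))\<^sup>2\<bar> \<le> a / t * 1"
    unfolding abs_mult[of "a / t"] using t a_pos by (intro mult_mono) (auto simp: abs_square_le_1)
  moreover have "\<bar>q / t\<^sup>2 * (sin (\<theta> t) * cos (\<theta> t))\<bar> \<le> q / t0 / t * 1"
    unfolding abs_mult[of "q / t\<^sup>2"]
  proof (intro mult_mono abs_sin_cos_le)
    have "q / t / t \<le> q / t0 / t"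
      using t q_nonneg assms t0_pos by (intro divide_right_mono divide_left_mono) auto
    then show "\<bar>q / t\<^sup>2\<bar> \<le> q / t0 / t" using q_nonneg by (simp add: power2_eq_square)
  qed (use t q_nonneg t0_pos in auto)
  ultimately have "\<bar>a / t * (sin (\<theta> t))\<^sup>2 + q / t\<^sup>2 * (sin (\<theta> t) * cos (\<theta> t))\<bar> \<le> (a + q / t0) / t"
    unfolding add_divide_distrib by linarith
  then show ?thesis
    unfolding dr_def abs_mult using r_pos[OF assms] by (intro mult_mono) auto
qed

text \<open>As \<open>r'\<close> is of order \<open>r / t\<close>, consecutive turns near time \<open>s\<close> have a distance of order
  \<open>s powr (- (a / 2) - 1)\<close>.\<close>

lemma r_lipschitz_late:
  "\<exists>C>0. \<forall>s\<ge>t1. \<forall>t\<ge>s. \<bar>r t - r s\<bar> \<le> C * s powr (- (a / 2) - 1) * (t - s)"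
proof -
  obtain C where C: "0 < C" "\<And>t. t0 \<le> t \<Longrightarrow> r t \<le> C * t powr (- (a / 2))"
    using r_asymp by blast
  let ?B = "a + q / t0"
  have B: "0 < ?B" using a_pos q_nonneg t0_pos by (simp add: add_pos_nonneg)
  have bd: "\<bar>r t - r s\<bar> \<le> C * ?B * s powr (- (a / 2) - 1) * (t - s)" if st: "t1 \<le> s" "s \<le> t" for s t
  proof (cases "s = t")
    case False
    then have "s < t" using st by simp
    then obtain z where z: "s < z" "r t - r s = (t - s) * dr z"
      using MVT2[of s t r dr] r_at st t1_bounds by force
    have zp: "t0 \<le> z" "0 < z" "0 < s" using z st t1_bounds t0_pos by auto
    have "\<bar>dr z\<bar> \<le> r z * (?B / z)" using abs_dr_le zp by simp
    also have "\<dots> \<le> C * z powr (- (a / 2)) * (?B / z)"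
      using C zp B by (intro mult_right_mono) auto
    also have "\<dots> = C * ?B * z powr (- (a / 2) - 1)"
      using zp by (simp add: powr_diff)
    also have "\<dots> \<le> C * ?B * s powr (- (a / 2) - 1)"
      using zp z C B a_pos by (intro mult_left_mono powr_mono2') auto
    finally show ?thesis unfolding z(2) abs_mult
      using \<open>s < t\<close> by (simp add: mult.commute mult_left_mono)
  qed simp
  show ?thesis using bd C B by (intro exI[of _ "C * ?B"]) auto
qed

end

section \<open>Box dimension of the phase curve\<close>

context pruefer_system
begin

definition curve :: "real \<Rightarrow> real \<times> real" where
  "curve t = (r t * cos (\<theta> t), - r t * sin (\<theta> t))"

lemma norm_curve: "t0 \<le> t \<Longrightarrow> norm (curve t) = r t"
proof -
  assume "t0 \<le> t"
  have "(r t * cos (\<theta> t))\<^sup>2 + (- r t * sin (\<theta> t))\<^sup>2 = (r t)\<^sup>2 * ((sin (\<theta> t))\<^sup>2 + (cos (\<theta> t))\<^sup>2)"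
    by (simp only: power_mult_distrib power2_minus distrib_left add.commute)
  also have "\<dots> = (r t)\<^sup>2" by (simp only: sin_cos_squared_add mult_1_right)
  finally have "norm (curve t) = sqrt ((r t)\<^sup>2)"
    by (simp only: curve_def norm_Pair real_norm_def power2_abs)
  then show ?thesis using r_pos[OF \<open>t0 \<le> t\<close>] by simp
qed

lemma abs_d\<theta>_le:
  assumes "t0 \<le> t"
  shows "\<bar>d\<theta> t\<bar> \<le> 1 + a / t0 + q / t0\<^sup>2"
proof -
  have "\<bar>a / t * (sin (\<theta> t) * cos (\<theta> t))\<bar> \<le> a / t0 * 1"
    unfolding abs_mult[of "a / t"]
    by (intro mult_mono abs_sin_cos_le) (use assms t0_pos a_pos in \<open>auto intro!: divide_left_mono\<close>)
  moreover have "\<bar>q / t\<^sup>2 * (cos (\<theta> t))\<^sup>2\<bar> \<le> q / t0\<^sup>2 * 1"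
    unfolding abs_mult[of "q / t\<^sup>2"]
  proof (intro mult_mono)
    show "\<bar>q / t\<^sup>2\<bar> \<le> q / t0\<^sup>2" using assms t0_pos q_nonneg
      by (auto intro!: divide_left_mono power_mono)
    show "\<bar>(cos (\<theta> t))\<^sup>2\<bar> \<le> 1" by (simp add: abs_square_le_1)
  qed (use q_nonneg in auto)
  ultimately show ?thesis unfolding d\<theta>_def by linarith
qed

text \<open>The right-hand side is the increment of an antiderivative of \<open>M * t powr (- (a / 2))\<close>.\<close>

lemma increment_le_powr:
  assumes "t0 \<le> s" "s \<le> t"
    and der: "\<And>u. t0 < u \<Longrightarrow> (f has_real_derivative f' u) (at u)"
    and cont: "continuous_on {t0..} f"
    and le: "\<And>u. t0 < u \<Longrightarrow> \<bar>f' u\<bar> \<le> M * u powr (- (a / 2))"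
  shows "\<bar>f t - f s\<bar> \<le> M / (1 - a / 2) * (t powr (1 - a / 2) - s powr (1 - a / 2))"
proof -
  define G where "G u = M / (1 - a / 2) * u powr (1 - a / 2)" for u
  have p: "0 < 1 - a / 2" using a_less by simp
  have G: "(G has_real_derivative M * u powr (- (a / 2))) (at u)" if "t0 < u" for u
    unfolding G_def[abs_def] using that t0_pos p
    by (auto intro!: derivative_eq_intros)
  have contG: "continuous_on {s..t} G"
    unfolding G_def using assms t0_pos by (intro continuous_intros) auto
  have contf: "continuous_on {s..t} f"
    by (rule continuous_on_subset[OF cont]) (use assms in auto)
  have "G s - f s \<le> G t - f t"
  proof (rule DERIV_nonneg_imp_increasing_open[OF \<open>s \<le> t\<close>])
    fix u assume "s < u" "u < t"
    then have u: "t0 < u" using assms by simp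
    show "\<exists>y. ((\<lambda>u. G u - f u) has_real_derivative y) (at u) \<and> 0 \<le> y"
      using DERIV_diff[OF G[OF u] der[OF u]] le[OF u] by (intro exI conjI) auto
  qed (intro continuous_intros contG contf)
  moreover have "G s + f s \<le> G t + f t"
  proof (rule DERIV_nonneg_imp_increasing_open[OF \<open>s \<le> t\<close>])
    fix u assume "s < u" "u < t"
    then have u: "t0 < u" using assms by simp
    show "\<exists>y. ((\<lambda>u. G u + f u) has_real_derivative y) (at u) \<and> 0 \<le> y"
      using DERIV_add[OF G[OF u] der[OF u]] le[OF u] by (intro exI conjI) auto
  qed (intro continuous_intros contG contf)
  ultimately have "\<bar>f t - f s\<bar> \<le> G t - G s" by linarith
  then show ?thesis by (simp add: G_def right_diff_distrib)
qed

text \<open>The curve has speed of order \<open>t powr (- (a / 2))\<close>, so it is Lipschitz in the parameter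
  \<open>t powr (1 - a / 2)\<close>.\<close>

lemma curve_increment:
  "\<exists>L>0. \<forall>s\<ge>t0. \<forall>t\<ge>t0. dist (curve s) (curve t) \<le> L * \<bar>s powr (1 - a / 2) - t powr (1 - a / 2)\<bar>"
proof -
  obtain C where C: "0 < C" "\<And>t. t0 \<le> t \<Longrightarrow> r t \<le> C * t powr (- (a / 2))"
    using r_asymp by blast
  define B where "B = (a + q / t0) / t0 + (1 + a / t0 + q / t0\<^sup>2)"
  define M where "M = C * B"
  have Bpos: "0 < B" unfolding B_def using a_pos q_nonneg t0_pos by (intro add_pos_pos add_pos_nonneg divide_pos_pos) auto
  have Mpos: "0 < M" using Bpos C by (simp add: M_def)
  have main: "\<bar>dr t\<bar> + r t * \<bar>d\<theta> t\<bar> \<le> M * t powr (- (a / 2))" if t: "t0 < t" for t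
  proof -
    have "\<bar>dr t\<bar> \<le> r t * ((a + q / t0) / t)" using abs_dr_le t by simp
    also have "\<dots> \<le> r t * ((a + q / t0) / t0)"
      using t t0_pos a_pos q_nonneg r_pos[of t] by (intro mult_left_mono divide_left_mono) auto
    finally have "\<bar>dr t\<bar> + r t * \<bar>d\<theta> t\<bar> \<le> r t * ((a + q / t0) / t0) + r t * (1 + a / t0 + q / t0\<^sup>2)"
      using abs_d\<theta>_le[of t] t r_pos[of t] by (intro add_mono mult_left_mono) auto
    also have "\<dots> = r t * B" by (simp add: B_def distrib_left)
    also have "\<dots> \<le> C * t powr (- (a / 2)) * B"
      using C t Bpos by (intro mult_right_mono) auto
    finally show ?thesis by (simp add: M_def mult_ac)
  qed
  have bound: "\<bar>x * dr t + y * (r t * d\<theta> t)\<bar> \<le> M * t powr (- (a / 2))"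
    if "t0 < t" "\<bar>x\<bar> \<le> 1" "\<bar>y\<bar> \<le> 1" for x y t
  proof -
    have "\<bar>x * dr t\<bar> \<le> 1 * \<bar>dr t\<bar>" "\<bar>y * (r t * d\<theta> t)\<bar> \<le> 1 * (r t * \<bar>d\<theta> t\<bar>)"
      unfolding abs_mult using that r_pos[of t] by (intro mult_mono; simp)+
    then show ?thesis using main[OF that(1)] by linarith
  qed
  let ?L = "2 * (M / (1 - a / 2))"
  have *: "dist (curve s) (curve t) \<le> ?L * (t powr (1 - a / 2) - s powr (1 - a / 2))"
    if st: "t0 \<le> s" "s \<le> t" for s t
  proof -
    have 1: "\<bar>r t * cos (\<theta> t) - r s * cos (\<theta> s)\<bar>
        \<le> M / (1 - a / 2) * (t powr (1 - a / 2) - s powr (1 - a / 2))"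
    proof (rule increment_le_powr[OF st])
      fix u assume u: "t0 < u"
      show "((\<lambda>u. r u * cos (\<theta> u)) has_real_derivative
          cos (\<theta> u) * dr u + (- sin (\<theta> u)) * (r u * d\<theta> u)) (at u)"
        by (auto intro!: derivative_eq_intros r_at \<theta>_at u)
      show "\<bar>cos (\<theta> u) * dr u + (- sin (\<theta> u)) * (r u * d\<theta> u)\<bar> \<le> M * u powr (- (a / 2))"
        by (rule bound[OF u]) auto
    qed (intro continuous_intros cont_r cont_\<theta>)
    have 2: "\<bar>- r t * sin (\<theta> t) - - r s * sin (\<theta> s)\<bar>
        \<le> M / (1 - a / 2) * (t powr (1 - a / 2) - s powr (1 - a / 2))"
    proof (rule increment_le_powr[OF st])
      fix u assume u: "t0 < u"
      show "((\<lambda>u. - r u * sin (\<theta> u)) has_real_derivative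
          (- sin (\<theta> u)) * dr u + (- cos (\<theta> u)) * (r u * d\<theta> u)) (at u)"
        by (auto intro!: derivative_eq_intros r_at \<theta>_at u)
      show "\<bar>(- sin (\<theta> u)) * dr u + (- cos (\<theta> u)) * (r u * d\<theta> u)\<bar> \<le> M * u powr (- (a / 2))"
        by (rule bound[OF u]) auto
    qed (intro continuous_intros cont_r cont_\<theta>)
    have "dist (curve s) (curve t) \<le> \<bar>r t * cos (\<theta> t) - r s * cos (\<theta> s)\<bar>
        + \<bar>- r t * sin (\<theta> t) - - r s * sin (\<theta> s)\<bar>"
      unfolding curve_def dist_Pair_Pair dist_real_def
      using sqrt_sum_squares_le_sum_abs[of "r s * cos (\<theta> s) - r t * cos (\<theta> t)"
        "- r s * sin (\<theta> s) - - r t * sin (\<theta> t)"]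
      by (simp add: abs_minus_commute power2_commute[of "r t * sin (\<theta> t)"])
    then show ?thesis using 1 2 by simp
  qed
  have mono: "s powr (1 - a / 2) \<le> t powr (1 - a / 2)" if "t0 \<le> s" "s \<le> t" for s t
    using that t0_pos a_less by (intro powr_mono2) auto
  have "dist (curve s) (curve t) \<le> ?L * \<bar>s powr (1 - a / 2) - t powr (1 - a / 2)\<bar>"
    if "t0 \<le> s" "t0 \<le> t" for s t
  proof (cases "s \<le> t")
    case True
    then show ?thesis using *[of s t] mono[of s t] that by (simp only: abs_minus_commute[of "s powr _"]) simp
  next
    case False
    then show ?thesis using *[of t s] mono[of t s] that by (simp add: dist_commute)
  qed
  moreover have "0 < ?L" using Mpos a_less by simp
  ultimately show ?thesis by blast
qed

text \<open>A point in the disc has the same distance from the origin as some later point \<open>curve u\<close>. Within the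
  next turn, which takes time at most \<open>4 pi\<close>, the curve points in the direction of the given point,
  and in that time the radius has changed by less than \<open>e\<close>.\<close>

lemma curve_nucleus:
  assumes s: "t1 \<le> s" and C: "0 < C"
    "\<And>u t. t1 \<le> u \<Longrightarrow> u \<le> t \<Longrightarrow> \<bar>r t - r u\<bar> \<le> C * u powr (- (a / 2) - 1) * (t - u)"
    and lim: "(r \<longlongrightarrow> 0) at_top"
    and e: "0 < e" "4 * pi * C * s powr (- (a / 2) - 1) < e"
  shows "ball 0 (r s) \<subseteq> eps_nbhd (curve ` {t0..}) e"
proof
  fix p :: "real \<times> real" assume "p \<in> ball 0 (r s)"
  then have p: "norm p < r s" by simp
  show "p \<in> eps_nbhd (curve ` {t0..}) e"
  proof (cases "p = 0")
    case True
    have "eventually (\<lambda>t. r t < e \<and> t0 \<le> t) at_top"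
      using order_tendstoD(2)[OF lim e(1)] eventually_ge_at_top by (rule eventually_conj)
    then obtain t where "r t < e" "t0 \<le> t"
      by (auto simp: eventually_at_top_linorder)
    then show ?thesis using True norm_curve[of t]
      by (auto simp: eps_nbhd_def dist_norm norm_minus_commute intro!: bexI[of _ t])
  next
    case False
    define \<rho> where "\<rho> = norm p"
    have \<rho>: "0 < \<rho>" "\<rho> < r s" using False p by (auto simp: \<rho>_def)
    have "eventually (\<lambda>t. r t < \<rho> \<and> s \<le> t) at_top"
      using order_tendstoD(2)[OF lim \<rho>(1)] eventually_ge_at_top by (rule eventually_conj)
    then obtain t' where t': "r t' < \<rho>" "s \<le> t'"
      by (auto simp: eventually_at_top_linorder)
    have "continuous_on {s..t'} r"
      by (rule continuous_on_subset[OF cont_r]) (use s t1_bounds in auto)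
    then obtain u where u: "s \<le> u" "r u = \<rho>"
      using IVT2'[of r t' \<rho> s] t' \<rho> by auto
    obtain x y where xy: "p = (x, y)" by (cases p)
    have "\<rho>\<^sup>2 = x\<^sup>2 + y\<^sup>2" by (simp add: xy \<rho>_def norm_Pair)
    then have "(x / \<rho>)\<^sup>2 + (- y / \<rho>)\<^sup>2 = \<rho>\<^sup>2 / \<rho>\<^sup>2"
      by (simp only: power_divide power2_minus add_divide_distrib)
    then have "(x / \<rho>)\<^sup>2 + (- y / \<rho>)\<^sup>2 = 1" using \<rho> by simp
    then obtain \<eta> where \<eta>: "x / \<rho> = cos \<eta>" "- y / \<rho> = sin \<eta>"
      by (rule sincos_total_2pi)
    \<comment> \<open>Rounding up makes \<open>v\<close> the first angle from \<open>\<theta> u\<close> on that has the direction of \<open>p\<close>.\<close>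
    define k where "k = \<lceil>(\<theta> u - \<eta>) / (2 * pi)\<rceil>"
    define v where "v = \<eta> + of_int k * (2 * pi)"
    have "(\<theta> u - \<eta>) / (2 * pi) \<le> of_int k" "of_int k < (\<theta> u - \<eta>) / (2 * pi) + 1"
      unfolding k_def by linarith+
    then have v: "\<theta> u \<le> v" "v \<le> \<theta> u + 2 * pi"
      by (simp_all add: v_def divide_le_eq less_divide_eq field_simps)
    have u1: "t1 \<le> u" using u s by simp
    obtain t where t: "u \<le> t" "t \<le> u + 2 * (v - \<theta> u)" "\<theta> t = v"
      using \<theta>_surj[OF u1 v(1)] by blast
    have tu: "t - u \<le> 4 * pi" using t v by simp
    have "sin v = sin \<eta> \<and> cos v = cos \<eta>"
      unfolding sin_cos_eq_iff v_def by (intro exI[of _ k]) simp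
    then have trig: "cos (\<theta> t) = x / \<rho>" "sin (\<theta> t) = - y / \<rho>"
      using t(3) \<eta> by simp_all
    have "p - curve t = ((\<rho> - r t) * cos (\<theta> t), - (\<rho> - r t) * sin (\<theta> t))"
      using \<rho> by (simp add: xy curve_def trig field_simps)
    moreover have "((\<rho> - r t) * cos (\<theta> t))\<^sup>2 + (- (\<rho> - r t) * sin (\<theta> t))\<^sup>2
        = (\<rho> - r t)\<^sup>2 * ((sin (\<theta> t))\<^sup>2 + (cos (\<theta> t))\<^sup>2)"
      by (simp only: power_mult_distrib power2_minus distrib_left add.commute)
    ultimately have "norm (p - curve t) = sqrt ((\<rho> - r t)\<^sup>2)"
      by (simp only: norm_Pair real_norm_def power2_abs sin_cos_squared_add mult_1_right)
    then have "norm (p - curve t) = \<bar>r t - r u\<bar>"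
      using u by (simp add: abs_minus_commute)
    also have "\<dots> \<le> C * u powr (- (a / 2) - 1) * (t - u)"
      by (rule C(2)[OF u1 t(1)])
    also have "\<dots> \<le> C * s powr (- (a / 2) - 1) * (4 * pi)"
      using C(1) tu t u s t1_bounds t0_pos a_pos
      by (intro mult_mono mult_left_mono powr_mono2') auto
    also have "\<dots> < e" using e(2) by (simp add: mult_ac)
    finally show ?thesis using t u1 t1_bounds
      by (auto simp: eps_nbhd_def dist_norm intro!: bexI[of _ t])
  qed
qed

lemma r_tendsto_0: "(r \<longlongrightarrow> 0) at_top"
proof -
  obtain C where C: "0 < C" "\<And>t. t0 \<le> t \<Longrightarrow> r t \<le> C * t powr (- (a / 2))"
    using r_asymp by blast
  have "((\<lambda>t. C * t powr (- (a / 2))) \<longlongrightarrow> C * 0) at_top"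
    using a_pos by (intro tendsto_intros tendsto_neg_powr filterlim_ident) auto
  then have "((\<lambda>t. C * t powr (- (a / 2))) \<longlongrightarrow> 0) at_top" by simp
  then show ?thesis
    by (rule tendsto_sandwich[rotated 2, OF tendsto_const])
       (use C r_pos in \<open>auto intro: eventually_at_top_linorderI[of t0] less_imp_le\<close>)
qed

lemma bounded_curve: "bounded (curve ` {t0..})"
proof -
  obtain C where C: "0 < C" "\<And>t. t0 \<le> t \<Longrightarrow> r t \<le> C * t powr (- (a / 2))"
    using r_asymp by blast
  have "norm (curve t) \<le> C * t0 powr (- (a / 2))" if "t0 \<le> t" for t
  proof -
    have "r t \<le> C * t powr (- (a / 2))" using C that by simp
    also have "\<dots> \<le> C * t0 powr (- (a / 2))"
      using C that t0_pos a_pos by (intro mult_left_mono powr_mono2') auto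
    finally show ?thesis using norm_curve[OF that] by simp
  qed
  then show ?thesis by (auto simp: bounded_iff)
qed

text \<open>The part of the curve after time \<open>w\<close> lies in a disc of radius of order \<open>w powr (- (a / 2))\<close>, the part
  before is a Lipschitz arc of parameter length \<open>w powr (1 - a / 2)\<close>; the width
  \<open>w powr (- (1 + a / 2))\<close> is the one for which both areas have the same order.\<close>

lemma emeasure_eps_nbhd_curve_upper:
  "\<exists>D. \<forall>w>t1. emeasure lborel (eps_nbhd (curve ` {t0..}) (w powr (- (1 + a / 2))))
     \<le> ennreal (D * (w powr (- (a / 2)))\<^sup>2)"
proof -
  obtain C where C: "0 < C" "\<And>t. t0 \<le> t \<Longrightarrow> r t \<le> C * t powr (- (a / 2))"
    using r_asymp by blast
  obtain L where L: "0 < L" "\<And>s t. t0 \<le> s \<Longrightarrow> t0 \<le> t \<Longrightarrow>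
      dist (curve s) (curve t) \<le> L * \<bar>s powr (1 - a / 2) - t powr (1 - a / 2)\<bar>"
    using curve_increment by blast
  define p where "p = 1 - a / 2"
  have p: "0 < p" using a_less by (simp add: p_def)
  define F where "F u = curve (u powr (1 / p))" for u
  have "emeasure lborel (eps_nbhd (curve ` {t0..}) (w powr (- (1 + a / 2))))
     \<le> ennreal ((pi * (C + 1)\<^sup>2 + 4 * pi * (L + 1)) * (w powr (- (a / 2)))\<^sup>2)" if w: "t1 < w" for w
  proof -
    define P where "P = w powr (- (a / 2))"
    define e where "e = w powr (- (1 + a / 2))"
    have w1: "1 < w" "t0 < w" "0 < w" using w t1_bounds by auto
    have P: "0 < P" using w1 by (simp add: P_def)
    have "- (1 + a / 2) = - (a / 2) - 1" by simp
    then have e: "e = P / w" "0 < e" using w1 by (simp_all only: P_def e_def powr_diff) simp_all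
    have eP: "e \<le> P" using w1 P by (simp add: e(1) divide_le_eq)
    have wP: "w powr p * e = P\<^sup>2"
      using w1 by (simp add: P_def e_def p_def powr_add[symmetric] power2_eq_square)
    have lip: "L-lipschitz_on {t0 powr p..w powr p} F"
    proof (rule lipschitz_onI)
      fix u v assume uv: "u \<in> {t0 powr p..w powr p}" "v \<in> {t0 powr p..w powr p}"
      have inv: "t0 \<le> u powr (1 / p)" "(u powr (1 / p)) powr p = u" if "t0 powr p \<le> u" for u
      proof -
        have "0 < u" using that t0_pos by (smt (verit) powr_gt_zero)
        then show "(u powr (1 / p)) powr p = u" using p by (simp add: powr_powr)
        have "(t0 powr p) powr (1 / p) \<le> u powr (1 / p)"
          using that p by (intro powr_mono2) auto
        then show "t0 \<le> u powr (1 / p)" using p t0_pos by (simp add: powr_powr)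
      qed
      show "dist (F u) (F v) \<le> L * dist u v"
        using L(2)[of "u powr (1 / p)" "v powr (1 / p)"] inv uv
        by (simp add: F_def p_def[symmetric] dist_real_def)
    qed (use L in simp)
    have sub: "eps_nbhd (curve ` {t0..}) e \<subseteq>
        ball 0 ((C + 1) * P) \<union> eps_nbhd (F ` {t0 powr p..w powr p}) e"
    proof
      fix y assume "y \<in> eps_nbhd (curve ` {t0..}) e"
      then obtain t where t: "t0 \<le> t" "dist y (curve t) < e"
        by (auto simp: eps_nbhd_def)
      show "y \<in> ball 0 ((C + 1) * P) \<union> eps_nbhd (F ` {t0 powr p..w powr p}) e"
      proof (cases "t \<le> w")
        case True
        have "curve t = F (t powr p)" using t t0_pos p by (simp add: F_def powr_powr)
        moreover have "t powr p \<in> {t0 powr p..w powr p}"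
          using t True t0_pos p by (auto intro!: powr_mono2)
        ultimately have "y \<in> eps_nbhd (F ` {t0 powr p..w powr p}) e"
          using t unfolding eps_nbhd_def by blast
        then show ?thesis by simp
      next
        case False
        have "norm (curve t) \<le> C * t powr (- (a / 2))" using C t norm_curve[of t] by simp
        also have "\<dots> \<le> C * P" unfolding P_def
          using C False w1 a_pos by (intro mult_left_mono powr_mono2') auto
        finally have "norm y < C * P + e"
          using t(2) norm_triangle_ineq2[of y "curve t"] by (simp add: dist_norm)
        then show ?thesis using eP by (simp add: algebra_simps)
      qed
    qed
    have "emeasure lborel (eps_nbhd (curve ` {t0..}) e) \<le>
        emeasure lborel (ball (0 :: real \<times> real) ((C + 1) * P) \<union> eps_nbhd (F ` {t0 powr p..w powr p}) e)"
      by (rule emeasure_mono[OF sub]) (auto intro: borel_open open_eps_nbhd)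
    also have "\<dots> \<le> emeasure lborel (ball (0 :: real \<times> real) ((C + 1) * P))
        + emeasure lborel (eps_nbhd (F ` {t0 powr p..w powr p}) e)"
      by (rule emeasure_subadditive) (auto intro: borel_open open_eps_nbhd)
    also have "\<dots> \<le> ennreal (pi * ((C + 1) * P)\<^sup>2)
        + ennreal (4 * pi * ((w powr p - t0 powr p) * L * e + e\<^sup>2))"
      using C P L e w1 t0_pos p
      by (intro add_mono emeasure_eps_nbhd_lipschitz_arc[OF lip]) (auto simp: emeasure_lborel_ball_plane intro!: powr_mono2)
    also have "\<dots> = ennreal (pi * ((C + 1) * P)\<^sup>2 + 4 * pi * ((w powr p - t0 powr p) * L * e + e\<^sup>2))"
    proof (intro ennreal_plus[symmetric] mult_nonneg_nonneg add_nonneg_nonneg)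
      show "0 \<le> w powr p - t0 powr p" using w1 t0_pos p by (simp add: powr_mono2)
    qed (use L e in auto)
    also have "\<dots> \<le> ennreal (pi * ((C + 1) * P)\<^sup>2 + 4 * pi * (L * P\<^sup>2 + P\<^sup>2))"
    proof (intro ennreal_leI add_left_mono mult_left_mono add_mono)
      have "(w powr p - t0 powr p) * L * e \<le> w powr p * L * e"
        using L e by (intro mult_right_mono) auto
      also have "\<dots> = L * P\<^sup>2" using wP by (simp add: mult_ac)
      finally show "(w powr p - t0 powr p) * L * e \<le> L * P\<^sup>2" .
      show "e\<^sup>2 \<le> P\<^sup>2" using eP e by (intro power_mono) auto
    qed simp
    also have "\<dots> = ennreal ((pi * (C + 1)\<^sup>2 + 4 * pi * (L + 1)) * P\<^sup>2)"
      by (simp only: power_mult_distrib) (simp add: algebra_simps)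
    finally show ?thesis by (simp add: P_def e_def)
  qed
  then show ?thesis by blast
qed

text \<open>At the time \<open>k w\<close>, for a constant \<open>k\<close>, the turns are closer than \<open>w powr (- (1 + a / 2))\<close>, so the
  nucleus is a disc of radius \<open>r (k w)\<close>.\<close>

lemma emeasure_eps_nbhd_curve_lower:
  "\<exists>c>0. \<forall>w>t1. ennreal (c * (w powr (- (a / 2)))\<^sup>2)
     \<le> emeasure lborel (eps_nbhd (curve ` {t0..}) (w powr (- (1 + a / 2))))"
proof -
  obtain c where c: "0 < c" "\<And>t. t0 \<le> t \<Longrightarrow> c * t powr (- (a / 2)) \<le> r t"
    using r_asymp by blast
  obtain C where C: "0 < C"
    "\<And>u t. t1 \<le> u \<Longrightarrow> u \<le> t \<Longrightarrow> \<bar>r t - r u\<bar> \<le> C * u powr (- (a / 2) - 1) * (t - u)"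
    using r_lipschitz_late by blast
  define p where "p = 1 + a / 2"
  have p: "0 < p" using a_pos by (simp add: p_def)
  \<comment> \<open>Chosen such that \<open>4 * pi * C * k powr (- p) < 1\<close>, as required for the nucleus.\<close>
  define k where "k = (4 * pi * C + 1) powr (1 / p)"
  have k1: "1 \<le> k" unfolding k_def using C p by (intro ge_one_powr_ge_zero) auto
  have minus_p: "- (a / 2) - 1 = - p" by (simp add: p_def)
  have kp: "k powr (- p) = 1 / (4 * pi * C + 1)"
    unfolding k_def using C p by (simp add: powr_powr powr_minus divide_simps)
  have "ennreal (pi * (c * k powr (- (a / 2)))\<^sup>2 * (w powr (- (a / 2)))\<^sup>2)
     \<le> emeasure lborel (eps_nbhd (curve ` {t0..}) (w powr (- (1 + a / 2))))" if w: "t1 < w" for w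
  proof -
    have w1: "1 < w" "t0 < w" "0 < w" using w t1_bounds by auto
    have kw: "w \<le> k * w" using k1 w1 by simp
    have late: "t1 \<le> k * w" "t0 \<le> k * w" using kw w w1 by linarith+
    have "4 * pi * C * (k * w) powr (- (a / 2) - 1) = 4 * pi * C * (k powr (- p) * w powr (- p))"
      using k1 w1 minus_p by (simp add: powr_mult)
    also have "\<dots> = 4 * pi * C / (4 * pi * C + 1) * w powr (- p)" by (simp add: kp)
    also have "\<dots> < 1 * w powr (- p)"
      using C w1 by (intro mult_strict_right_mono) (auto simp: divide_less_eq add_pos_pos)
    finally have small: "4 * pi * C * (k * w) powr (- (a / 2) - 1) < w powr (- (1 + a / 2))"
      by (simp add: p_def)
    have sub: "ball 0 (r (k * w)) \<subseteq> eps_nbhd (curve ` {t0..}) (w powr (- (1 + a / 2)))"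
      by (rule curve_nucleus[OF late(1) C r_tendsto_0 _ small]) (use w1 in auto)
    have "c * k powr (- (a / 2)) * w powr (- (a / 2)) \<le> r (k * w)"
      using c(2)[OF late(2)] k1 w1 by (simp add: powr_mult mult_ac)
    then have "(c * k powr (- (a / 2)) * w powr (- (a / 2)))\<^sup>2 \<le> (r (k * w))\<^sup>2"
      using c by (intro power_mono) auto
    then have "ennreal (pi * (c * k powr (- (a / 2)))\<^sup>2 * (w powr (- (a / 2)))\<^sup>2)
        \<le> ennreal (pi * (r (k * w))\<^sup>2)"
      by (intro ennreal_leI) (simp add: power_mult_distrib mult_ac)
    also have "\<dots> = emeasure lborel (ball (0 :: real \<times> real) (r (k * w)))"
      using r_pos[OF late(2)] by (simp add: emeasure_lborel_ball_plane)
    also have "\<dots> \<le> emeasure lborel (eps_nbhd (curve ` {t0..}) (w powr (- (1 + a / 2))))"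
      by (rule emeasure_mono[OF sub]) (auto intro: borel_open open_eps_nbhd)
    finally show ?thesis .
  qed
  moreover have "0 < pi * (c * k powr (- (a / 2)))\<^sup>2"
    using c k1 by auto
  ultimately show ?thesis by blast
qed

theorem has_box_dim_curve: "has_box_dim (curve ` {t0..}) (4 / (2 + a))"
proof -
  obtain D where D: "\<And>w. t1 < w \<Longrightarrow> emeasure lborel (eps_nbhd (curve ` {t0..}) (w powr (- (1 + a / 2))))
     \<le> ennreal (D * (w powr (- (a / 2)))\<^sup>2)"
    using emeasure_eps_nbhd_curve_upper by blast
  obtain c where c: "0 < c" "\<And>w. t1 < w \<Longrightarrow> ennreal (c * (w powr (- (a / 2)))\<^sup>2)
     \<le> emeasure lborel (eps_nbhd (curve ` {t0..}) (w powr (- (1 + a / 2))))"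
    using emeasure_eps_nbhd_curve_lower by blast
  define p where "p = 1 + a / 2"
  have p: "0 < p" using a_pos by (simp add: p_def)
  define e0 where "e0 = t1 powr (- p)"
  define w where "w e = e powr (- 1 / p)" for e :: real
  have w: "t1 < w e" "w e powr (- p) = e"
    "(w e powr (- (a / 2)))\<^sup>2 = e powr (real DIM(real \<times> real) - 4 / (2 + a))" if "0 < e" "e < e0" for e
  proof -
    have "(t1 powr (- p)) powr (- 1 / p) < e powr (- 1 / p)"
      using that p by (intro powr_less_mono2_neg) (auto simp: e0_def)
    then show "t1 < w e" using p t1_bounds by (simp add: powr_powr w_def)
    show "w e powr (- p) = e" using p that by (simp add: w_def powr_powr)
    have "(w e powr (- (a / 2)))\<^sup>2 = e powr (2 * (- 1 / p * (- (a / 2))))"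
      using that by (simp add: w_def powr_powr powr_add[symmetric] power2_eq_square)
    also have "2 * (- 1 / p * (- (a / 2))) = 2 - 4 / (2 + a)"
      using a_pos by (simp add: p_def field_simps)
    finally show "(w e powr (- (a / 2)))\<^sup>2 = e powr (real DIM(real \<times> real) - 4 / (2 + a))" by simp
  qed
  show ?thesis
  proof (rule has_box_dimI[OF bounded_curve _ c(1)])
    show "0 < e0" using t1_bounds by (simp add: e0_def)
    show "0 \<le> 4 / (2 + a)" using a_pos by simp
  next
    fix e :: real assume e: "0 < e" "e < e0"
    show "ennreal (c * e powr (real DIM(real \<times> real) - 4 / (2 + a)))
        \<le> emeasure lborel (eps_nbhd (curve ` {t0..}) e)"
      using c(2)[OF w(1)[OF e]] w(2)[OF e] unfolding w(3)[OF e] by (simp add: p_def)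
    show "emeasure lborel (eps_nbhd (curve ` {t0..}) e)
        \<le> ennreal (D * e powr (real DIM(real \<times> real) - 4 / (2 + a)))"
      using D[OF w(1)[OF e]] w(2)[OF e] unfolding w(3)[OF e] by (simp add: p_def)
  qed
qed

end

section \<open>The phase curve as a spiral\<close>

text \<open>Shifting both arguments by the same multiple of \<open>pi\<close> changes both signs or none. This reduces
  the sign of the product to arguments between \<open>- pi\<close> and \<open>pi\<close>.\<close>

lemma sin_mult_sin_shift:
  "sin x * sin y = sin (x - real m * pi) * sin (y - real m * pi)"
proof -
  have "(-1 :: real) ^ m * (-1) ^ m = 1" by (simp add: power_mult_distrib[symmetric])
  then show ?thesis
    by (simp add: sin_diff sin_npi cos_npi algebra_simps)
qed

context pruefer_system
begin

lemma \<theta>_image: "t1 \<le> T \<Longrightarrow> (\<lambda>t. - \<theta> t) ` {T..} = {..- \<theta> T}"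
proof (intro equalityI subsetI)
  fix v assume "t1 \<le> T" "v \<in> {..- \<theta> T}"
  then obtain t where "T \<le> t" "\<theta> t = - v"
    using \<theta>_surj[of T "- v"] by auto
  then show "v \<in> (\<lambda>t. - \<theta> t) ` {T..}" by force
next
  fix v assume "t1 \<le> T" "v \<in> (\<lambda>t. - \<theta> t) ` {T..}"
  then show "v \<in> {..- \<theta> T}" using \<theta>_less[of T] by (auto simp: le_less)
qed

text \<open>The angle is comparable to the time, so the power law of the radius in time is one in the angle.\<close>

lemma comparable_radius:
  assumes T: "t1 \<le> T" "0 < \<theta> T" and g: "\<And>t. T \<le> t \<Longrightarrow> g (- \<theta> t) = r t"
  shows "comparable at_bot g (\<lambda>s. \<bar>s\<bar> powr (- (a / 2)))"
proof -
  obtain c C where c: "0 < c" "\<And>t. t0 \<le> t \<Longrightarrow> c * t powr (- (a / 2)) \<le> r t"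
    and C: "0 < C" "\<And>t. t0 \<le> t \<Longrightarrow> r t \<le> C * t powr (- (a / 2))"
    using r_asymp by blast
  define T' where "T' = max T (max (2 * t1 - 4 * \<theta> t1) (\<theta> t1 - 2 * t1))"
  have T': "T \<le> T'" "t1 \<le> T'" using T by (auto simp: T'_def)
  have *: "3 powr (- (a / 2)) / C * g s \<le> \<bar>s\<bar> powr (- (a / 2)) \<and>
      \<bar>s\<bar> powr (- (a / 2)) \<le> (1 / 4) powr (- (a / 2)) / c * g s" if s: "s \<le> - \<theta> T'" for s
  proof -
    obtain t where t: "T' \<le> t" "s = - \<theta> t"
      using \<theta>_image[OF T'(2)] s by (metis atLeast_iff atMost_iff imageE)
    have tt: "t1 \<le> t" "T \<le> t" "2 * t1 - 4 * \<theta> t1 \<le> t" "\<theta> t1 - 2 * t1 \<le> t" "0 < t" "t0 \<le> t"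
      using t T t1_bounds by (auto simp: T'_def)
    have th: "t / 4 \<le> \<theta> t" "\<theta> t \<le> 3 * t"
      using \<theta>_increment[of t1 t] tt by auto
    have pos: "0 < \<theta> t" using th tt by auto
    have abs: "\<bar>s\<bar> = \<theta> t" using t pos by simp
    have gs: "g s = r t" using g[OF tt(2)] t by simp
    have "(3 * t) powr (- (a / 2)) \<le> (\<theta> t) powr (- (a / 2))"
      using th pos a_pos by (intro powr_mono2') auto
    then have 1: "3 powr (- (a / 2)) * t powr (- (a / 2)) \<le> (\<theta> t) powr (- (a / 2))"
      using tt by (simp add: powr_mult)
    have "(\<theta> t) powr (- (a / 2)) \<le> (1 / 4 * t) powr (- (a / 2))"
      using th tt a_pos by (intro powr_mono2') auto
    then have 2: "(\<theta> t) powr (- (a / 2)) \<le> (1 / 4) powr (- (a / 2)) * t powr (- (a / 2))"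
      using tt by (subst (asm) powr_mult) auto
    have "3 powr (- (a / 2)) / C * r t \<le> 3 powr (- (a / 2)) / C * (C * t powr (- (a / 2)))"
      using C tt by (intro mult_left_mono) auto
    then have 3: "3 powr (- (a / 2)) / C * g s \<le> \<bar>s\<bar> powr (- (a / 2))"
      using 1 C unfolding gs abs by simp
    have "(1 / 4) powr (- (a / 2)) / c * (c * t powr (- (a / 2))) \<le> (1 / 4) powr (- (a / 2)) / c * r t"
      using c tt by (intro mult_left_mono) auto
    then have 4: "\<bar>s\<bar> powr (- (a / 2)) \<le> (1 / 4) powr (- (a / 2)) / c * g s"
      using 2 c unfolding gs abs by simp
    show ?thesis using 3 4 by simp
  qed
  have "eventually (\<lambda>s. 3 powr (- (a / 2)) / C * g s \<le> \<bar>s\<bar> powr (- (a / 2)) \<and>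
      \<bar>s\<bar> powr (- (a / 2)) \<le> (1 / 4) powr (- (a / 2)) / c * g s) at_bot"
    unfolding eventually_at_bot_linorder using * by blast
  moreover have "0 < 3 powr (- (a / 2)) / C" "0 < (1 / 4) powr (- (a / 2)) / c"
    using C c by auto
  ultimately show ?thesis unfolding comparable_def by blast
qed

lemma is_spiral_radius:
  assumes T: "t2 \<le> T" "0 < \<theta> T" and g: "\<And>t. T \<le> t \<Longrightarrow> g (- \<theta> t) = r t"
  shows "is_spiral g {..- \<theta> T}"
proof -
  have T1: "t1 \<le> T" "t0 \<le> T" using T t1_bounds by (auto simp: t2_def)
  have time: "\<exists>t\<ge>T. \<theta> t = s \<and> g (- s) = r t" if s: "\<theta> T \<le> s" for s
  proof -
    obtain t where t: "T \<le> t" "\<theta> t = s" using \<theta>_surj[OF T1(1) s] by blast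
    then show ?thesis using g[OF t(1)] by auto
  qed
  obtain c C where cC: "0 < c" "0 < C"
    "eventually (\<lambda>s. c * g s \<le> \<bar>s\<bar> powr (- (a / 2)) \<and> \<bar>s\<bar> powr (- (a / 2)) \<le> C * g s) at_bot"
    using comparable_radius[OF T1(1) T(2) g] unfolding comparable_def by blast
  have pos: "0 < g (- s)" if "\<theta> T \<le> s" for s
    using time[OF that] r_pos T1 by force
  have "((\<lambda>s. g (- s)) \<longlongrightarrow> 0) at_top"
  proof (rule tendsto_sandwich)
    show "eventually (\<lambda>s. 0 \<le> g (- s)) at_top"
      using pos by (intro eventually_at_top_linorderI[of "\<theta> T"]) (simp add: less_imp_le)
    have "eventually (\<lambda>s. c * g (- s) \<le> \<bar>- s\<bar> powr (- (a / 2)) \<and> \<bar>- s\<bar> powr (- (a / 2)) \<le> C * g (- s)) at_top"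
      using cC(3) unfolding at_bot_mirror eventually_filtermap .
    then show "eventually (\<lambda>s. g (- s) \<le> 1 / c * s powr (- (a / 2))) at_top"
      using eventually_ge_at_top[of 0]
    proof eventually_elim
      case (elim s)
      then show ?case using cC(1) by (simp add: pos_le_divide_eq mult.commute)
    qed
    have "((\<lambda>s. 1 / c * s powr (- (a / 2))) \<longlongrightarrow> 1 / c * 0) at_top"
      using a_pos by (intro tendsto_intros tendsto_neg_powr filterlim_ident) auto
    then show "((\<lambda>s. 1 / c * s powr (- (a / 2))) \<longlongrightarrow> 0) at_top" by simp
  qed simp
  moreover have "g (- (s + 2 * real l * pi)) < g (- (s + 2 * real k * pi))"
    if s: "\<theta> T \<le> s" and kl: "k < l" for s k l
  proof -
    have le: "\<theta> T \<le> s + 2 * real i * pi" for i using s by (simp add: add_increasing2)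
    obtain t where t: "T \<le> t" "\<theta> t = s + 2 * real k * pi" "g (- (s + 2 * real k * pi)) = r t"
      using time[OF le[of k]] by blast
    obtain u where u: "T \<le> u" "\<theta> u = s + 2 * real l * pi" "g (- (s + 2 * real l * pi)) = r u"
      using time[OF le[of l]] by blast
    have eq: "\<theta> u = \<theta> t + 2 * pi * real (l - k)"
      using kl by (simp add: t u of_nat_diff algebra_simps)
    then have "\<theta> t < \<theta> u" using kl by simp
    then have "t < u" using \<theta>_less_iff[of t u] t u T1 by simp
    then show ?thesis using r_radially_decreasing[of t u "l - k"] t u T eq by simp
  qed
  ultimately have "spiral_pos (\<lambda>s. g (- s)) (\<theta> T)"
    unfolding spiral_pos_def using T pos by auto
  then show ?thesis unfolding is_spiral_def by blast
qed

subsection \<open>The case without waves\<close>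

text \<open>Here \<open>r' = - r (a / t) sin\<^sup>2 \<theta>\<close>, which cannot vanish on an interval because \<open>\<theta>\<close> increases strictly.\<close>

lemma r_strict_decreasing:
  assumes "q = 0" "t1 \<le> s" "s < t"
  shows "r t < r s"
proof (rule ccontr)
  assume "\<not> r t < r s"
  have dr: "dr u \<le> 0" "dr u = 0 \<Longrightarrow> sin (\<theta> u) = 0" if "t1 \<le> u" for u
  proof -
    have u: "0 < r u" "0 < a / u" using that r_pos[of u] t1_bounds a_pos by auto
    have "dr u = - (r u * (a / u) * (sin (\<theta> u))\<^sup>2)" unfolding dr_def using \<open>q = 0\<close> by simp
    moreover have "0 \<le> r u * (a / u) * (sin (\<theta> u))\<^sup>2"
      by (intro mult_nonneg_nonneg) (use u in auto)
    ultimately show "dr u \<le> 0" "dr u = 0 \<Longrightarrow> sin (\<theta> u) = 0" using u by auto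
  qed
  have dec: "r v \<le> r u" if "t1 \<le> u" "u \<le> v" for u v
    using that(2)
  proof (rule DERIV_nonpos_imp_nonincreasing)
    fix w assume "u \<le> w" "w \<le> v"
    then show "\<exists>y. (r has_real_derivative y) (at w) \<and> y \<le> 0"
      using r_at[of w] dr(1)[of w] that t1_bounds by (intro exI[of _ "dr w"]) auto
  qed
  have const: "r u = r s" if "s \<le> u" "u \<le> t" for u
    using dec[of s u] dec[of u t] that assms \<open>\<not> r t < r s\<close> by linarith
  have zero: "sin (\<theta> u) = 0" if u: "s < u" "u < t" for u
  proof -
    have "(r has_real_derivative 0) (at u)"
    proof (rule has_field_derivative_transform_within_open[of "\<lambda>_. r s"])
      show "open {s<..<t}" "u \<in> {s<..<t}" using u by auto
      show "r s = r v" if "v \<in> {s<..<t}" for v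
        by (rule const[symmetric]) (use that in auto)
    qed simp
    moreover have "(r has_real_derivative dr u) (at u)"
      using r_at[of u] u assms t1_bounds by simp
    ultimately have "dr u = 0" using DERIV_unique by blast
    then show ?thesis using dr(2)[of u] u assms by simp
  qed
  \<comment> \<open>Two times in the interval whose angles differ by less than \<open>pi\<close>.\<close>
  define h where "h = min 1 (t - s) / 3"
  have h: "0 < h" "s + 2 * h < t" "h < 1"
    using assms(3) by (cases "1 \<le> t - s"; simp add: h_def field_simps)+
  have "0 < \<theta> (s + 2 * h) - \<theta> (s + h)" "\<theta> (s + 2 * h) - \<theta> (s + h) < pi"
    using \<theta>_increment[of "s + h" "s + 2 * h"] h assms pi_gt3 by auto
  then have "0 < sin (\<theta> (s + 2 * h) - \<theta> (s + h))" by (rule sin_gt_zero)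
  then show False using zero[of "s + h"] zero[of "s + 2 * h"] h by (simp add: sin_diff)
qed

text \<open>A wave would take \<open>g \<circ> \<psi>\<close> twice to the same value, but both \<open>g\<close> and \<open>\<psi>\<close> are injective.\<close>

lemma not_wavy:
  assumes q: "q = 0" and T: "t1 \<le> T" and g: "\<And>t. T \<le> t \<Longrightarrow> g (- \<theta> t) = r t"
  shows "\<not> is_wavy_spiral g {..- \<theta> T}"
proof
  assume "is_wavy_spiral g {..- \<theta> T}"
  then obtain u0 \<psi> W where \<psi>: "strict_mono_on {u0..} \<psi> \<or> strict_antimono_on {u0..} \<psi>"
    "\<psi> ` {u0..} \<subseteq> {..- \<theta> T}"
    and W: "wave_sequence u0 (\<lambda>t. g (\<psi> t)) W" "waviness (\<lambda>t. g (\<psi> t)) W"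
    unfolding is_wavy_spiral_def wavy_function_def by blast
  have inj_g: "inj_on g {..- \<theta> T}"
  proof (rule inj_onI)
    fix x y assume xy: "x \<in> {..- \<theta> T}" "y \<in> {..- \<theta> T}" "g x = g y"
    obtain s where s: "T \<le> s" "x = - \<theta> s" using \<theta>_image[OF T] xy by (metis atLeast_iff imageE)
    obtain t where t: "T \<le> t" "y = - \<theta> t" using \<theta>_image[OF T] xy by (metis atLeast_iff imageE)
    have "r s = r t" using xy s t g by auto
    then have "s = t"
      using r_strict_decreasing[OF q, of s t] r_strict_decreasing[OF q, of t s] s t T
      by (cases s t rule: linorder_cases) auto
    then show "x = y" using s t by simp
  qed
  have inj_\<psi>: "inj_on \<psi> {u0..}"
    using \<psi>(1)
  proof
    assume "strict_mono_on {u0..} \<psi>"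
    then show ?thesis by (rule strict_mono_on_imp_inj_on)
  next
    assume "strict_antimono_on {u0..} \<psi>"
    then have "strict_mono_on {u0..} (\<lambda>t. - \<psi> t)"
      by (auto simp: monotone_on_def)
    then have "inj_on (\<lambda>t. - \<psi> t) {u0..}" by (rule strict_mono_on_imp_inj_on)
    then show ?thesis by (simp add: inj_on_def)
  qed
  have "{t. t > W (2 * 0 + 1) \<and> g (\<psi> t) = g (\<psi> (W (2 * 0 + 1)))} \<noteq> {}"
    using W(1) unfolding wave_sequence_def by blast
  then have "\<exists>t. t > W 1 \<and> g (\<psi> t) = g (\<psi> (W 1))" by auto
  moreover have "W 0 = u0" using W(1) unfolding wave_sequence_def by blast
  moreover have "W 0 < W 1" using W(2) by (simp add: waviness_def strict_mono_def)
  ultimately obtain t where t: "u0 \<le> W 1" "W 1 < t" "g (\<psi> t) = g (\<psi> (W 1))" by auto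
  have "\<psi> t = \<psi> (W 1)"
    by (rule inj_onD[OF inj_g t(3)]) (use t \<psi>(2) in \<open>auto simp: image_subset_iff\<close>)
  then have "t = W 1" by (rule inj_onD[OF inj_\<psi>]) (use t in auto)
  then show False using t by simp
qed

subsection \<open>The case with waves\<close>

text \<open>The angle \<open>\<delta>\<close> combines the two terms of \<open>r'\<close> into one sine:
  \<open>a sin \<theta> + (q / t) cos \<theta>\<close> is a positive multiple of \<open>sin (\<theta> + \<delta>)\<close>.\<close>

definition \<delta> :: "real \<Rightarrow> real" where
  "\<delta> t = arctan (q / (a * t))"

definition \<eta> :: "real \<Rightarrow> real" where
  "\<eta> t = \<theta> t + \<delta> t"

text \<open>Beyond \<open>8 * q / a\<close> the angle \<open>\<delta>\<close> is below \<open>pi / 4\<close> and varies so slowly that the shifted angle \<open>\<eta>\<close>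
  increases; together with \<open>4 * K / a\<close> this also makes the decay after a wave exceed its growth.\<close>

definition t3 :: real where
  "t3 = t2 + 8 * q / a + 4 * K / a + 1"

lemma t3_bounds:
  assumes "t3 \<le> t"
  shows "t2 \<le> t" "t1 \<le> t" "t0 < t" "1 < t" "8 * q / a < t" "4 * K / a < t"
proof -
  have "0 \<le> 8 * q / a" "0 < 4 * K / a" using q_nonneg a_pos K_pos by auto
  then show "t2 \<le> t" "t1 \<le> t" "t0 < t" "1 < t" "8 * q / a < t" "4 * K / a < t"
    using assms t1_bounds unfolding t3_def t2_def by linarith+
qed

lemma \<delta>_bounds:
  assumes "0 < q" "t3 \<le> t"
  shows "0 < \<delta> t" "\<delta> t < pi / 4" "\<delta> t \<le> q / (a * t)"
proof -
  have t: "0 < t" "8 * q < t * a" using t3_bounds[OF assms(2)] a_pos by (auto simp: divide_less_eq)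
  have y: "0 < q / (a * t)" "q / (a * t) < 1"
    using t a_pos assms by (auto simp: divide_less_eq mult.commute)
  show "0 < \<delta> t" using y by (simp add: \<delta>_def)
  show "\<delta> t < pi / 4" using y arctan_less_iff[of "q / (a * t)" 1] by (simp add: \<delta>_def arctan_one)
  show "\<delta> t \<le> q / (a * t)" using y by (simp add: \<delta>_def arctan_le_self)
qed

text \<open>Both sign changes of \<open>r'\<close> in a half turn become visible: at the zeros of \<open>sin \<theta>\<close> and of \<open>sin \<eta>\<close>.\<close>

lemma dr_product:
  assumes "t0 \<le> t"
  shows "\<exists>A>0. dr t = - (A * (sin (\<theta> t) * sin (\<eta> t)))"
proof -
  have t: "0 < t" using assms t0_pos by simp
  have c: "0 < cos (\<delta> t)" unfolding \<delta>_def cos_arctan by (simp add: add_pos_nonneg)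
  have "sin (\<delta> t) = cos (\<delta> t) * (q / (a * t))"
    unfolding \<delta>_def cos_arctan sin_arctan by simp
  then have s: "sin (\<eta> t) = cos (\<delta> t) * (sin (\<theta> t) + q / (a * t) * cos (\<theta> t))"
    by (simp add: \<eta>_def sin_add algebra_simps)
  have "dr t = - (r t * a / (t * cos (\<delta> t)) * (sin (\<theta> t) * sin (\<eta> t)))"
    unfolding s dr_def using t c a_pos by (simp add: field_simps power2_eq_square)
  moreover have "0 < r t * a / (t * cos (\<delta> t))" using t c a_pos r_pos[OF assms] by simp
  ultimately show ?thesis by blast
qed

lemma cont_\<eta>: "continuous_on {t3..} \<eta>"
proof -
  have "t0 \<le> t" "t \<noteq> 0" if "t \<in> {t3..}" for t using t3_bounds[of t] that by auto
  then show ?thesis unfolding \<eta>_def[abs_def] \<delta>_def[abs_def]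
    using a_pos by (intro continuous_intros continuous_on_subset[OF cont_\<theta>]) auto
qed

text \<open>The decreasing \<open>\<delta>\<close> changes at a rate of order \<open>1 / t\<^sup>2\<close> only, too slowly to stop the growth of \<open>\<theta>\<close>.\<close>

lemma \<eta>_less:
  assumes "0 < q" "t3 \<le> s" "s < t"
  shows "\<eta> s < \<eta> t"
  using assms(3)
proof (rule DERIV_pos_imp_increasing)
  fix u assume "s \<le> u" "u \<le> t"
  then have u: "t3 \<le> u" "0 < u" "1 < u" "t0 < u" "t1 \<le> u" "8 * q / a < u"
    using assms t3_bounds[of u] by auto
  let ?y = "q / (a * u)"
  let ?D = "d\<theta> u - q / (a * u\<^sup>2) / (1 + ?y\<^sup>2)"
  have "(\<eta> has_real_derivative ?D) (at u)"
    unfolding \<eta>_def[abs_def] \<delta>_def[abs_def]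
    using u a_pos
    by (auto intro!: derivative_eq_intros \<theta>_at simp: power2_eq_square divide_inverse)
  moreover have "0 < ?D"
  proof -
    have "q / (a * u\<^sup>2) / (1 + ?y\<^sup>2) \<le> q / (a * u\<^sup>2) / 1"
      using a_pos assms u by (intro divide_left_mono) (auto intro!: add_pos_nonneg)
    also have "\<dots> = (q / a) / u\<^sup>2" by simp
    also have "q / a \<le> u / 8"
    proof -
      have "8 * (q / a) < u" using u by simp
      then show ?thesis by linarith
    qed
    then have "(q / a) / u\<^sup>2 \<le> (u / 8) / u\<^sup>2" by (rule divide_right_mono) simp
    also have "\<dots> \<le> 1 / 8" using u by (simp add: power2_eq_square divide_le_eq)
    finally show ?thesis using d\<theta>_bounds(1)[OF u(5)] by linarith
  qed
  ultimately show "\<exists>y. (\<eta> has_real_derivative y) (at u) \<and> 0 < y" by blast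
qed

lemma \<eta>_less_iff: "0 < q \<Longrightarrow> t3 \<le> s \<Longrightarrow> t3 \<le> t \<Longrightarrow> \<eta> s < \<eta> t \<longleftrightarrow> s < t"
  using \<eta>_less[of s t] \<eta>_less[of t s] by (cases s t rule: linorder_cases) auto

text \<open>A multiple of \<open>pi\<close> between \<open>\<theta>\<close> and \<open>\<eta>\<close> makes their sines differ in sign.\<close>

lemma dr_pos:
  assumes "0 < q" "t3 \<le> t" "\<theta> t < real m * pi" "real m * pi < \<eta> t"
  shows "0 < dr t"
proof -
  obtain A where A: "0 < A" "dr t = - (A * (sin (\<theta> t) * sin (\<eta> t)))"
    using dr_product[of t] t3_bounds[OF assms(2)] by auto
  have d: "\<delta> t < pi / 4" using \<delta>_bounds assms by simp
  have "sin (\<theta> t - real m * pi) < 0"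
    using assms d by (intro sin_less_zero) (auto simp: \<eta>_def)
  moreover have "0 < sin (\<eta> t - real m * pi)"
    using assms d by (intro sin_gt_zero) (auto simp: \<eta>_def)
  ultimately have "sin (\<theta> t) * sin (\<eta> t) < 0"
    by (subst sin_mult_sin_shift[of _ _ m], rule mult_neg_pos)
  then show ?thesis using A by (simp add: mult_pos_neg)
qed

lemma dr_nonpos:
  assumes "0 < q" "t3 \<le> t" "real m * pi \<le> \<theta> t" "\<eta> t \<le> real (Suc m) * pi"
  shows "dr t \<le> 0"
    and "real m * pi < \<theta> t \<Longrightarrow> \<eta> t < real (Suc m) * pi \<Longrightarrow> dr t < 0"
proof -
  obtain A where A: "0 < A" "dr t = - (A * (sin (\<theta> t) * sin (\<eta> t)))"
    using dr_product[of t] t3_bounds[OF assms(2)] by auto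
  have d: "0 < \<delta> t" using \<delta>_bounds assms by simp
  have ge: "0 \<le> sin (\<theta> t - real m * pi)" "0 \<le> sin (\<eta> t - real m * pi)"
    using assms d by (intro sin_ge_zero; auto simp: \<eta>_def algebra_simps)+
  then have "0 \<le> sin (\<theta> t) * sin (\<eta> t)"
    by (subst sin_mult_sin_shift[of _ _ m], rule mult_nonneg_nonneg)
  then show "dr t \<le> 0" using A by (simp add: zero_le_mult_iff)
  assume "real m * pi < \<theta> t" "\<eta> t < real (Suc m) * pi"
  then have "0 < sin (\<theta> t - real m * pi)" "0 < sin (\<eta> t - real m * pi)"
    using d by (intro sin_gt_zero; auto simp: \<eta>_def algebra_simps)+
  then have "0 < sin (\<theta> t) * sin (\<eta> t)"
    by (subst sin_mult_sin_shift[of _ _ m], rule mult_pos_pos)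
  then show "dr t < 0" using A by (simp add: zero_less_mult_iff)
qed

text \<open>At \<open>d\<close> the oscillating term of the energy vanishes, and at \<open>b\<close> it is of order \<open>1 / b\<^sup>2\<close> as \<open>\<theta> b\<close> differs
  from \<open>m pi\<close> by the small \<open>\<delta> b\<close>. So the secular decrease over at least the time \<open>1 / 2\<close>, which is of
  order \<open>1 / b\<close>, prevails.\<close>

lemma r_after_wave:
  assumes q: "0 < q" and b: "t3 \<le> b" "\<eta> b = real m * pi"
    and d: "b \<le> d" "\<theta> d = real m * pi + pi / 2"
  shows "r d < r b"
proof -
  note tb = t3_bounds[OF b(1)]
  have pos: "0 < b" "0 < d" using tb d by auto
  have \<delta>b: "0 < \<delta> b" "\<delta> b < pi / 4" "\<delta> b \<le> q / (a * b)" using \<delta>_bounds[OF q b(1)] by auto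
  have \<theta>b: "\<theta> b = real m * pi - \<delta> b" using b(2) by (simp add: \<eta>_def)
  have s0: "sin (2 * \<theta> d) = 0"
  proof -
    have "2 * \<theta> d = real (2 * m + 1) * pi" by (simp add: d(2) algebra_simps)
    then show ?thesis by (simp only: sin_npi)
  qed
  have "sin (2 * \<theta> b) = - sin (2 * \<delta> b)"
  proof -
    have "2 * \<theta> b = real (2 * m) * pi - 2 * \<delta> b" by (simp add: \<theta>b algebra_simps)
    then show ?thesis by (simp only: sin_diff sin_npi cos_npi) simp
  qed
  moreover have "sin (2 * \<delta> b) \<le> 2 * \<delta> b" using \<delta>b by (intro sin_x_le_x) auto
  ultimately have "- sin (2 * \<theta> b) \<le> 2 * (q / (a * b))" using \<delta>b by linarith
  then have "a / 4 * (- sin (2 * \<theta> b) / b) \<le> a / 4 * (2 * (q / (a * b)) / b)"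
    using a_pos pos by (intro mult_left_mono divide_right_mono) auto
  also have "\<dots> = q / (2 * b\<^sup>2)" using a_pos pos by (simp add: field_simps power2_eq_square)
  finally have wave: "a / 4 * (sin (2 * \<theta> d) / d - sin (2 * \<theta> b) / b) \<le> q / (2 * b\<^sup>2)"
    by (simp add: s0)
  have "\<theta> d - \<theta> b \<le> 2 * (d - b)" using \<theta>_increment(2)[of b d] tb d by simp
  then have len: "1 / 2 \<le> d - b" using d(2) \<theta>b \<delta>b pi_gt3 by simp
  have frac: "1 / (4 * b) \<le> (d - b) / d"
  proof -
    have "b / d \<le> b / (b + 1 / 2)" using len pos by (intro divide_left_mono) auto
    moreover have "b / (b + 1 / 2) \<le> 1 - 1 / (4 * b)"
      using tb by (simp add: field_simps)
    ultimately show ?thesis using pos by (simp add: diff_divide_distrib)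
  qed
  have "4 * K / a < b" using tb by simp
  then have "K / b - a / 2 \<le> - (a / 4)" using pos a_pos by (simp add: field_simps)
  then have "(d - b) / d * (K / b - a / 2) \<le> (d - b) / d * (- (a / 4))"
    using pos d by (intro mult_left_mono) auto
  also have "\<dots> \<le> 1 / (4 * b) * (- (a / 4))"
    using frac a_pos by (intro mult_right_mono_neg) auto
  finally have "ln (r d) - ln (r b) \<le> 1 / (4 * b) * (- (a / 4)) + q / (2 * b\<^sup>2)"
    using ln_r_drop[of b d] tb d wave by linarith
  also have "\<dots> < 0"
  proof -
    have "8 * q < a * b" using tb a_pos by (simp add: divide_less_eq mult.commute)
    then show ?thesis using pos by (simp add: field_simps power2_eq_square)
  qed
  finally show ?thesis using r_pos[of b] r_pos[of d] tb d by simp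
qed

text \<open>The \<open>m\<close>-th wave: \<open>r\<close> increases from \<open>b\<close> to \<open>c\<close> and decreases from \<open>c\<close> to \<open>d\<close>, below \<open>r b\<close>, so it
  passes the value \<open>r b\<close> at a time \<open>e\<close> in between.\<close>

lemma wave:
  assumes q: "0 < q" and m: "\<theta> t3 + 1 \<le> real m * pi"
  shows "\<exists>b c e d. t3 \<le> b \<and> b < c \<and> c < e \<and> e \<le> d \<and> \<eta> b = real m * pi \<and> \<theta> c = real m * pi \<and>
    \<theta> d = real m * pi + pi / 2 \<and> r e = r b \<and> (\<forall>t. b < t \<and> t < e \<longrightarrow> r b < r t)"
proof -
  have t33: "t1 \<le> t3" using t3_bounds[of t3] by simp
  obtain c where c: "t3 \<le> c" "\<theta> c = real m * pi"
    using \<theta>_surj[OF t33, of "real m * pi"] m by auto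
  obtain d where d: "c \<le> d" "\<theta> d = real m * pi + pi / 2"
    using \<theta>_surj[of c "real m * pi + pi / 2"] c t33 by auto
  have "\<eta> t3 \<le> real m * pi" using \<delta>_bounds[OF q, of t3] m pi_less_4 by (simp add: \<eta>_def)
  moreover have "real m * pi \<le> \<eta> c" using \<delta>_bounds[OF q c(1)] c by (simp add: \<eta>_def)
  moreover have "continuous_on {t3..c} \<eta>" by (rule continuous_on_subset[OF cont_\<eta>]) auto
  ultimately obtain b where b: "t3 \<le> b" "b \<le> c" "\<eta> b = real m * pi"
    using IVT'[of \<eta> t3 "real m * pi" c] c by auto
  note \<delta>b = \<delta>_bounds[OF q b(1)]
  have bc: "b < c"
  proof -
    have "\<theta> b < \<theta> c" using b c \<delta>b by (simp add: \<eta>_def)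
    then show ?thesis using \<theta>_less_iff[of b c] b c t33 by simp
  qed
  have cd: "c < d" using \<theta>_less_iff[of c d] c d t33 by simp
  have cont: "continuous_on {u..v} r" if "t3 \<le> u" for u v
    by (rule continuous_on_subset[OF cont_r]) (use that t3_bounds[of u] in auto)
  have up: "r u < r v" if uv: "b \<le> u" "u < v" "v \<le> c" for u v
    using uv(2)
  proof (rule DERIV_pos_imp_increasing_open)
    fix w assume w: "u < w" "w < v"
    have w3: "t3 \<le> w" using w uv b by simp
    have "\<theta> w < real m * pi" using \<theta>_less[of w c] w uv c w3 t33 by simp
    moreover have "real m * pi < \<eta> w" using \<eta>_less[OF q b(1), of w] w uv b by simp
    ultimately have "0 < dr w" using dr_pos[OF q w3] by simp
    then show "\<exists>y. (r has_real_derivative y) (at w) \<and> 0 < y"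
      using r_at[of w] t3_bounds[OF w3] by blast
  qed (use cont uv b in auto)
  have down: "r v < r u" if uv: "c \<le> u" "u < v" "v \<le> d" for u v
    using uv(2)
  proof (rule DERIV_neg_imp_decreasing_open)
    fix w assume w: "u < w" "w < v"
    have w3: "t3 \<le> w" using w uv c by simp
    have 1: "real m * pi < \<theta> w" using \<theta>_less[of c w] w uv c t33 by simp
    have "\<theta> w < real m * pi + pi / 2" using \<theta>_less[of w d] w uv d w3 t33 by simp
    then have 2: "\<eta> w < real (Suc m) * pi"
      using \<delta>_bounds[OF q w3] by (simp add: \<eta>_def algebra_simps)
    have "dr w < 0" using dr_nonpos(2)[OF q w3 _ _ 1 2] 1 2 by simp
    then show "\<exists>y. (r has_real_derivative y) (at w) \<and> y < 0"
      using r_at[of w] t3_bounds[OF w3] by blast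
  qed (use cont uv c in auto)
  have rd: "r d < r b" using r_after_wave[OF q b(1) b(3) _ d(2)] bc cd by simp
  have rc: "r b < r c" using up[of b c] bc by simp
  obtain e where e: "c \<le> e" "e \<le> d" "r e = r b"
    using IVT2'[of r d "r b" c] rd rc cd cont[OF c(1), of d] by auto
  have ce: "c < e" using e rc by (cases "c = e") auto
  have "r b < r t" if t: "b < t" "t < e" for t
  proof (cases "t \<le> c")
    case True
    then show ?thesis using up[of b t] t by simp
  next
    case False
    then show ?thesis using down[of t e] t e by simp
  qed
  then show ?thesis using b bc c ce d e by blast
qed

text \<open>The even members of the wave sequence are the times \<open>e\<close> at which the waves end, the odd ones the
  times \<open>b\<close> at which they begin; it starts a quarter turn after a multiple of \<open>pi\<close>, where \<open>r\<close>
  decreases.\<close>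

lemma wavy_function_radius:
  assumes q: "0 < q" and T: "t1 \<le> T"
  shows "\<exists>u0\<ge>T. \<forall>h. (\<forall>t\<ge>u0. h t = r t) \<longrightarrow> wavy_function u0 h"
proof -
  define N where "N = nat \<lceil>max (\<theta> t3 + 1) (\<theta> T)\<rceil>"
  have N: "\<theta> t3 + 1 \<le> real m * pi" "\<theta> T \<le> real m * pi" if "N \<le> m" for m
  proof -
    have "max (\<theta> t3 + 1) (\<theta> T) \<le> real N" unfolding N_def by linarith
    also have "real N \<le> real m * 1" using that by simp
    also have "\<dots> \<le> real m * pi" using pi_gt3 by (intro mult_left_mono) auto
    finally show "\<theta> t3 + 1 \<le> real m * pi" "\<theta> T \<le> real m * pi" by auto
  qed
  have "\<forall>m. \<exists>b c e d. N \<le> m \<longrightarrow> t3 \<le> b \<and> b < c \<and> c < e \<and> e \<le> d \<and> \<eta> b = real m * pi \<and>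
      \<theta> c = real m * pi \<and> \<theta> d = real m * pi + pi / 2 \<and> r e = r b \<and> (\<forall>t. b < t \<and> t < e \<longrightarrow> r b < r t)"
    using wave[OF q N(1)] by blast
  then obtain b c e d where bced: "\<And>m. N \<le> m \<Longrightarrow> t3 \<le> b m \<and> b m < c m \<and> c m < e m \<and> e m \<le> d m \<and>
      \<eta> (b m) = real m * pi \<and> \<theta> (c m) = real m * pi \<and> \<theta> (d m) = real m * pi + pi / 2 \<and>
      r (e m) = r (b m) \<and> (\<forall>t. b m < t \<and> t < e m \<longrightarrow> r (b m) < r t)"
    by metis
  have late: "t3 \<le> b m" "t3 \<le> c m" "t3 \<le> e m" "t3 \<le> d m" if "N \<le> m" for m
    using bced[OF that] by linarith+
  have t31: "t1 \<le> t" if "t3 \<le> t" for t using t3_bounds[OF that] by simp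
  have next_wave: "\<eta> (d m) < real (Suc m) * pi" "d m < b (Suc m)" if m: "N \<le> m" for m
  proof -
    show 1: "\<eta> (d m) < real (Suc m) * pi"
      using bced[OF m] \<delta>_bounds[OF q late(4)[OF m]] by (simp add: \<eta>_def algebra_simps)
    show "d m < b (Suc m)"
      using 1 bced[of "Suc m"] m \<eta>_less_iff[OF q late(4)[OF m] late(1)[of "Suc m"]] by simp
  qed
  have gap: "pi / 8 \<le> b (Suc m) - d m" if m: "N \<le> m" for m
  proof -
    have "\<theta> (b (Suc m)) - \<theta> (d m) \<le> 2 * (b (Suc m) - d m)"
      using \<theta>_increment(2)[of "d m" "b (Suc m)"] next_wave[OF m] t31 late[OF m] by simp
    moreover have "real (Suc m) * pi - pi / 4 \<le> \<theta> (b (Suc m))"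
      using bced[of "Suc m"] m \<delta>_bounds[OF q late(1)[of "Suc m"]] by (simp add: \<eta>_def)
    moreover have "\<theta> (d m) = real m * pi + pi / 2" using bced[OF m] by simp
    ultimately show ?thesis by (simp add: algebra_simps)
  qed
  have dr_start: "dr t \<le> 0" if m: "N \<le> m" and t: "c m \<le> t" "t \<le> b (Suc m)" for m t
  proof (rule dr_nonpos(1)[OF q])
    show t3t: "t3 \<le> t" using late[OF m] t by simp
    show "real m * pi \<le> \<theta> t"
      using bced[OF m] \<theta>_less[of "c m" t] t late[OF m] t31 by (cases "c m = t") auto
    show "\<eta> t \<le> real (Suc m) * pi"
      using bced[of "Suc m"] m \<eta>_less[OF q t3t, of "b (Suc m)"] t by (cases "t = b (Suc m)") auto
  qed
  have dr_wave: "0 < dr t" if m: "N \<le> m" and t: "b m < t" "t < c m" for m t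
  proof (rule dr_pos[OF q])
    show t3t: "t3 \<le> t" using late[OF m] t by simp
    show "\<theta> t < real m * pi" using bced[OF m] \<theta>_less[of t "c m"] t t31[OF t3t] by simp
    show "real m * pi < \<eta> t" using bced[OF m] \<eta>_less[OF q late(1)[OF m], of t] t by simp
  qed
  define u0 where "u0 = d N"
  have u0T: "T \<le> u0"
  proof -
    have "\<theta> u0 = real N * pi + pi / 2" using bced[of N] by (simp add: u0_def)
    then have "\<theta> T < \<theta> u0" using N(2)[of N] pi_half_gt_zero by linarith
    then show ?thesis using \<theta>_less_iff[of T u0] T late[of N] t31 by (simp add: u0_def)
  qed
  have u0t: "t0 < u0" "t3 \<le> u0" using late(4)[of N] t3_bounds[of u0] by (auto simp: u0_def)
  \<comment> \<open>The sequence starts at \<open>d N\<close>, not at the end \<open>e N\<close> of a wave.\<close>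
  define E where "E k = (if k = 0 then d N else e (N + k))" for k
  define B where "B k = b (N + k + 1)" for k
  define W where "W n = (if even n then E (n div 2) else B (n div 2))" for n
  have W_simps: "W (2 * k) = E k" "W (2 * k + 1) = B k" "W (2 * k + 2) = E (k + 1)" for k
    by (simp_all add: W_def)
  have E: "c (N + k) < E k" "E k \<le> d (N + k)" "E k < B k" "pi / 8 \<le> B k - E k" for k
  proof -
    show "c (N + k) < E k" using bced[of "N + k"] by (auto simp: E_def)
    show "E k \<le> d (N + k)" using bced[of "N + k"] by (auto simp: E_def)
    then show "E k < B k" "pi / 8 \<le> B k - E k"
      using next_wave(2)[of "N + k"] gap[of "N + k"] by (auto simp: B_def)
  qed
  have BE: "B k < E (k + 1)" for k
    using bced[of "N + k + 1"] by (auto simp: B_def E_def)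
  have rE: "r (E (k + 1)) = r (B k)" for k
    using bced[of "N + k + 1"] by (auto simp: B_def E_def)
  have r_wave: "r (B k) < r t" if "B k < t" "t < E (k + 1)" for k t
    using bced[of "N + k + 1"] that by (auto simp: B_def E_def)
  have mono: "strict_mono W"
  proof (rule strict_monoI_Suc)
    fix n
    show "W n < W (Suc n)"
    proof (cases "even n")
      case True
      then obtain k where "n = 2 * k" by blast
      then show ?thesis using E(3)[of k] W_simps[of k] by simp
    next
      case False
      then obtain k where "n = 2 * k + 1" using oddE by blast
      then show ?thesis using BE[of k] W_simps[of k] by simp
    qed
  qed
  have W0: "W 0 = u0" using W_simps(1)[of 0] by (simp add: E_def u0_def)
  have Wge: "u0 \<le> W n" for n using strict_mono_mono[OF mono] W0 monoD by fastforce
  have EB_ge: "u0 \<le> E k" "u0 \<le> B k" for k using Wge[of "2 * k"] Wge[of "2 * k + 1"] W_simps by auto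
  have B_lim: "filterlim B at_top sequentially"
  proof (rule filterlim_at_top_mono)
    show "filterlim (\<lambda>k. u0 + real k * (pi / 8)) at_top sequentially"
      by (intro filterlim_tendsto_add_at_top[OF tendsto_const]
            filterlim_at_top_mult_tendsto_pos[OF tendsto_const] filterlim_real_sequentially) simp
    have "u0 + real k * (pi / 8) \<le> B k" for k
    proof (induction k)
      case 0
      then show ?case using EB_ge by simp
    next
      case (Suc k)
      have "B k + pi / 8 \<le> B (Suc k)" using BE[of k] E(4)[of "Suc k"] by simp
      then show ?case using Suc by (simp add: algebra_simps add_divide_distrib)
    qed
    then show "eventually (\<lambda>k. u0 + real k * (pi / 8) \<le> B k) sequentially" by simp
  qed
  have W_lim: "filterlim W at_top sequentially"
    unfolding filterlim_at_top
  proof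
    fix Z
    obtain k where "Z \<le> B k"
      using B_lim unfolding filterlim_at_top eventually_sequentially by blast
    then have "Z \<le> W n" if "2 * k + 1 \<le> n" for n
      using monoD[OF strict_mono_mono[OF mono] that] W_simps(2)[of k] by simp
    then show "eventually (\<lambda>n. Z \<le> W n) sequentially" unfolding eventually_sequentially by blast
  qed
  obtain C where C: "0 < C"
    "\<And>s t. t1 \<le> s \<Longrightarrow> s \<le> t \<Longrightarrow> \<bar>r t - r s\<bar> \<le> C * s powr (- (a / 2) - 1) * (t - s)"
    using r_lipschitz_late by blast
  have len: "E (k + 1) - B k \<le> 2 * pi" for k
  proof -
    let ?m = "N + k + 1"
    have m: "N \<le> ?m" by simp
    have *: "x \<le> 2 * y" if "x / 2 \<le> y / 2 + y / 4" "0 < y" for x y :: real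
      using that by linarith
    have "(d ?m - b ?m) / 2 \<le> \<theta> (d ?m) - \<theta> (b ?m)"
      using \<theta>_increment(1)[of "b ?m" "d ?m"] bced[OF m] t31 by simp
    also have "\<dots> \<le> pi / 2 + pi / 4"
      using bced[OF m] \<delta>_bounds[OF q late(1)[OF m]] by (simp add: \<eta>_def)
    finally have "d ?m - b ?m \<le> 2 * pi"
      by (rule *) simp
    then show ?thesis using E(2)[of "k + 1"] by (simp add: B_def)
  qed
  have osc: "0 \<le> osc r {B k..E (k + 1)} \<and> osc r {B k..E (k + 1)} \<le> 4 * pi * C * B k powr (- (a / 2) - 1)" for k
  proof -
    let ?X = "2 * pi * C * B k powr (- (a / 2) - 1)"
    have Bk: "t1 \<le> B k" using EB_ge[of k] u0t t31 by auto
    have bd: "\<bar>r t - r (B k)\<bar> \<le> ?X" if "t \<in> {B k..E (k + 1)}" for t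
    proof -
      have "\<bar>r t - r (B k)\<bar> \<le> C * B k powr (- (a / 2) - 1) * (t - B k)"
        using C(2)[OF Bk] that by simp
      also have "\<dots> \<le> C * B k powr (- (a / 2) - 1) * (2 * pi)"
        using C(1) len[of k] that by (intro mult_left_mono) auto
      finally show ?thesis by (simp add: mult_ac)
    qed
    have ne: "r ` {B k..E (k + 1)} \<noteq> {}" using BE[of k] by auto
    have up: "y \<le> r (B k) + ?X" and lo: "r (B k) - ?X \<le> y" if "y \<in> r ` {B k..E (k + 1)}" for y
      using that bd by (auto simp: abs_le_iff) (smt (verit, best) atLeastAtMost_iff bd)+
    have "Sup (r ` {B k..E (k + 1)}) \<le> r (B k) + ?X" by (rule cSup_least[OF ne up])
    moreover have "r (B k) - ?X \<le> Inf (r ` {B k..E (k + 1)})" by (rule cInf_greatest[OF ne lo])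
    moreover have "Inf (r ` {B k..E (k + 1)}) \<le> Sup (r ` {B k..E (k + 1)})"
      by (rule cInf_le_cSup[OF ne bdd_aboveI[OF up] bdd_belowI[OF lo]])
    ultimately show ?thesis unfolding osc_def by simp
  qed
  have wavi: "waviness h W" if h: "\<And>t. u0 \<le> t \<Longrightarrow> h t = r t" for h
  proof -
    have osc_h: "osc h {W (2 * k + 1)..W (2 * k + 2)} = osc r {B k..E (k + 1)}" for k
    proof -
      have "h ` {B k..E (k + 1)} = r ` {B k..E (k + 1)}"
        using h EB_ge[of k] by (intro image_cong) auto
      then show ?thesis unfolding osc_def W_simps by simp
    qed
    have Bpos: "0 < B k" for k using EB_ge[of k] u0t t0_pos by (simp add: less_le_trans)
    \<comment> \<open>The oscillation is of order \<open>B k powr (- (a / 2) - 1)\<close>; \<open>a / 4\<close> is less than \<open>a / 2\<close> and lies in \<open>(0, 1)\<close>.\<close>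
    have "(\<lambda>k. osc h {W (2 * k + 1)..W (2 * k + 2)}) \<in> o(\<lambda>k. W (2 * k + 1) powr (- (a / 4) - 1))"
      unfolding osc_h unfolding W_simps(2)
    proof (rule smalloI_tendsto)
      show "((\<lambda>k. osc r {B k..E (k + 1)} / B k powr (- (a / 4) - 1)) \<longlongrightarrow> 0) sequentially"
      proof (rule tendsto_sandwich)
        show "eventually (\<lambda>k. 0 \<le> osc r {B k..E (k + 1)} / B k powr (- (a / 4) - 1)) sequentially"
          using osc by (intro always_eventually allI divide_nonneg_nonneg) auto
        have "osc r {B k..E (k + 1)} / B k powr (- (a / 4) - 1) \<le> 4 * pi * C * B k powr (- (a / 4))" for k
        proof -
          have "osc r {B k..E (k + 1)} / B k powr (- (a / 4) - 1)
              \<le> 4 * pi * C * B k powr (- (a / 2) - 1) / B k powr (- (a / 4) - 1)"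
            using osc[of k] by (intro divide_right_mono) auto
          also have "\<dots> = 4 * pi * C * (B k powr (- (a / 2) - 1) / B k powr (- (a / 4) - 1))" by simp
          also have "B k powr (- (a / 2) - 1) / B k powr (- (a / 4) - 1) = B k powr (- (a / 4))"
            using Bpos[of k] by (simp add: powr_diff[symmetric])
          finally show ?thesis .
        qed
        then show "eventually (\<lambda>k. osc r {B k..E (k + 1)} / B k powr (- (a / 4) - 1)
            \<le> 4 * pi * C * B k powr (- (a / 4))) sequentially" by simp
        have "((\<lambda>k. 4 * pi * C * B k powr (- (a / 4))) \<longlongrightarrow> 4 * pi * C * 0) sequentially"
          using a_pos by (intro tendsto_intros tendsto_neg_powr B_lim) auto
        then show "((\<lambda>k. 4 * pi * C * B k powr (- (a / 4))) \<longlongrightarrow> 0) sequentially" by simp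
      qed simp
      show "eventually (\<lambda>k. B k powr (- (a / 4) - 1) \<noteq> 0) sequentially"
        using Bpos by (simp add: less_imp_neq[symmetric])
    qed
    then have "\<exists>\<alpha>\<in>{0<..<1}. (\<lambda>k. osc h {W (2 * k + 1)..W (2 * k + 2)}) \<in> o(\<lambda>k. W (2 * k + 1) powr (- \<alpha> - 1))"
      using a_pos a_less by (intro bexI[of _ "a / 4"]) auto
    moreover have "\<exists>\<epsilon>>0. \<forall>k. W (2 * k + 1) - W (2 * k) \<ge> \<epsilon>"
      unfolding W_simps using E(4) by (intro exI[of _ "pi / 8"]) auto
    ultimately show ?thesis unfolding waviness_def using mono W_lim by blast
  qed
  have "wavy_function u0 h" if h: "\<And>t. u0 \<le> t \<Longrightarrow> h t = r t" for h
  proof -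
    have der: "(h has_real_derivative dr t) (at t within {u0..})" if "u0 \<le> t" for t
      by (rule has_field_derivative_transform_within[OF r_within zero_less_one])
         (use that h u0t in auto)
    have deriv: "deriv_on {u0..} h t = dr t" if "u0 \<le> t" for t
      by (rule deriv_on_atLeast_eqI[OF that der[OF that]])
    have "C1_on {u0..} h"
      by (rule C1_on_atLeastI[OF der]) (use u0t in \<open>auto intro: continuous_on_subset[OF cont_dr]\<close>)
    moreover have "\<forall>t\<ge>u0. 0 < h t" using h r_pos u0t by auto
    moreover have "deriv_on {u0..} h u0 \<le> 0"
      unfolding deriv[OF order_refl]
      using dr_start[of N u0] bced[of N] next_wave(2)[of N] by (simp add: u0_def)
    moreover have "wave_sequence u0 h W"
      unfolding wave_sequence_def
    proof (intro conjI allI)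
      show "W 0 = u0" by (rule W0)
      fix k
      let ?S = "{t. W (2 * k) < t \<and> 0 < deriv_on {u0..} h t}"
      let ?m = "N + k + 1"
      have S_eq: "?S = {t. E k < t \<and> 0 < dr t}"
        unfolding W_simps using deriv EB_ge[of k] by auto
      have S1: "B k \<le> t" if "t \<in> ?S" for t
      proof (rule ccontr)
        assume "\<not> B k \<le> t"
        then have "dr t \<le> 0" using that E(1)[of k] unfolding S_eq
          by (intro dr_start[of "N + k"]) (auto simp: B_def)
        then show False using that unfolding S_eq by simp
      qed
      have bc: "B k < c ?m" using bced[of ?m] by (simp add: B_def)
      have S2: "t \<in> ?S" if "B k < t" "t < c ?m" for t
        using that dr_wave[of ?m t] E(3)[of k] unfolding S_eq by (auto simp: B_def)
      show "?S \<noteq> {}" using S2 dense[OF bc] by blast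
      show "W (2 * k + 1) = Inf ?S"
        unfolding W_simps(2)
      proof (rule sym, rule cInf_eq[OF S1])
        fix y assume y: "\<And>t. t \<in> ?S \<Longrightarrow> y \<le> t"
        show "y \<le> B k"
        proof (rule dense_ge_bounded[OF bc])
          fix w assume "B k < w" "w < c ?m"
          then show "y \<le> w" using y S2 by simp
        qed
      qed
      let ?R = "{t. W (2 * k + 1) < t \<and> h t = h (W (2 * k + 1))}"
      have R_eq: "?R = {t. B k < t \<and> r t = r (B k)}"
        unfolding W_simps using h EB_ge[of k] by auto
      have mem: "E (k + 1) \<in> ?R" unfolding R_eq using BE[of k] rE[of k] by simp
      show "?R \<noteq> {}" using mem by blast
      show "W (2 * k + 2) = Inf ?R"
        unfolding W_simps(3)
      proof (rule sym, rule cInf_eq_minimum[OF mem])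
        fix t assume "t \<in> ?R"
        then show "E (k + 1) \<le> t" using r_wave[of k t] unfolding R_eq by force
      qed
    qed
    ultimately show ?thesis unfolding wavy_function_def using wavi[OF h] by blast
  qed
  then show ?thesis using u0T by blast
qed

lemma wavy:
  assumes q: "0 < q" and T: "t2 \<le> T" "0 < \<theta> T" and g: "\<And>t. T \<le> t \<Longrightarrow> g (- \<theta> t) = r t"
  shows "is_wavy_spiral g {..- \<theta> T}"
proof -
  have T1: "t1 \<le> T" "t0 < T" using T t1_bounds by (auto simp: t2_def)
  obtain u0 where u0: "T \<le> u0" "\<And>h. (\<forall>t\<ge>u0. h t = r t) \<Longrightarrow> wavy_function u0 h"
    using wavy_function_radius[OF q T1(1)] by blast
  have "wavy_function u0 (\<lambda>t. g (- \<theta> t))" by (rule u0(2)) (use g u0 in auto)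
  moreover have "C1_on {u0..} (\<lambda>t. - \<theta> t)"
  proof (rule C1_on_atLeastI)
    show "((\<lambda>t. - \<theta> t) has_real_derivative - d\<theta> t) (at t within {u0..})" if "u0 \<le> t" for t
      by (intro DERIV_minus \<theta>_within) (use that u0 T1 in auto)
    show "continuous_on {u0..} (\<lambda>t. - d\<theta> t)"
      by (intro continuous_intros continuous_on_subset[OF cont_d\<theta>]) (use u0 T1 in auto)
  qed
  moreover have "strict_antimono_on {u0..} (\<lambda>t. - \<theta> t)"
    using u0 T1 by (auto intro!: monotone_onI \<theta>_less)
  moreover have "(\<lambda>t. - \<theta> t) ` {u0..} \<subseteq> {..- \<theta> T}"
    using \<theta>_image[OF T1(1)] u0 by auto
  ultimately show ?thesis
    unfolding is_wavy_spiral_def using is_spiral_radius[OF T g] by blast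
qed

end

section \<open>Series solutions of the Bessel equation\<close>

text \<open>The equation \<open>t\<^sup>2 u'' + t u' + (t\<^sup>2 - b\<^sup>2) u = f\<close> as a system for \<open>u\<close> and \<open>v = t u'\<close>. The inhomogeneous
  term is there for derivatives with respect to the order.\<close>

definition bessel_system :: "real \<Rightarrow> (real \<Rightarrow> real) \<Rightarrow> (real \<Rightarrow> real) \<Rightarrow> (real \<Rightarrow> real) \<Rightarrow> bool" where
  "bessel_system b f u v \<longleftrightarrow> (\<forall>t>0. (u has_real_derivative v t / t) (at t) \<and>
     (v has_real_derivative ((b\<^sup>2 - t\<^sup>2) * u t + f t) / t) (at t))"

lemma bessel_system_lincomb:
  assumes "bessel_system b f u v" "bessel_system b g w z"
  shows "bessel_system b (\<lambda>t. A * f t + B * g t) (\<lambda>t. A * u t + B * w t) (\<lambda>t. A * v t + B * z t)"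
  unfolding bessel_system_def
proof (intro allI impI conjI)
  fix t :: real assume t: "0 < t"
  note d = assms[unfolded bessel_system_def, rule_format, OF t]
  show "((\<lambda>t. A * u t + B * w t) has_real_derivative (A * v t + B * z t) / t) (at t)"
    by (rule DERIV_cong[OF DERIV_add[OF DERIV_cmult DERIV_cmult]])
       (use d in \<open>auto simp: add_divide_distrib\<close>)
  show "((\<lambda>t. A * v t + B * z t) has_real_derivative
      ((b\<^sup>2 - t\<^sup>2) * (A * u t + B * w t) + (A * f t + B * g t)) / t) (at t)"
    by (rule DERIV_cong[OF DERIV_add[OF DERIV_cmult DERIV_cmult]])
       (use d t in \<open>auto simp: field_simps\<close>)
qed

definition pseries :: "(nat \<Rightarrow> real) \<Rightarrow> real \<Rightarrow> real" where
  "pseries c s = (\<Sum>m. c m * s ^ m)"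

definition entire_coeffs :: "(nat \<Rightarrow> real) \<Rightarrow> bool" where
  "entire_coeffs c \<longleftrightarrow> (\<forall>s. summable (\<lambda>m. c m * s ^ m))"

lemma entire_coeffs_diffs: "entire_coeffs c \<Longrightarrow> entire_coeffs (diffs c)"
  unfolding entire_coeffs_def by (auto intro: termdiff_converges_all)

lemma pseries_deriv:
  "entire_coeffs c \<Longrightarrow> (pseries c has_real_derivative pseries (diffs c) s) (at s)"
  unfolding pseries_def[abs_def] entire_coeffs_def
  by (rule termdiffs_strong_converges_everywhere) auto

lemma pseries_at_0: "pseries c 0 = c 0"
  unfolding pseries_def by (rule powser_zero)

lemma pseries_tendsto_0:
  assumes "entire_coeffs c"
  shows "((\<lambda>t. pseries c ((t / 2)\<^sup>2)) \<longlongrightarrow> c 0) (at_right 0)"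
proof -
  have "isCont (\<lambda>t. pseries c ((t / 2)\<^sup>2)) 0"
    by (rule isCont_o2[OF _ DERIV_isCont[OF pseries_deriv[OF assms]]]) (intro continuous_intros; simp)
  then have "((\<lambda>t. pseries c ((t / 2)\<^sup>2)) \<longlongrightarrow> pseries c ((0 / 2)\<^sup>2)) (at 0)"
    by (simp add: isCont_def)
  then show ?thesis
    by (simp add: pseries_at_0 filterlim_at_split)
qed

text \<open>The operator \<open>s P'' + (b + 1) P' + P\<close> acts on coefficients; up to the factor \<open>4 s\<close> it is Bessel's
  operator applied to \<open>(t / 2) powr b * P s\<close> with \<open>s = (t / 2)\<^sup>2\<close>.\<close>

lemma pseries_frobenius:
  assumes "entire_coeffs c"
  shows "s * pseries (diffs (diffs c)) s + (b + 1) * pseries (diffs c) s + pseries c s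
    = pseries (\<lambda>m. (real m + 1) * (real m + 1 + b) * c (Suc m) + c m) s"
proof -
  have d1: "entire_coeffs (diffs c)" and d2: "entire_coeffs (diffs (diffs c))"
    using assms entire_coeffs_diffs by blast+
  have sum: "(\<lambda>m. c m * s ^ m) sums pseries c s"
    "(\<lambda>m. diffs c m * s ^ m) sums pseries (diffs c) s"
    "(\<lambda>m. diffs (diffs c) m * s ^ m) sums pseries (diffs (diffs c)) s"
    using assms d1 d2 unfolding pseries_def entire_coeffs_def by (auto intro: summable_sums)
  have "(\<lambda>m. real m * diffs c m * s ^ m) sums (s * pseries (diffs (diffs c)) s)"
  proof (rule sums_Suc_imp)
    have "(\<lambda>m. s * (diffs (diffs c) m * s ^ m)) sums (s * pseries (diffs (diffs c)) s)"
      by (rule sums_mult[OF sum(3)])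
    then show "(\<lambda>m. real (Suc m) * diffs c (Suc m) * s ^ Suc m) sums (s * pseries (diffs (diffs c)) s)"
      by (simp add: diffs_def mult_ac)
  qed simp
  then have "(\<lambda>m. real m * diffs c m * s ^ m + (b + 1) * (diffs c m * s ^ m) + c m * s ^ m) sums
      (s * pseries (diffs (diffs c)) s + (b + 1) * pseries (diffs c) s + pseries c s)"
    by (intro sums_add sums_mult sum)
  moreover have "real m * diffs c m * s ^ m + (b + 1) * (diffs c m * s ^ m) + c m * s ^ m
      = ((real m + 1) * (real m + 1 + b) * c (Suc m) + c m) * s ^ m" for m
    by (simp add: diffs_def algebra_simps)
  ultimately show ?thesis
    unfolding pseries_def[of "\<lambda>m. (real m + 1) * (real m + 1 + b) * c (Suc m) + c m"]
    by (simp add: sums_iff)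
qed

definition J_coeff :: "real \<Rightarrow> nat \<Rightarrow> real" where
  "J_coeff b m = (-1) ^ m * rGamma (b + real m + 1) / fact m"

definition J_coeff_deriv :: "real \<Rightarrow> nat \<Rightarrow> real" where
  "J_coeff_deriv b m = (-1) ^ m * deriv rGamma (b + real m + 1) / fact m"

lemma rGamma_deriv: "(rGamma has_real_derivative deriv rGamma z) (at (z :: real))"
  by (rule DERIV_deriv_iff_field_differentiable[THEN iffD2])
     (auto simp: field_differentiable_def intro: has_field_derivative_rGamma)

lemma deriv_rGamma_rec:
  "deriv rGamma (z :: real) = rGamma (z + 1) + z * deriv rGamma (z + 1)"
proof -
  have "((\<lambda>z. z * rGamma (z + 1)) has_real_derivative 1 * rGamma (z + 1) + deriv rGamma (z + 1) * z) (at z)"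
    by (intro DERIV_mult DERIV_ident DERIV_shift[THEN iffD1, of _ _ _ 1] rGamma_deriv)
  then have "(rGamma has_real_derivative rGamma (z + 1) + z * deriv rGamma (z + 1)) (at z)"
    by (simp add: rGamma_plus1 mult.commute)
  then show ?thesis by (rule DERIV_unique[OF rGamma_deriv])
qed

text \<open>The recurrences divide by \<open>z \<ge> 1\<close>, so the bounds on \<open>[1, 2]\<close> propagate to the right: the one for
  \<open>rGamma\<close> is kept and the one for its derivative grows by at most \<open>M\<close> per unit step.\<close>

lemma rGamma_bounds:
  "\<exists>M>0. \<forall>z::real\<ge>1. \<bar>rGamma z\<bar> \<le> M \<and> \<bar>deriv rGamma z\<bar> \<le> M * z"
proof -
  have "compact ((\<lambda>z::real. rGamma z) ` {1..2})"
    by (intro compact_continuous_image continuous_intros) auto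
  then have "bounded ((\<lambda>z::real. rGamma z) ` {1..2})" by (rule compact_imp_bounded)
  then obtain M1 where "\<forall>y\<in>(\<lambda>z::real. rGamma z) ` {1..2}. norm y \<le> M1"
    unfolding bounded_iff by blast
  then have M1: "\<bar>rGamma (z::real)\<bar> \<le> M1" if "z \<in> {1..2}" for z
    using that by auto
  have nonpos: "z \<notin> \<int>\<^sub>\<le>\<^sub>0" if "1 \<le> z" for z :: real
    using that by (auto elim!: nonpos_Ints_cases)
  have der: "deriv rGamma z = - rGamma z * Digamma z" if "1 \<le> z" for z :: real
    by (rule DERIV_imp_deriv has_field_derivative_rGamma_no_nonpos_int nonpos that)+
  have "compact ((\<lambda>z::real. - rGamma z * Digamma z) ` {1..2})"
    by (intro compact_continuous_image continuous_intros continuous_on_Polygamma) (use nonpos in auto)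
  then have "bounded ((\<lambda>z::real. - rGamma z * Digamma z) ` {1..2})" by (rule compact_imp_bounded)
  then obtain M2 where "\<forall>y\<in>(\<lambda>z::real. - rGamma z * Digamma z) ` {1..2}. norm y \<le> M2"
    unfolding bounded_iff by blast
  then have M2: "\<bar>- rGamma (z::real) * Digamma z\<bar> \<le> M2" if "z \<in> {1..2}" for z
    using that by auto
  define M where "M = max 1 (max M1 M2)"
  have M: "1 \<le> M" "\<And>z. z \<in> {1..2} \<Longrightarrow> \<bar>rGamma (z::real)\<bar> \<le> M"
    "\<And>z. z \<in> {1..2} \<Longrightarrow> \<bar>deriv rGamma (z::real)\<bar> \<le> M"
    using M1 M2 der by (force simp: M_def)+
  have main: "\<bar>rGamma z\<bar> \<le> M \<and> \<bar>deriv rGamma z\<bar> \<le> M * z" if "1 \<le> z" "z \<le> real n + 2" for n z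
    using that
  proof (induction n arbitrary: z)
    case 0
    then have "\<bar>deriv rGamma z\<bar> \<le> M * 1" "M * 1 \<le> M * z" "\<bar>rGamma z\<bar> \<le> M"
      using M(1) M(2)[of z] M(3)[of z] by (auto intro: mult_left_mono)
    then show ?case by linarith
  next
    case (Suc n)
    show ?case
    proof (cases "z \<le> real n + 2")
      case True
      then show ?thesis using Suc by simp
    next
      case False
      define y where "y = z - 1"
      have y: "1 \<le> y" "y \<le> real n + 2" "z = y + 1" using False Suc.prems by (auto simp: y_def)
      have IH: "\<bar>rGamma y\<bar> \<le> M" "\<bar>deriv rGamma y\<bar> \<le> M * y" using Suc.IH[OF y(1,2)] by auto
      have "y * rGamma z = rGamma y" using rGamma_plus1[of y] y by simp
      then have "y * \<bar>rGamma z\<bar> = \<bar>rGamma y\<bar>" using y by (metis abs_mult abs_of_nonneg dual_order.trans zero_le_one)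
      moreover have "1 * \<bar>rGamma z\<bar> \<le> y * \<bar>rGamma z\<bar>" using y by (intro mult_right_mono) auto
      ultimately have 1: "\<bar>rGamma z\<bar> \<le> M" using IH by linarith
      have "y * deriv rGamma z = deriv rGamma y - rGamma z" using deriv_rGamma_rec[of y] y by simp
      then have "y * \<bar>deriv rGamma z\<bar> = \<bar>deriv rGamma y - rGamma z\<bar>"
        using y by (metis abs_mult abs_of_nonneg dual_order.trans zero_le_one)
      also have "\<dots> \<le> M * y + M" using IH 1 by linarith
      finally have "y * \<bar>deriv rGamma z\<bar> \<le> M * z" using y by (simp add: algebra_simps)
      moreover have "1 * \<bar>deriv rGamma z\<bar> \<le> y * \<bar>deriv rGamma z\<bar>" using y by (intro mult_right_mono) auto
      ultimately show ?thesis using 1 by linarith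
    qed
  qed
  have "\<bar>rGamma z\<bar> \<le> M \<and> \<bar>deriv rGamma z\<bar> \<le> M * z" if "1 \<le> z" for z
    using main[of z "nat \<lceil>z\<rceil>"] that by linarith
  then show ?thesis using M(1) by (intro exI[of _ M]) auto
qed

text \<open>Uniformly for orders within distance \<open>1\<close> of \<open>b0\<close>, the coefficients and their derivatives with
  respect to the order are eventually bounded by those of an exponential series.\<close>

lemma J_coeff_bounds:
  "\<exists>M. eventually (\<lambda>m. \<forall>b\<in>{b0 - 1..b0 + 1}. \<bar>J_coeff b m\<bar> \<le> M * 2 ^ m / fact m \<and>
     \<bar>J_coeff_deriv b m\<bar> \<le> M * 2 ^ m / fact m) sequentially"
proof -
  obtain M where M: "0 < M" "\<And>z::real. 1 \<le> z \<Longrightarrow> \<bar>rGamma z\<bar> \<le> M"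
    "\<And>z::real. 1 \<le> z \<Longrightarrow> \<bar>deriv rGamma z\<bar> \<le> M * z"
    using rGamma_bounds by blast
  define N where "N = nat \<lceil>\<bar>b0\<bar>\<rceil> + 1"
  have N: "\<bar>b0\<bar> + 1 \<le> real N" unfolding N_def by linarith
  have "\<bar>J_coeff b m\<bar> \<le> 3 * M * 2 ^ m / fact m \<and> \<bar>J_coeff_deriv b m\<bar> \<le> 3 * M * 2 ^ m / fact m"
    if m: "N \<le> m" and b: "b \<in> {b0 - 1..b0 + 1}" for m b
  proof -
    have z: "1 \<le> b + real m + 1" "b + real m + 1 \<le> 2 * real m + 1"
      using N m b by (auto simp: abs_if split: if_splits)
    have "real m \<le> 2 ^ m" by (simp add: less_imp_le of_nat_less_two_power)
    moreover have "(1 :: real) \<le> 2 ^ m" by simp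
    ultimately have p: "b + real m + 1 \<le> 3 * 2 ^ m" using z by linarith
    have "\<bar>rGamma (b + real m + 1)\<bar> \<le> M * 1" using M(2)[OF z(1)] by simp
    also have "\<dots> \<le> M * (3 * 2 ^ m)" using M(1) p z by (intro mult_left_mono) auto
    finally have 1: "\<bar>rGamma (b + real m + 1)\<bar> \<le> 3 * M * 2 ^ m" by simp
    have "\<bar>deriv rGamma (b + real m + 1)\<bar> \<le> M * (b + real m + 1)" using M(3)[OF z(1)] by simp
    also have "\<dots> \<le> M * (3 * 2 ^ m)" using M(1) p by (intro mult_left_mono) auto
    finally have 2: "\<bar>deriv rGamma (b + real m + 1)\<bar> \<le> 3 * M * 2 ^ m" by simp
    show ?thesis
      using 1 2 by (auto simp: J_coeff_def J_coeff_deriv_def abs_mult power_abs intro!: divide_right_mono)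
  qed
  then show ?thesis unfolding eventually_sequentially by blast
qed

lemma summable_exp_majorant: "summable (\<lambda>m. M * 2 ^ m / fact m * \<bar>s\<bar> ^ m)" for s M :: real
proof -
  have "summable (\<lambda>m. M * (inverse (fact m) * (2 * \<bar>s\<bar>) ^ m))"
    using summable_exp[of "2 * \<bar>s\<bar>"] by (intro summable_mult)
  then show ?thesis by (simp add: power_mult_distrib divide_inverse mult_ac)
qed

lemma abs_power_term_le:
  "\<bar>x\<bar> \<le> B \<Longrightarrow> norm (x * s ^ m) \<le> B * \<bar>s\<bar> ^ m" for x s B :: real
  unfolding real_norm_def abs_mult power_abs by (rule mult_right_mono) auto

lemma entire_J_coeff: "entire_coeffs (J_coeff b)" and entire_J_coeff_deriv: "entire_coeffs (J_coeff_deriv b)"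
proof -
  obtain M where M: "eventually (\<lambda>m. \<bar>J_coeff b m\<bar> \<le> M * 2 ^ m / fact m \<and>
     \<bar>J_coeff_deriv b m\<bar> \<le> M * 2 ^ m / fact m) sequentially"
    using J_coeff_bounds[of b] by (force elim: eventually_mono)
  have "summable (\<lambda>m. J_coeff b m * s ^ m)" for s
    by (rule summable_comparison_test_ev[OF _ summable_exp_majorant[of M s]])
       (use M in \<open>eventually_elim, blast intro: abs_power_term_le\<close>)
  moreover have "summable (\<lambda>m. J_coeff_deriv b m * s ^ m)" for s
    by (rule summable_comparison_test_ev[OF _ summable_exp_majorant[of M s]])
       (use M in \<open>eventually_elim, blast intro: abs_power_term_le\<close>)
  ultimately show "entire_coeffs (J_coeff b)" "entire_coeffs (J_coeff_deriv b)"
    by (auto simp: entire_coeffs_def)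
qed

text \<open>Termwise differentiation in the order, by locally uniform convergence of the differentiated
  series.\<close>

lemma pseries_J_coeff_deriv_order:
  "((\<lambda>b. pseries (J_coeff b) s) has_real_derivative pseries (J_coeff_deriv b0) s) (at b0)"
  unfolding pseries_def
proof (rule has_field_derivative_series'(2))
  let ?S = "{b0 - 1..b0 + 1}"
  show "convex ?S" "b0 \<in> ?S" "b0 \<in> interior ?S" by auto
  show "summable (\<lambda>m. J_coeff b0 m * s ^ m)"
    using entire_J_coeff by (simp add: entire_coeffs_def)
  show "((\<lambda>b. J_coeff b m * s ^ m) has_real_derivative J_coeff_deriv b m * s ^ m) (at b within ?S)" for m b
  proof -
    have "((\<lambda>b. rGamma (b + (real m + 1))) has_real_derivative deriv rGamma (b + (real m + 1))) (at b)"
      by (intro DERIV_shift[THEN iffD1] rGamma_deriv)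
    then have "((\<lambda>b. (-1) ^ m / fact m * s ^ m * rGamma (b + (real m + 1))) has_real_derivative
        (-1) ^ m / fact m * s ^ m * deriv rGamma (b + (real m + 1))) (at b)"
      by (rule DERIV_cmult)
    then have "((\<lambda>b. J_coeff b m * s ^ m) has_real_derivative J_coeff_deriv b m * s ^ m) (at b)"
      by (simp add: J_coeff_def J_coeff_deriv_def add.assoc mult_ac)
    then show ?thesis by (rule has_field_derivative_at_within)
  qed
  obtain M where M: "eventually (\<lambda>m. \<forall>b\<in>?S. \<bar>J_coeff b m\<bar> \<le> M * 2 ^ m / fact m \<and>
     \<bar>J_coeff_deriv b m\<bar> \<le> M * 2 ^ m / fact m) sequentially"
    using J_coeff_bounds[of b0] by blast
  show "uniformly_convergent_on ?S (\<lambda>n b. \<Sum>m<n. J_coeff_deriv b m * s ^ m)"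
    by (rule Weierstrass_m_test'_ev[OF _ summable_exp_majorant[of M s]])
       (use M in \<open>eventually_elim, blast intro: abs_power_term_le\<close>)
qed

lemma J_coeff_rec:
  "(real m + 1) * (real m + 1 + b) * J_coeff b (Suc m) + J_coeff b m = 0"
proof -
  have "(b + real m + 1) * rGamma (b + real m + 1 + 1) = rGamma (b + real m + 1)"
    by (rule rGamma_plus1)
  then have "rGamma (b + real m + 1) = (real m + 1 + b) * rGamma (b + (1 + real m) + 1)"
    by (simp add: algebra_simps)
  then show ?thesis
    by (simp add: J_coeff_def divide_simps)
qed

text \<open>This is the derivative of the recurrence for \<open>J_coeff b\<close> with respect to \<open>b\<close>.\<close>

lemma J_coeff_deriv_rec:
  "(real m + 1) * (real m + 1 + b) * J_coeff_deriv b (Suc m) + J_coeff_deriv b m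
    = - diffs (J_coeff b) m"
proof -
  have "deriv rGamma (b + real m + 1) = rGamma (b + real m + 1 + 1)
      + (b + real m + 1) * deriv rGamma (b + real m + 1 + 1)"
    by (rule deriv_rGamma_rec)
  then have "deriv rGamma (b + real m + 1) = rGamma (b + (1 + real m) + 1)
      + (real m + 1 + b) * deriv rGamma (b + (1 + real m) + 1)"
    by (simp add: algebra_simps)
  then show ?thesis
    by (simp add: J_coeff_def J_coeff_deriv_def diffs_def divide_simps) (simp add: algebra_simps)
qed

text \<open>Substituting \<open>s = (t / 2)\<^sup>2\<close>, under which \<open>t d/dt\<close> becomes \<open>2 s d/ds\<close>.\<close>

lemma pseries_square_deriv:
  assumes "entire_coeffs c" "0 < t"
  shows "((\<lambda>t. pseries c ((t / 2)\<^sup>2)) has_real_derivative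
    2 * (t / 2)\<^sup>2 * pseries (diffs c) ((t / 2)\<^sup>2) / t) (at t)"
proof -
  have "((\<lambda>t. pseries c ((t / 2)\<^sup>2)) has_real_derivative pseries (diffs c) ((t / 2)\<^sup>2) * (t / 2)) (at t)"
    by (rule DERIV_chain2[OF pseries_deriv[OF assms(1)]]) (auto intro!: derivative_eq_intros)
  then show ?thesis using assms by (simp add: power2_eq_square field_simps)
qed

lemma half_powr_deriv:
  "0 < t \<Longrightarrow> ((\<lambda>t::real. (t / 2) powr b) has_real_derivative b * (t / 2) powr b / t) (at t)"
  by (auto intro!: derivative_eq_intros simp: powr_diff field_simps)

lemma bessel_system_frobenius:
  assumes c: "entire_coeffs c"
    and rec: "\<And>m. (real m + 1) * (real m + 1 + b) * c (Suc m) + c m = h m"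
  shows "bessel_system b (\<lambda>t. 4 * (t / 2)\<^sup>2 * (t / 2) powr b * pseries h ((t / 2)\<^sup>2))
    (\<lambda>t. (t / 2) powr b * pseries c ((t / 2)\<^sup>2))
    (\<lambda>t. (t / 2) powr b * (b * pseries c ((t / 2)\<^sup>2) + 2 * (t / 2)\<^sup>2 * pseries (diffs c) ((t / 2)\<^sup>2)))"
  unfolding bessel_system_def
proof (intro allI impI conjI)
  fix t :: real assume t: "0 < t"
  define s where "s = (t / 2)\<^sup>2"
  define P Q R X where "P = pseries c s" and "Q = pseries (diffs c) s"
    and "R = pseries (diffs (diffs c)) s" and "X = (t / 2) powr b"
  have d1: "entire_coeffs (diffs c)" by (rule entire_coeffs_diffs[OF c])
  note D = pseries_square_deriv[OF c t] pseries_square_deriv[OF d1 t] half_powr_deriv[OF t, of b]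
  have fr: "s * R + (b + 1) * Q + P = pseries h s"
    using pseries_frobenius[OF c, of s b] rec by (simp add: P_def Q_def R_def)
  have tt: "t\<^sup>2 = 4 * s" by (simp add: s_def power2_eq_square)
  show "((\<lambda>t. (t / 2) powr b * pseries c ((t / 2)\<^sup>2)) has_real_derivative
      (t / 2) powr b * (b * pseries c ((t / 2)\<^sup>2) + 2 * (t / 2)\<^sup>2 * pseries (diffs c) ((t / 2)\<^sup>2)) / t) (at t)"
    by (rule DERIV_cong[OF DERIV_mult[OF D(3) D(1)]])
       (use t in \<open>simp add: field_simps\<close>)
  have S: "((\<lambda>t. 2 * (t / 2)\<^sup>2) has_real_derivative 4 * s / t) (at t)"
    using t by (auto intro!: derivative_eq_intros simp: s_def power2_eq_square field_simps)
  have "((\<lambda>t. (t / 2) powr b * (b * pseries c ((t / 2)\<^sup>2) + 2 * (t / 2)\<^sup>2 * pseries (diffs c) ((t / 2)\<^sup>2)))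
      has_real_derivative
        b * X / t * (b * P + 2 * s * Q)
        + (b * (2 * s * Q / t) + (4 * s / t * Q + 2 * s * R / t * (2 * s))) * X) (at t)"
    using DERIV_mult[OF D(3) DERIV_add[OF DERIV_cmult[OF D(1), of b] DERIV_mult[OF S D(2)]]]
    unfolding s_def P_def Q_def R_def X_def .
  moreover have "b * X / t * (b * P + 2 * s * Q)
        + (b * (2 * s * Q / t) + (4 * s / t * Q + 2 * s * R / t * (2 * s))) * X
      = X * (b\<^sup>2 * P + 4 * s * (s * R + (b + 1) * Q)) / t"
    using t by (simp add: field_simps power2_eq_square)
  moreover have "b\<^sup>2 * P + 4 * s * (s * R + (b + 1) * Q) = (b\<^sup>2 - t\<^sup>2) * P + 4 * s * pseries h s"
    unfolding fr[symmetric] tt by (simp add: algebra_simps)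
  moreover have "X * ((b\<^sup>2 - t\<^sup>2) * P + 4 * s * pseries h s) / t
      = ((b\<^sup>2 - t\<^sup>2) * (X * P) + 4 * s * X * pseries h s) / t"
    by (simp add: algebra_simps)
  ultimately show "((\<lambda>t. (t / 2) powr b * (b * pseries c ((t / 2)\<^sup>2) + 2 * (t / 2)\<^sup>2 * pseries (diffs c) ((t / 2)\<^sup>2)))
      has_real_derivative ((b\<^sup>2 - t\<^sup>2) * ((t / 2) powr b * pseries c ((t / 2)\<^sup>2)) +
         4 * (t / 2)\<^sup>2 * (t / 2) powr b * pseries h ((t / 2)\<^sup>2)) / t) (at t)"
    unfolding s_def P_def X_def by simp
qed

text \<open>A factor \<open>ln (t / 2)\<close> adds \<open>u\<close> to \<open>t u'\<close>, hence twice \<open>t u'\<close> to the second-order operator.\<close>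

lemma bessel_system_ln:
  assumes "bessel_system b (\<lambda>_. 0) u v"
  shows "bessel_system b (\<lambda>t. 2 * v t) (\<lambda>t. ln (t / 2) * u t) (\<lambda>t. u t + ln (t / 2) * v t)"
  unfolding bessel_system_def
proof (intro allI impI conjI)
  fix t :: real assume t: "0 < t"
  have d: "(u has_real_derivative v t / t) (at t)" "(v has_real_derivative ((b\<^sup>2 - t\<^sup>2) * u t) / t) (at t)"
    using assms t unfolding bessel_system_def by auto
  have l: "((\<lambda>t. ln (t / 2)) has_real_derivative 1 / t) (at t)"
    using t by (auto intro!: derivative_eq_intros)
  show "((\<lambda>t. ln (t / 2) * u t) has_real_derivative (u t + ln (t / 2) * v t) / t) (at t)"
    by (rule DERIV_cong[OF DERIV_mult[OF l d(1)]]) (use t in \<open>simp add: field_simps\<close>)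
  show "((\<lambda>t. u t + ln (t / 2) * v t) has_real_derivative
      ((b\<^sup>2 - t\<^sup>2) * (ln (t / 2) * u t) + 2 * v t) / t) (at t)"
    by (rule DERIV_cong[OF DERIV_add[OF d(1) DERIV_mult[OF l d(2)]]])
       (use t in \<open>simp add: field_simps\<close>)
qed

lemma bessel_J_eq:
  assumes "0 < t"
  shows "bessel_J b t = (t / 2) powr b * pseries (J_coeff b) ((t / 2)\<^sup>2)"
proof -
  have "(-1) ^ m * rGamma (b + real m + 1) / fact m * (t / 2) powr (b + 2 * real m)
      = (t / 2) powr b * (J_coeff b m * ((t / 2)\<^sup>2) ^ m)" for m
  proof -
    have "(t / 2) powr (2 * real m) = ((t / 2)\<^sup>2) ^ m"
      using assms powr_realpow[of "t / 2" "2 * m"] by (simp add: power_mult)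
    then show ?thesis by (simp add: J_coeff_def powr_add)
  qed
  moreover have "summable (\<lambda>m. J_coeff b m * ((t / 2)\<^sup>2) ^ m)"
    using entire_J_coeff by (simp add: entire_coeffs_def)
  ultimately show ?thesis
    unfolding bessel_J_def pseries_def by (simp add: suminf_mult)
qed

lemma pseries_0: "pseries (\<lambda>_. 0) s = 0"
  by (simp add: pseries_def)

lemma pseries_uminus: "entire_coeffs c \<Longrightarrow> pseries (\<lambda>m. - c m) s = - pseries c s"
  by (simp add: pseries_def entire_coeffs_def suminf_minus)

text \<open>For positive \<open>t\<close> this is \<open>bessel_J b t\<close>, with the power of \<open>t / 2\<close> taken out of the series.\<close>

definition frobenius_J :: "real \<Rightarrow> real \<Rightarrow> real" where
  "frobenius_J b t = (t / 2) powr b * pseries (J_coeff b) ((t / 2)\<^sup>2)"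

definition frobenius_J' :: "real \<Rightarrow> real \<Rightarrow> real" where
  "frobenius_J' b t = (t / 2) powr b * (b * pseries (J_coeff b) ((t / 2)\<^sup>2)
     + 2 * (t / 2)\<^sup>2 * pseries (diffs (J_coeff b)) ((t / 2)\<^sup>2))"

lemma bessel_system_J: "bessel_system b (\<lambda>_. 0) (frobenius_J b) (frobenius_J' b)"
  using bessel_system_frobenius[OF entire_J_coeff J_coeff_rec, of b]
  unfolding pseries_0 mult_zero_right frobenius_J_def[abs_def] frobenius_J'_def[abs_def] .

definition J_order_deriv :: "real \<Rightarrow> real \<Rightarrow> real" where
  "J_order_deriv b t = ln (t / 2) * frobenius_J b t + (t / 2) powr b * pseries (J_coeff_deriv b) ((t / 2)\<^sup>2)"

lemma J_has_order_deriv: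
  assumes "0 < t"
  shows "((\<lambda>b. frobenius_J b t) has_real_derivative J_order_deriv b t) (at b)"
proof -
  have "((\<lambda>b. (t / 2) powr b) has_real_derivative (t / 2) powr b * ln (t / 2)) (at b)"
    using assms by (auto intro!: derivative_eq_intros simp: powr_def)
  then show ?thesis
    unfolding frobenius_J_def J_order_deriv_def
    by (rule DERIV_cong[OF DERIV_mult[OF _ pseries_J_coeff_deriv_order]]) (simp add: algebra_simps)
qed

text \<open>Differentiating Bessel's equation in the order turns the term \<open>- b\<^sup>2 u\<close> into the inhomogeneity.\<close>

lemma bessel_system_J_order_deriv:
  "\<exists>w. bessel_system b (\<lambda>t. 2 * b * frobenius_J b t) (J_order_deriv b) w"
proof -
  have "bessel_system b (\<lambda>t. 4 * (t / 2)\<^sup>2 * (t / 2) powr b * pseries (\<lambda>m. - diffs (J_coeff b) m) ((t / 2)\<^sup>2))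
    (\<lambda>t. (t / 2) powr b * pseries (J_coeff_deriv b) ((t / 2)\<^sup>2))
    (\<lambda>t. (t / 2) powr b * (b * pseries (J_coeff_deriv b) ((t / 2)\<^sup>2)
      + 2 * (t / 2)\<^sup>2 * pseries (diffs (J_coeff_deriv b)) ((t / 2)\<^sup>2)))"
    by (rule bessel_system_frobenius[OF entire_J_coeff_deriv J_coeff_deriv_rec])
  from bessel_system_lincomb[OF bessel_system_ln[OF bessel_system_J[of b]] this, of 1 1]
  obtain w where w: "bessel_system b
     (\<lambda>t. 1 * (2 * frobenius_J' b t) + 1 * (4 * (t / 2)\<^sup>2 * (t / 2) powr b * pseries (\<lambda>m. - diffs (J_coeff b) m) ((t / 2)\<^sup>2)))
     (\<lambda>t. 1 * (ln (t / 2) * frobenius_J b t) + 1 * ((t / 2) powr b * pseries (J_coeff_deriv b) ((t / 2)\<^sup>2))) w"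
    by blast
  moreover have "1 * (2 * frobenius_J' b t) + 1 * (4 * (t / 2)\<^sup>2 * (t / 2) powr b * pseries (\<lambda>m. - diffs (J_coeff b) m) ((t / 2)\<^sup>2))
      = 2 * b * frobenius_J b t" for t
    unfolding pseries_uminus[OF entire_coeffs_diffs[OF entire_J_coeff]] frobenius_J_def frobenius_J'_def
    by (simp add: algebra_simps)
  ultimately show ?thesis unfolding J_order_deriv_def[abs_def] by auto
qed

section \<open>Bessel functions of both kinds as nontrivial solutions\<close>

text \<open>Nonvanishing near the origin, where the series determine the leading behaviour, excludes the zero
  solution.\<close>

definition nontrivial_at_0 :: "(real \<Rightarrow> real) \<Rightarrow> bool" where
  "nontrivial_at_0 u \<longleftrightarrow> eventually (\<lambda>t. u t \<noteq> 0) (at_right 0)"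

lemma nontrivial_at_0I:
  assumes "((\<lambda>t. h t * u t) \<longlongrightarrow> L) (at_right 0)" "L \<noteq> 0"
  shows "nontrivial_at_0 u"
  unfolding nontrivial_at_0_def
  using tendsto_imp_eventually_ne[OF assms] by eventually_elim auto

lemma at_right_0_pos: "eventually (\<lambda>t::real. 0 < t) (at_right 0)"
  by (rule eventually_at_right_less)

lemma half_powr_tendsto_0: "0 < b \<Longrightarrow> ((\<lambda>t::real. (t / 2) powr b) \<longlongrightarrow> 0) (at_right 0)"
proof -
  assume "0 < b"
  have "((\<lambda>t::real. t / 2) \<longlongrightarrow> 0) (at_right 0)" by (auto intro!: tendsto_eq_intros)
  then have "((\<lambda>t::real. (t / 2) powr b) \<longlongrightarrow> 0 powr b) (at_right 0)"
    by (rule tendsto_powr')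
       (use \<open>0 < b\<close> in \<open>auto intro!: eventually_mono[OF at_right_0_pos]\<close>)
  then show ?thesis by simp
qed

lemma rGamma_pos_neq_0: "0 < z \<Longrightarrow> rGamma (z :: real) \<noteq> 0"
  using nonpos_Ints_nonpos[of z] by (auto simp: rGamma_eq_zero_iff)

lemma nontrivial_J:
  assumes "0 \<le> b"
  shows "nontrivial_at_0 (frobenius_J b)"
proof (rule nontrivial_at_0I)
  show "((\<lambda>t. (t / 2) powr (- b) * frobenius_J b t) \<longlongrightarrow> J_coeff b 0) (at_right 0)"
  proof (rule Lim_transform_eventually[OF pseries_tendsto_0[OF entire_J_coeff]])
    show "eventually (\<lambda>t. pseries (J_coeff b) ((t / 2)\<^sup>2) = (t / 2) powr (- b) * frobenius_J b t) (at_right 0)"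
      using at_right_0_pos
      by eventually_elim (simp add: frobenius_J_def powr_minus)
  qed
  show "J_coeff b 0 \<noteq> 0" using assms by (simp add: J_coeff_def rGamma_pos_neq_0)
qed

text \<open>For positive noninteger \<open>b\<close> the singular summand, of order \<open>- b\<close>, dominates at the origin.\<close>

lemma nontrivial_Y_noninteger:
  assumes "0 < b" "b \<notin> \<int>" "B \<noteq> 0"
  shows "nontrivial_at_0 (\<lambda>t. A * frobenius_J b t + B * frobenius_J (- b) t)"
proof (rule nontrivial_at_0I)
  have "((\<lambda>t. A * ((t / 2) powr (2 * b) * pseries (J_coeff b) ((t / 2)\<^sup>2)) + B * pseries (J_coeff (- b)) ((t / 2)\<^sup>2))
      \<longlongrightarrow> A * (0 * J_coeff b 0) + B * J_coeff (- b) 0) (at_right 0)"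
    using assms(1)
    by (intro tendsto_intros half_powr_tendsto_0 pseries_tendsto_0 entire_J_coeff) auto
  then show "((\<lambda>t. (t / 2) powr b * (A * frobenius_J b t + B * frobenius_J (- b) t)) \<longlongrightarrow> A * (0 * J_coeff b 0) + B * J_coeff (- b) 0) (at_right 0)"
  proof (rule Lim_transform_eventually)
    show "eventually (\<lambda>t. A * ((t / 2) powr (2 * b) * pseries (J_coeff b) ((t / 2)\<^sup>2)) + B * pseries (J_coeff (- b)) ((t / 2)\<^sup>2)
        = (t / 2) powr b * (A * frobenius_J b t + B * frobenius_J (- b) t)) (at_right 0)"
      using at_right_0_pos
    proof eventually_elim
      case (elim t)
      define X Z where "X = (t / 2) powr b" and "Z = (t / 2) powr (- b)"
      have XX: "(t / 2) powr (2 * b) = X * X"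
        by (simp add: X_def powr_add[symmetric])
      have XZ: "X * Z = 1"
        using elim by (simp add: X_def Z_def powr_add[symmetric])
      have "X * (A * frobenius_J b t + B * frobenius_J (- b) t) = A * (X * X * pseries (J_coeff b) ((t / 2)\<^sup>2))
          + B * ((X * Z) * pseries (J_coeff (- b)) ((t / 2)\<^sup>2))"
        unfolding frobenius_J_def X_def[symmetric] Z_def[symmetric] by (simp add: algebra_simps)
      then show ?case unfolding XX XZ X_def[symmetric] by simp
    qed
  qed
  have "rGamma (- b + 1) \<noteq> 0"
  proof
    assume "rGamma (- b + 1) = 0"
    then have "- b + 1 \<in> \<int>" using nonpos_Ints_subset_Ints by (auto simp: rGamma_eq_zero_iff)
    then have "1 - (- b + 1) \<in> \<int>" by (intro Ints_diff) auto
    then show False using assms by simp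
  qed
  then show "A * (0 * J_coeff b 0) + B * J_coeff (- b) 0 \<noteq> 0"
    using assms by (simp add: J_coeff_def)
qed

text \<open>The first \<open>n\<close> coefficients vanish at the poles of the Gamma function; the others are,
  up to the sign, those of order \<open>n\<close>, shifted by \<open>n\<close>.\<close>

lemma J_neg_integer:
  assumes "0 < t"
  shows "frobenius_J (- real n) t = (-1) ^ n * frobenius_J (real n) t"
proof -
  let ?s = "(t / 2)\<^sup>2"
  have zero: "J_coeff (- real n) m = 0" if "m < n" for m
  proof -
    have "- real n + real m + 1 = - real (n - m - 1)" using that by (simp add: of_nat_diff)
    moreover have "rGamma (- real k) = 0" for k by (simp add: rGamma_eq_zero_iff)
    ultimately have "rGamma (- real n + real m + 1) = 0" by (simp only:)
    then show ?thesis by (simp add: J_coeff_def)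
  qed
  have shift: "J_coeff (- real n) (m + n) = (-1) ^ n * J_coeff (real n) m" for m
  proof -
    have "rGamma (- real n + real (m + n) + 1) = 1 / fact m"
      using rGamma_inverse_Gamma[of "1 + real m"] Gamma_fact[of m, where 'a = real]
      by (simp add: divide_inverse add.commute)
    moreover have "rGamma (real n + real m + 1) = 1 / fact (m + n)"
      using rGamma_inverse_Gamma[of "1 + real (m + n)"] Gamma_fact[of "m + n", where 'a = real]
      by (simp add: divide_inverse add.commute)
    ultimately show ?thesis by (simp add: J_coeff_def power_add mult.commute)
  qed
  have summable: "summable (\<lambda>m. J_coeff b m * ?s ^ m)" for b
    using entire_J_coeff by (simp add: entire_coeffs_def)
  have "pseries (J_coeff (- real n)) ?s = (\<Sum>m. J_coeff (- real n) (m + n) * ?s ^ (m + n))"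
    unfolding pseries_def suminf_split_initial_segment[OF summable, of _ n] using zero by simp
  also have "\<dots> = (\<Sum>m. ((-1) ^ n * ?s ^ n) * (J_coeff (real n) m * ?s ^ m))"
    by (simp only: shift power_add mult_ac)
  also have "\<dots> = (-1) ^ n * ?s ^ n * pseries (J_coeff (real n)) ?s"
    unfolding pseries_def by (rule suminf_mult[OF summable])
  finally have "frobenius_J (- real n) t = (-1) ^ n * ((t / 2) powr (- real n) * ?s ^ n) * pseries (J_coeff (real n)) ?s"
    by (simp add: frobenius_J_def)
  also have "(t / 2) powr (- real n) * ?s ^ n = (t / 2) powr (real n)"
  proof -
    have "?s ^ n = (t / 2) powr (real n + real n)"
      using assms powr_realpow[of "t / 2" "n + n"]
      by (simp add: power_add power_mult_distrib[symmetric] power2_eq_square)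
    then show ?thesis using assms by (simp add: powr_add[symmetric])
  qed
  finally show ?thesis by (simp add: frobenius_J_def)
qed

text \<open>The derivative in \<open>b\<close> at \<open>b = n\<close> of \<open>frobenius_J b t * cos (b * pi) - frobenius_J (- b) t\<close>, the numerator
  of the quotient that defines \<open>Y\<close>.\<close>

definition Y_num :: "nat \<Rightarrow> real \<Rightarrow> real" where
  "Y_num n t = (-1) ^ n * J_order_deriv (real n) t + J_order_deriv (- real n) t"

text \<open>The inhomogeneities \<open>2 n J n\<close> and \<open>- 2 n J (- n)\<close> of the two derivatives cancel by the reflection
  formula.\<close>

lemma bessel_system_Y_num: "\<exists>w. bessel_system (real n) (\<lambda>_. 0) u w"
  if u: "\<And>t. 0 < t \<Longrightarrow> u t = C * Y_num n t" for u C
proof -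
  obtain w1 where w1: "bessel_system (real n) (\<lambda>t. 2 * real n * frobenius_J (real n) t) (J_order_deriv (real n)) w1"
    using bessel_system_J_order_deriv by blast
  obtain w2 where "bessel_system (- real n) (\<lambda>t. 2 * (- real n) * frobenius_J (- real n) t) (J_order_deriv (- real n)) w2"
    using bessel_system_J_order_deriv by blast
  then have w2: "bessel_system (real n) (\<lambda>t. 2 * (- real n) * frobenius_J (- real n) t) (J_order_deriv (- real n)) w2"
    by (simp add: bessel_system_def)
  define v where "v t = C * (-1) ^ n * w1 t + C * w2 t" for t
  have sys: "bessel_system (real n) (\<lambda>t. C * (-1) ^ n * (2 * real n * frobenius_J (real n) t) + C * (2 * (- real n) * frobenius_J (- real n) t))
      (\<lambda>t. C * (-1) ^ n * J_order_deriv (real n) t + C * J_order_deriv (- real n) t) v"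
    unfolding v_def[abs_def] by (rule bessel_system_lincomb[OF w1 w2])
  have "bessel_system (real n) (\<lambda>_. 0) u v"
    unfolding bessel_system_def
  proof (intro allI impI)
    fix t :: real assume t: "0 < t"
    have ueq: "C * (-1) ^ n * J_order_deriv (real n) s + C * J_order_deriv (- real n) s = u s" if "0 < s" for s
      using u[OF that] by (simp add: Y_num_def algebra_simps)
    have zero: "C * (-1) ^ n * (2 * real n * frobenius_J (real n) t) + C * (2 * (- real n) * frobenius_J (- real n) t) = 0"
      unfolding J_neg_integer[OF t] by simp
    have "((\<lambda>t. C * (-1) ^ n * J_order_deriv (real n) t + C * J_order_deriv (- real n) t)
        has_real_derivative v t / t) (at t)"
      "(v has_real_derivative ((real n)\<^sup>2 - t\<^sup>2) * u t / t) (at t)"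
      using sys[unfolded bessel_system_def, rule_format, OF t] unfolding ueq[OF t] zero by simp_all
    moreover from this(1) have "(u has_real_derivative v t / t) (at t)"
      by (rule has_field_derivative_transform_within_open[of _ _ _ "{0<..}"]) (use t ueq in auto)
    ultimately show "(u has_real_derivative v t / t) (at t) \<and>
        (v has_real_derivative (((real n)\<^sup>2 - t\<^sup>2) * u t + 0) / t) (at t)" by simp
  qed
  then show ?thesis by blast
qed

text \<open>Numerator and denominator both vanish at \<open>b = n\<close>, so the limit is the quotient of their derivatives
  in \<open>b\<close>.\<close>

lemma bessel_Y_integer:
  assumes t: "0 < t"
  shows "bessel_Y (real n) t = (-1) ^ n / pi * Y_num n t"
proof -
  define N where "N b = frobenius_J b t * cos (b * pi) - frobenius_J (- b) t" for b
  have quot: "bessel_Y_quotient b t = N b / sin (b * pi)" for b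
    using t by (simp add: bessel_Y_quotient_def N_def bessel_J_eq frobenius_J_def)
  have cosn: "cos (real n * pi) = (-1) ^ n" "sin (real n * pi) = 0" by (simp_all add: cos_npi sin_npi)
  have N0: "N (real n) = 0" unfolding N_def by (simp add: J_neg_integer[OF t] cosn mult.commute)
  have dJ: "((\<lambda>b. frobenius_J b t) has_real_derivative J_order_deriv b t) (at b)" for b
    by (rule J_has_order_deriv[OF t])
  have "(N has_real_derivative (J_order_deriv (real n) t * cos (real n * pi)
      + (- sin (real n * pi) * pi) * frobenius_J (real n) t) - J_order_deriv (- real n) t * (- 1)) (at (real n))"
    unfolding N_def[abs_def]
    by (intro DERIV_diff DERIV_mult dJ DERIV_chain2[OF dJ]) (auto intro!: derivative_eq_intros)
  then have "(N has_real_derivative Y_num n t) (at (real n))"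
    by (simp add: cosn Y_num_def mult.commute)
  then have 1: "((\<lambda>b. (N b - N (real n)) / (b - real n)) \<longlongrightarrow> Y_num n t) (at (real n))"
    by (simp add: has_field_derivative_iff)
  have "((\<lambda>b. sin (b * pi)) has_real_derivative cos (real n * pi) * pi) (at (real n))"
    by (auto intro!: derivative_eq_intros)
  then have 2: "((\<lambda>b. (sin (b * pi) - sin (real n * pi)) / (b - real n)) \<longlongrightarrow> (-1) ^ n * pi) (at (real n))"
    by (simp add: has_field_derivative_iff cosn)
  have "((\<lambda>b. ((N b - N (real n)) / (b - real n)) / ((sin (b * pi) - sin (real n * pi)) / (b - real n)))
      \<longlongrightarrow> Y_num n t / ((-1) ^ n * pi)) (at (real n))"
    by (rule tendsto_divide[OF 1 2]) simp
  then have "((\<lambda>b. bessel_Y_quotient b t) \<longlongrightarrow> Y_num n t / ((-1) ^ n * pi)) (at (real n))"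
  proof (rule Lim_transform_eventually)
    show "eventually (\<lambda>b. ((N b - N (real n)) / (b - real n)) / ((sin (b * pi) - sin (real n * pi)) / (b - real n))
        = bessel_Y_quotient b t) (at (real n))"
      using eventually_neq_at_within[of "real n" "real n" UNIV]
      by eventually_elim (simp add: quot N0 cosn)
  qed
  then have "Lim (at (real n)) (\<lambda>b. bessel_Y_quotient b t) = Y_num n t / ((-1) ^ n * pi)"
    by (intro tendsto_Lim) auto
  moreover have "Y_num n t / ((-1) ^ n * pi) = (-1) ^ n / pi * Y_num n t"
    by (cases "even n") auto
  ultimately show ?thesis by (simp add: bessel_Y_def)
qed

lemma ln_half_at_bot: "filterlim (\<lambda>t::real. ln (t / 2)) at_bot (at_right 0)"
proof (rule filterlim_compose[OF ln_at_0])
  show "filterlim (\<lambda>t::real. t / 2) (at_right 0) (at_right 0)"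
    unfolding filterlim_at
    by (auto intro!: tendsto_eq_intros eventually_mono[OF at_right_0_pos])
qed

lemma half_powr_ln_tendsto_0:
  assumes "0 < b"
  shows "((\<lambda>t::real. (t / 2) powr b * ln (t / 2)) \<longlongrightarrow> 0) (at_right 0)"
proof -
  have "filterlim (\<lambda>t::real. inverse ((t / 2) powr b)) at_top (at_right 0)"
    by (rule filterlim_inverse_at_top[OF half_powr_tendsto_0[OF assms]])
       (use at_right_0_pos in \<open>auto elim: eventually_mono\<close>)
  from filterlim_compose[OF ln_x_over_x_tendsto_0 this]
  have "((\<lambda>t::real. - (1 / b) * (ln (inverse ((t / 2) powr b)) / inverse ((t / 2) powr b)))
      \<longlongrightarrow> - (1 / b) * 0) (at_right 0)"
    by (intro tendsto_mult tendsto_const)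
  then have "((\<lambda>t::real. - (1 / b) * (ln (inverse ((t / 2) powr b)) / inverse ((t / 2) powr b)))
      \<longlongrightarrow> 0) (at_right 0)" by simp
  then show ?thesis
  proof (rule Lim_transform_eventually)
    show "eventually (\<lambda>t::real. - (1 / b) * (ln (inverse ((t / 2) powr b)) / inverse ((t / 2) powr b))
        = (t / 2) powr b * ln (t / 2)) (at_right 0)"
      using at_right_0_pos
    proof eventually_elim
      case (elim t)
      have "ln (inverse ((t / 2) powr b)) = - (b * ln (t / 2))"
        using elim by (simp only: ln_inverse ln_powr)
      then have "- (1 / b) * (ln (inverse ((t / 2) powr b)) / inverse ((t / 2) powr b))
          = (1 / b * b) * (ln (t / 2) / inverse ((t / 2) powr b))" by simp
      also have "\<dots> = (t / 2) powr b * ln (t / 2)"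
        using assms by (simp only: divide_inverse inverse_inverse_eq) simp
      finally show ?case .
    qed
  qed
qed

text \<open>For \<open>n = 0\<close> the logarithm dominates at the origin. For \<open>n > 0\<close> the term \<open>(t / 2) powr (- n)\<close> does; its
  coefficient is the derivative of \<open>rGamma\<close> at a nonpositive integer, which is not \<open>0\<close>.\<close>

lemma nontrivial_Y_num: "nontrivial_at_0 (Y_num n)"
proof (cases "n = 0")
  case True
  show ?thesis
  proof (rule nontrivial_at_0I)
    have inv: "((\<lambda>t::real. inverse (ln (t / 2))) \<longlongrightarrow> 0) (at_right 0)"
      by (rule filterlim_compose[OF tendsto_inverse_0 filterlim_mono[OF ln_half_at_bot at_bot_le_at_infinity order_refl]])
    have "((\<lambda>t. 2 * (pseries (J_coeff 0) ((t / 2)\<^sup>2) + inverse (ln (t / 2)) * pseries (J_coeff_deriv 0) ((t / 2)\<^sup>2)))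
        \<longlongrightarrow> 2 * (J_coeff 0 0 + 0 * J_coeff_deriv 0 0)) (at_right 0)"
      by (intro tendsto_intros inv pseries_tendsto_0 entire_J_coeff entire_J_coeff_deriv)
    then show "((\<lambda>t. inverse (ln (t / 2)) * Y_num n t) \<longlongrightarrow> 2 * (J_coeff 0 0 + 0 * J_coeff_deriv 0 0)) (at_right 0)"
    proof (rule Lim_transform_eventually)
      have "eventually (\<lambda>t::real. ln (t / 2) < 0) (at_right 0)"
        using ln_half_at_bot unfolding filterlim_at_bot_dense by blast
      then show "eventually (\<lambda>t. 2 * (pseries (J_coeff 0) ((t / 2)\<^sup>2) + inverse (ln (t / 2)) * pseries (J_coeff_deriv 0) ((t / 2)\<^sup>2))
          = inverse (ln (t / 2)) * Y_num n t) (at_right 0)"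
        using at_right_0_pos
      proof eventually_elim
        case (elim t)
        define l where "l = ln (t / 2)"
        have "l \<noteq> 0" using elim by (simp add: l_def)
        then show ?case using True elim unfolding Y_num_def J_order_deriv_def frobenius_J_def l_def[symmetric]
          by (simp add: field_simps)
      qed
    qed
    show "2 * (J_coeff 0 0 + 0 * J_coeff_deriv 0 0) \<noteq> 0" by (simp add: J_coeff_def)
  qed
next
  case False
  then have n: "0 < real n" by simp
  show ?thesis
  proof (rule nontrivial_at_0I)
    let ?S = "\<lambda>t. pseries (J_coeff (real n)) ((t / 2)\<^sup>2)"
    let ?D = "\<lambda>t. pseries (J_coeff_deriv (real n)) ((t / 2)\<^sup>2)"
    let ?E = "\<lambda>t. pseries (J_coeff_deriv (- real n)) ((t / 2)\<^sup>2)"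
    let ?L = "(-1) ^ n * (2 * (0 * J_coeff (real n) 0) + 0 * J_coeff_deriv (real n) 0) + J_coeff_deriv (- real n) 0"
    have "((\<lambda>t. (-1) ^ n * (2 * ((t / 2) powr (2 * real n) * ln (t / 2) * ?S t) + (t / 2) powr (2 * real n) * ?D t) + ?E t)
        \<longlongrightarrow> ?L) (at_right 0)"
      using n by (intro tendsto_intros half_powr_tendsto_0 half_powr_ln_tendsto_0 pseries_tendsto_0
        entire_J_coeff entire_J_coeff_deriv) auto
    then show "((\<lambda>t. (t / 2) powr (real n) * Y_num n t) \<longlongrightarrow> ?L) (at_right 0)"
    proof (rule Lim_transform_eventually)
      show "eventually (\<lambda>t. (-1) ^ n * (2 * ((t / 2) powr (2 * real n) * ln (t / 2) * ?S t)
          + (t / 2) powr (2 * real n) * ?D t) + ?E t = (t / 2) powr (real n) * Y_num n t) (at_right 0)"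
        using at_right_0_pos
      proof eventually_elim
        case (elim t)
        define X where "X = (t / 2) powr (real n)"
        define Z where "Z = (t / 2) powr (- real n)"
        have XX: "(t / 2) powr (2 * real n) = X * X"
          by (simp add: X_def powr_add[symmetric])
        have XZ: "X * Z = 1"
          using elim by (simp add: X_def Z_def powr_add[symmetric])
        have Jn: "frobenius_J (real n) t = X * ?S t" "frobenius_J (- real n) t = (-1) ^ n * (X * ?S t)"
          unfolding J_neg_integer[OF elim] by (simp_all add: frobenius_J_def X_def)
        have "X * Y_num n t = (-1) ^ n * (2 * (X * X * ln (t / 2) * ?S t) + X * X * ?D t) + (X * Z) * ?E t"
          unfolding Y_num_def J_order_deriv_def Jn X_def[symmetric] Z_def[symmetric]
          by (simp add: algebra_simps)
        then show ?case unfolding XX XZ X_def[symmetric] by simp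
      qed
    qed
    have "(rGamma has_real_derivative (-1) ^ (n - 1) * fact (n - 1)) (at (- of_nat (n - 1) :: real))"
      by (rule has_field_derivative_rGamma_nonpos_int)
    moreover have "- of_nat (n - 1) = - real n + 1" using False by (simp add: of_nat_diff)
    ultimately have "deriv rGamma (- real n + 1) = (-1) ^ (n - 1) * fact (n - 1)"
      by (simp only: DERIV_imp_deriv)
    then have "J_coeff_deriv (- real n) 0 \<noteq> 0" by (simp add: J_coeff_deriv_def)
    then show "?L \<noteq> 0" by simp
  qed
qed

definition bessel_solution :: "real \<Rightarrow> (real \<Rightarrow> real) \<Rightarrow> (real \<Rightarrow> real) \<Rightarrow> bool" where
  "bessel_solution b u v \<longleftrightarrow> bessel_system b (\<lambda>_. 0) u v \<and> nontrivial_at_0 u"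

lemma bessel_system_cong:
  assumes "bessel_system b f u v" "\<And>t. 0 < t \<Longrightarrow> u' t = u t" "\<And>t. 0 < t \<Longrightarrow> f' t = f t"
  shows "bessel_system b f' u' v"
  unfolding bessel_system_def
proof (intro allI impI)
  fix t :: real assume t: "0 < t"
  have d: "(u has_real_derivative v t / t) (at t)"
    "(v has_real_derivative ((b\<^sup>2 - t\<^sup>2) * u t + f t) / t) (at t)"
    using assms(1) t unfolding bessel_system_def by auto
  have "(u' has_real_derivative v t / t) (at t)"
    by (rule has_field_derivative_transform_within_open[OF d(1), of "{0<..}"]) (use t assms(2) in auto)
  then show "(u' has_real_derivative v t / t) (at t) \<and>
      (v has_real_derivative ((b\<^sup>2 - t\<^sup>2) * u' t + f' t) / t) (at t)"
    using d(2) assms(2,3) t by simp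
qed

lemma nontrivial_at_0_cong:
  assumes "nontrivial_at_0 u" "\<And>t. 0 < t \<Longrightarrow> u' t = C * u t" "C \<noteq> 0"
  shows "nontrivial_at_0 u'"
  using assms(1) unfolding nontrivial_at_0_def
  by (rule eventually_elim2[OF _ at_right_0_pos]) (use assms(2,3) in auto)

lemma bessel_solution_J:
  assumes "0 \<le> b"
  shows "\<exists>v. bessel_solution b (bessel_J b) v"
proof -
  have eq: "bessel_J b t = frobenius_J b t" if "0 < t" for t
    using bessel_J_eq[OF that] by (simp add: frobenius_J_def)
  have "bessel_system b (\<lambda>_. 0) (bessel_J b) (frobenius_J' b)"
    by (rule bessel_system_cong[OF bessel_system_J]) (auto simp: eq)
  moreover have "nontrivial_at_0 (bessel_J b)"
    by (rule nontrivial_at_0_cong[OF nontrivial_J[OF assms], of _ 1]) (auto simp: eq)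
  ultimately show ?thesis by (auto simp: bessel_solution_def)
qed

lemma bessel_solution_Y:
  assumes "0 \<le> b"
  shows "\<exists>v. bessel_solution b (bessel_Y b) v"
proof (cases "b \<in> \<int>")
  case True
  then obtain n where n: "b = real n" using assms
    by (metis Ints_cases of_int_0_le_iff of_int_of_nat_eq zero_le_imp_eq_int)
  have eq: "bessel_Y b t = (-1) ^ n / pi * Y_num n t" if "0 < t" for t
    using bessel_Y_integer[OF that] by (simp add: n)
  obtain v where "bessel_system b (\<lambda>_. 0) (bessel_Y b) v"
    using bessel_system_Y_num[OF eq] n by auto
  moreover have "nontrivial_at_0 (bessel_Y b)"
    by (rule nontrivial_at_0_cong[OF nontrivial_Y_num eq]) auto
  ultimately show ?thesis by (auto simp: bessel_solution_def)
next
  case False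
  have "sin (b * pi) \<noteq> 0" using False by (auto simp: sin_zero_iff_int2)
  define A where "A = cos (b * pi) / sin (b * pi)"
  define B where "B = - 1 / sin (b * pi)"
  have eq: "bessel_Y b t = A * frobenius_J b t + B * frobenius_J (- b) t" if "0 < t" for t
    using False bessel_J_eq[OF that]
    by (simp add: bessel_Y_def bessel_Y_quotient_def A_def B_def frobenius_J_def diff_divide_distrib)
  have neg: "bessel_system b (\<lambda>_. 0) (frobenius_J (- b)) (frobenius_J' (- b))"
    using bessel_system_J[of "- b"] by (simp add: bessel_system_def)
  have "bessel_system b (\<lambda>_. 0) (bessel_Y b) (\<lambda>t. A * frobenius_J' b t + B * frobenius_J' (- b) t)"
    by (rule bessel_system_cong[OF bessel_system_lincomb[OF bessel_system_J neg]]) (auto simp: eq)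
  moreover have "nontrivial_at_0 (\<lambda>t. A * frobenius_J b t + B * frobenius_J (- b) t)"
    by (rule nontrivial_Y_noninteger) (use False assms \<open>sin (b * pi) \<noteq> 0\<close> in \<open>auto simp: B_def less_le\<close>)
  then have "nontrivial_at_0 (bessel_Y b)"
    by (rule nontrivial_at_0_cong[of _ _ 1]) (auto simp: eq)
  ultimately show ?thesis by (auto simp: bessel_solution_def)
qed

text \<open>The squared norm \<open>u\<^sup>2 + v\<^sup>2\<close> has a logarithmic derivative that is bounded on compact intervals,
  so backwards from a common zero it would stay \<open>0\<close>; but \<open>u\<close> does not vanish near the origin.\<close>

lemma bessel_solution_no_double_zero:
  assumes "bessel_solution b u v" "0 < t"
  shows "u t \<noteq> 0 \<or> v t \<noteq> 0"
proof (rule ccontr)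
  assume "\<not> (u t \<noteq> 0 \<or> v t \<noteq> 0)"
  then have zero: "u t = 0" "v t = 0" by auto
  have "eventually (\<lambda>s. u s \<noteq> 0 \<and> s \<in> {0<..<t}) (at_right 0)"
    using assms eventually_at_right_real[of 0 t]
    by (auto simp: bessel_solution_def nontrivial_at_0_def intro: eventually_conj)
  then obtain s where s: "u s \<noteq> 0" "0 < s" "s < t"
    using eventually_happens[of _ "at_right (0::real)"] by (auto simp: trivial_limit_at_right_real)
  define w where "w x = (u x)\<^sup>2 + (v x)\<^sup>2" for x
  \<comment> \<open>A bound for the logarithmic derivative of \<open>w\<close> on \<open>[s, t]\<close>.\<close>
  define k where "k = (1 + b\<^sup>2 + t\<^sup>2) / s"
  have "0 \<le> k" unfolding k_def using s by (intro divide_nonneg_pos add_nonneg_nonneg) auto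
  have "w s * exp (k * s) \<le> w t * exp (k * t)"
  proof (rule DERIV_nonneg_imp_nondecreasing[where f = "\<lambda>x. w x * exp (k * x)"])
    fix x assume x: "s \<le> x" "x \<le> t"
    then have x0: "0 < x" using s by simp
    have d: "(u has_real_derivative v x / x) (at x)"
      "(v has_real_derivative ((b\<^sup>2 - x\<^sup>2) * u x) / x) (at x)"
      using assms(1) x0 unfolding bessel_solution_def bessel_system_def by auto
    define D where "D = 2 * (1 + b\<^sup>2 - x\<^sup>2) * (u x * v x) / x"
    have der: "((\<lambda>x. w x * exp (k * x)) has_real_derivative (D + k * w x) * exp (k * x)) (at x)"
      unfolding w_def[abs_def] D_def using x0
      by (auto intro!: derivative_eq_intros d simp: power2_eq_square field_simps)
    have nonneg: "0 \<le> D + k * w x"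
    proof -
      have "\<bar>2 * (u x * v x)\<bar> \<le> w x"
        unfolding w_def using sum_squares_bound[of "u x" "v x"] sum_squares_bound[of "u x" "- v x"]
        by (simp add: abs_le_iff mult.assoc)
      moreover have "\<bar>(1 + b\<^sup>2 - x\<^sup>2) / x\<bar> \<le> k"
      proof -
        have "x\<^sup>2 \<le> t\<^sup>2" using x x0 by (intro power_mono) auto
        then have "\<bar>1 + b\<^sup>2 - x\<^sup>2\<bar> \<le> 1 + b\<^sup>2 + t\<^sup>2"
          using zero_le_power2[of b] zero_le_power2[of x] by linarith
        then show ?thesis unfolding k_def abs_divide using x s x0 by (intro frac_le) auto
      qed
      ultimately have "\<bar>(1 + b\<^sup>2 - x\<^sup>2) / x\<bar> * \<bar>2 * (u x * v x)\<bar> \<le> k * w x"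
        using \<open>0 \<le> k\<close> by (intro mult_mono) auto
      moreover have "D = (1 + b\<^sup>2 - x\<^sup>2) / x * (2 * (u x * v x))" by (simp add: D_def)
      ultimately have "\<bar>D\<bar> \<le> k * w x" by (simp only: abs_mult)
      then show ?thesis by linarith
    qed
    have "0 \<le> (D + k * w x) * exp (k * x)" using nonneg by (rule mult_nonneg_nonneg) simp
    with der show "\<exists>y. ((\<lambda>x. w x * exp (k * x)) has_real_derivative y) (at x) \<and> 0 \<le> y"
      by blast
  qed (use s in simp)
  then have "w s * exp (k * s) \<le> 0" by (simp add: w_def zero)
  moreover have "0 < w s" using s by (simp add: w_def add_pos_nonneg)
  ultimately show False by (simp add: mult_le_0_iff)
qed

section \<open>From the equation to polar coordinates\<close>

lemma projection_of_tan_eq_quotient: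
  assumes "0 < s" "tan_eq_quotient p y z" "s\<^sup>2 = z\<^sup>2 + y\<^sup>2"
  shows "(z * cos p + y * sin p)\<^sup>2 = s\<^sup>2"
    and "y * cos p = z * sin p"
proof -
  show eq: "y * cos p = z * sin p"
    using assms(2) unfolding tan_eq_quotient_def tan_def
    by (auto simp: field_simps split: if_splits)
  have "(z * cos p + y * sin p)\<^sup>2 + (y * cos p - z * sin p)\<^sup>2
      = (z\<^sup>2 + y\<^sup>2) * ((sin p)\<^sup>2 + (cos p)\<^sup>2)"
    by algebra
  then show "(z * cos p + y * sin p)\<^sup>2 = s\<^sup>2" using eq assms(3) by simp
qed

text \<open>The equation for the tangent puts \<open>(x, y)\<close> on the line of direction \<open>p\<close>, so the projection \<open>w\<close> onto
  this direction is the radius up to sign. By continuity the sign is constant, and a negative sign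
  is a shift of the angle by \<open>pi\<close>.\<close>

lemma polar_lift:
  fixes x y p :: "real \<Rightarrow> real"
  assumes cont: "continuous_on {t0..} x" "continuous_on {t0..} y" "continuous_on {t0..} p"
    and nz: "\<And>t. t0 \<le> t \<Longrightarrow> x t \<noteq> 0 \<or> y t \<noteq> 0"
    and tan: "\<And>t. t0 \<le> t \<Longrightarrow> tan_eq_quotient (p t) (y t) (x t)"
  shows "\<exists>j\<in>{0, 1::nat}. \<forall>t\<ge>t0.
    (x t, y t) = polar_point (sqrt ((x t)\<^sup>2 + (y t)\<^sup>2)) (p t + real j * pi)"
proof -
  define r where "r t = sqrt ((x t)\<^sup>2 + (y t)\<^sup>2)" for t
  define w where "w t = x t * cos (p t) + y t * sin (p t)" for t
  have r: "0 < r t" "(r t)\<^sup>2 = (x t)\<^sup>2 + (y t)\<^sup>2" if "t0 \<le> t" for t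
    using nz[OF that] by (auto simp: r_def sum_power2_gt_zero_iff)
  have w2: "(w t)\<^sup>2 = (r t)\<^sup>2" and perp: "y t * cos (p t) = x t * sin (p t)" if "t0 \<le> t" for t
    using projection_of_tan_eq_quotient[OF r(1)[OF that] tan[OF that] r(2)[OF that]] by (auto simp: w_def)
  have wnz: "w t \<noteq> 0" if "t0 \<le> t" for t using w2[OF that] r[OF that] by auto
  have contw: "continuous_on {t0..} w"
    unfolding w_def[abs_def] by (intro continuous_intros continuous_on_cos continuous_on_sin cont)
  have xy: "x t = w t * cos (p t)" "y t = w t * sin (p t)" if "t0 \<le> t" for t
  proof -
    have "w t * cos (p t) = x t * (cos (p t))\<^sup>2 + (y t * cos (p t)) * sin (p t)"
      by (simp add: w_def power2_eq_square algebra_simps)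
    also have "\<dots> = x t * ((sin (p t))\<^sup>2 + (cos (p t))\<^sup>2)"
      unfolding perp[OF that] by algebra
    finally show "x t = w t * cos (p t)" by simp
    have "w t * sin (p t) = (x t * sin (p t)) * cos (p t) + y t * (sin (p t))\<^sup>2"
      by (simp add: w_def power2_eq_square algebra_simps)
    also have "\<dots> = y t * ((sin (p t))\<^sup>2 + (cos (p t))\<^sup>2)"
      unfolding perp[OF that, symmetric] by algebra
    finally show "y t = w t * sin (p t)" by simp
  qed
  have sgn: "(\<forall>t\<ge>t0. 0 < w t) \<or> (\<forall>t\<ge>t0. w t < 0)"
  proof (rule ccontr)
    assume "\<not> ?thesis"
    then obtain s u where su: "t0 \<le> s" "w s \<le> 0" "t0 \<le> u" "0 \<le> w u" by (auto simp: not_less)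
    have "connected (w ` {t0..})" by (rule connected_continuous_image[OF contw]) simp
    then have "0 \<in> w ` {t0..}"
      using connectedD_interval[of "w ` {t0..}" "w s" "w u" 0] su by auto
    then show False using wnz by auto
  qed
  then show ?thesis
  proof
    assume "\<forall>t\<ge>t0. 0 < w t"
    then have eq: "w t = r t" if "t0 \<le> t" for t
      using w2[OF that] r(1)[OF that] that by (simp add: power2_eq_iff_nonneg less_imp_le)
    have "(x t, y t) = polar_point (r t) (p t + real 0 * pi)" if "t0 \<le> t" for t
      using xy[OF that] eq[OF that] by (simp add: polar_point_def)
    then show ?thesis unfolding r_def by blast
  next
    assume neg: "\<forall>t\<ge>t0. w t < 0"
    have eq: "w t = - r t" if "t0 \<le> t" for t
      using w2[OF that] r(1)[OF that] neg that by (auto simp: power2_eq_iff)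
    have "(x t, y t) = polar_point (r t) (p t + real 1 * pi)" if "t0 \<le> t" for t
      using xy[OF that] eq[OF that] by (simp add: polar_point_def)
    then show ?thesis unfolding r_def by blast
  qed
qed

text \<open>Near \<open>t\<close> the phase is \<open>p t\<close> plus the arcsine of \<open>sin (p s - p t)\<close>, which is a
  differentiable function of \<open>cos p\<close> and \<open>sin p\<close>.\<close>

lemma phase_has_derivative:
  assumes cont: "continuous (at t within S) p" and t: "t \<in> S"
    and c: "((\<lambda>s. cos (p s)) has_real_derivative C) (at t within S)"
    and s: "((\<lambda>s. sin (p s)) has_real_derivative D) (at t within S)"
  shows "(p has_real_derivative cos (p t) * D - sin (p t) * C) (at t within S)"
proof -
  let ?h = "\<lambda>u. sin (p u) * cos (p t) - cos (p u) * sin (p t)"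
  have h: "(?h has_real_derivative D * cos (p t) - C * sin (p t)) (at t within S)"
    by (intro DERIV_diff DERIV_cmult_right s c)
  have "((\<lambda>u. p t + arcsin (?h u)) has_real_derivative
      inverse (sqrt (1 - (?h t)\<^sup>2)) * (D * cos (p t) - C * sin (p t))) (at t within S)"
    by (rule DERIV_cong[OF DERIV_add[OF DERIV_const DERIV_chain2[OF DERIV_arcsin h]]]) auto
  then have a: "((\<lambda>u. p t + arcsin (?h u)) has_real_derivative cos (p t) * D - sin (p t) * C) (at t within S)"
    by (simp add: mult.commute)
  obtain d where d: "0 < d" "\<And>u. u \<in> S \<Longrightarrow> dist u t < d \<Longrightarrow> dist (p u) (p t) < pi / 2"
    using cont unfolding continuous_within_eps_delta by (metis pi_half_gt_zero)
  show ?thesis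
  proof (rule has_field_derivative_transform_within[OF a d(1) t])
    fix u assume u: "u \<in> S" "dist u t < d"
    have "?h u = sin (p u - p t)" by (simp add: sin_diff)
    moreover have "arcsin (sin (p u - p t)) = p u - p t"
      using d(2)[OF u] by (intro arcsin_sin) (auto simp: dist_real_def abs_if split: if_splits)
    ultimately show "p t + arcsin (?h u) = p u" by simp
  qed
qed

text \<open>The derivatives of \<open>x / r\<close> and \<open>- y / r\<close>, the cosine and sine of the phase, determine the derivative of
  the phase.\<close>

lemma pruefer_system_of_solution:
  fixes x y p :: "real \<Rightarrow> real"
  assumes a: "0 < a" "a < 2" and q: "0 \<le> q" and t0: "0 < t0"
    and nz: "\<And>t. t0 \<le> t \<Longrightarrow> x t \<noteq> 0 \<or> y t \<noteq> 0"
    and dx: "\<And>t. t0 \<le> t \<Longrightarrow> (x has_real_derivative y t) (at t within {t0..})"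
    and dy: "\<And>t. t0 \<le> t \<Longrightarrow> (y has_real_derivative - (a / t * y t) - (1 - q / t\<^sup>2) * x t) (at t within {t0..})"
    and cont: "continuous_on {t0..} p"
    and polar: "\<And>t. t0 \<le> t \<Longrightarrow> (x t, y t) = polar_point (sqrt ((x t)\<^sup>2 + (y t)\<^sup>2)) (- p t)"
  shows "pruefer_system a q t0 (\<lambda>t. sqrt ((x t)\<^sup>2 + (y t)\<^sup>2)) p"
proof -
  define r where "r t = sqrt ((x t)\<^sup>2 + (y t)\<^sup>2)" for t
  have rpos: "0 < r t" if "t0 \<le> t" for t
    using nz[OF that] by (auto simp: r_def sum_power2_gt_zero_iff)
  have xy: "x t = r t * cos (p t)" "y t = - r t * sin (p t)" if "t0 \<le> t" for t
    using polar[OF that] by (auto simp: polar_point_def r_def)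
  define y' where "y' t = - (a / t * y t) - (1 - q / t\<^sup>2) * x t" for t
  define r' where "r' t = (x t * y t + y t * y' t) / r t" for t
  have dr: "(r has_real_derivative r' t) (at t within {t0..})" if t: "t0 \<le> t" for t
  proof -
    have pos: "0 < (x t)\<^sup>2 + (y t)\<^sup>2" using nz[OF t] by (auto simp: sum_power2_gt_zero_iff)
    have "((\<lambda>t. (x t)\<^sup>2 + (y t)\<^sup>2) has_real_derivative 2 * x t * y t + 2 * y t * y' t) (at t within {t0..})"
      by (rule DERIV_cong[OF DERIV_add[OF DERIV_power[OF dx[OF t], of 2] DERIV_power[OF dy[OF t], of 2]]])
         (simp add: y'_def algebra_simps)
    from DERIV_chain2[OF DERIV_real_sqrt[OF pos] this]
    have "(r has_real_derivative (inverse (sqrt ((x t)\<^sup>2 + (y t)\<^sup>2)) / 2 * (2 * x t * y t + 2 * y t * y' t))) (at t within {t0..})"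
      unfolding r_def[abs_def] .
    moreover have "inverse (sqrt ((x t)\<^sup>2 + (y t)\<^sup>2)) / 2 * (2 * x t * y t + 2 * y t * y' t) = r' t"
      unfolding r'_def r_def[symmetric] using rpos[OF t] by (simp add: field_simps)
    ultimately show ?thesis by simp
  qed
  have r'_eq: "r' t = - r t * (a / t * (sin (p t))\<^sup>2 + q / t\<^sup>2 * (sin (p t) * cos (p t)))" if t: "t0 \<le> t" for t
  proof -
    have "x t * y t + y t * y' t = r t * (- r t * (a / t * (sin (p t))\<^sup>2 + q / t\<^sup>2 * (sin (p t) * cos (p t))))"
      unfolding y'_def xy[OF t] by (simp add: algebra_simps power2_eq_square)
    then show ?thesis using rpos[OF t] unfolding r'_def by (simp add: field_simps)
  qed
  have dp: "(p has_real_derivative 1 - a / t * (sin (p t) * cos (p t)) - q / t\<^sup>2 * (cos (p t))\<^sup>2) (at t within {t0..})"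
    if t: "t0 \<le> t" for t
  proof -
    have mem: "t \<in> {t0..}" using t by simp
    have cosd: "((\<lambda>s. cos (p s)) has_real_derivative (y t * r t - x t * r' t) / (r t * r t)) (at t within {t0..})"
    proof (rule has_field_derivative_transform_within[OF DERIV_divide[OF dx[OF t] dr[OF t]] zero_less_one mem])
      fix s assume "s \<in> {t0..}"
      then have "t0 \<le> s" by simp
      then show "x s / r s = cos (p s)" using xy[of s] rpos[of s] by simp
    qed (use rpos[OF t] in simp)
    have y: "(y has_real_derivative y' t) (at t within {t0..})" using dy[OF t] by (simp add: y'_def)
    have sind: "((\<lambda>s. sin (p s)) has_real_derivative - ((y' t * r t - y t * r' t) / (r t * r t))) (at t within {t0..})"
    proof (rule has_field_derivative_transform_within[OF DERIV_minus[OF DERIV_divide[OF y dr[OF t]]] zero_less_one mem])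
      fix s assume "s \<in> {t0..}"
      then have "t0 \<le> s" by simp
      then show "- (y s / r s) = sin (p s)" using xy[of s] rpos[of s] by simp
    qed (use rpos[OF t] in simp)
    have "continuous (at t within {t0..}) p"
      using cont t by (simp add: continuous_on_eq_continuous_within)
    from phase_has_derivative[OF this mem cosd sind]
    have "(p has_real_derivative cos (p t) * - ((y' t * r t - y t * r' t) / (r t * r t))
        - sin (p t) * ((y t * r t - x t * r' t) / (r t * r t))) (at t within {t0..})" .
    moreover have "cos (p t) * - ((y' t * r t - y t * r' t) / (r t * r t))
        - sin (p t) * ((y t * r t - x t * r' t) / (r t * r t))
        = - (y' t * cos (p t) + y t * sin (p t)) / r t + r' t * (y t * cos (p t) + x t * sin (p t)) / (r t * r t)"
      using rpos[OF t] by (simp add: field_simps)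
    moreover have "y t * cos (p t) + x t * sin (p t) = 0" unfolding xy[OF t] by simp
    moreover have "- (y' t * cos (p t) + y t * sin (p t))
        = r t * ((sin (p t))\<^sup>2 + (cos (p t))\<^sup>2 - a / t * (sin (p t) * cos (p t)) - q / t\<^sup>2 * (cos (p t))\<^sup>2)"
      unfolding y'_def xy[OF t]
      by (simp add: algebra_simps power2_eq_square del: sin_cos_squared_add sin_cos_squared_add2 sin_cos_squared_add3)
    ultimately show ?thesis using rpos[OF t] by simp
  qed
  show ?thesis
    unfolding r_def[symmetric]
    by unfold_locales (use a q t0 rpos dr r'_eq dp in auto)
qed

text \<open>The substitution \<open>x = t powr ((\<mu> - 1) / 2) * u\<close> turns Bessel's equation into the equation
  of the generalized functions.\<close>

lemma gen_bessel_equation: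
  assumes sol: "bessel_solution (gen_order \<nu> \<mu>) u v"
  defines "k \<equiv> (\<mu> - 1) / 2"
  defines "x \<equiv> \<lambda>t. t powr k * u t" and "y \<equiv> \<lambda>t. t powr (k - 1) * (k * u t + v t)"
  assumes t: "0 < t"
  shows "(x has_real_derivative y t) (at t)"
    and "(y has_real_derivative - ((2 - \<mu>) / t * y t) - (1 - \<nu>\<^sup>2 / t\<^sup>2) * x t) (at t)"
    and "x t \<noteq> 0 \<or> y t \<noteq> 0"
proof -
  define b where "b = gen_order \<nu> \<mu>"
  have b2: "b\<^sup>2 = k\<^sup>2 + \<nu>\<^sup>2" by (simp add: b_def gen_order_def k_def)
  have \<mu>: "2 - \<mu> = 1 - 2 * k" by (simp add: k_def field_simps)
  have d: "(u has_real_derivative v t / t) (at t)" "(v has_real_derivative ((b\<^sup>2 - t\<^sup>2) * u t) / t) (at t)"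
    using sol t unfolding bessel_solution_def bessel_system_def b_def by auto
  have P: "((\<lambda>t. t powr c) has_real_derivative c * (t powr c / t)) (at t)" for c
    using t by (auto intro!: derivative_eq_intros simp: powr_diff)
  have k1: "t powr (k - 1) = t powr k / t" using t by (simp add: powr_diff)
  show "(x has_real_derivative y t) (at t)"
    unfolding x_def
    by (rule DERIV_cong[OF DERIV_mult[OF P d(1)]]) (use t in \<open>simp add: y_def k1 field_simps\<close>)
  define X where "X = t powr k"
  have "(y has_real_derivative (k - 1) * (t powr (k - 1) / t) * (k * u t + v t)
      + (k * (v t / t) + ((b\<^sup>2 - t\<^sup>2) * u t) / t) * t powr (k - 1)) (at t)"
    unfolding y_def by (intro DERIV_mult P DERIV_add DERIV_cmult d)
  moreover have "(k - 1) * (t powr (k - 1) / t) * (k * u t + v t)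
      + (k * (v t / t) + ((b\<^sup>2 - t\<^sup>2) * u t) / t) * t powr (k - 1)
      = - ((2 - \<mu>) / t * y t) - (1 - \<nu>\<^sup>2 / t\<^sup>2) * x t"
    unfolding \<mu> b2 y_def x_def k1 X_def[symmetric] using t
    by (simp add: field_simps power2_eq_square)
  ultimately show "(y has_real_derivative - ((2 - \<mu>) / t * y t) - (1 - \<nu>\<^sup>2 / t\<^sup>2) * x t) (at t)"
    by simp
  show "x t \<noteq> 0 \<or> y t \<noteq> 0"
    using bessel_solution_no_double_zero[OF sol t] t by (auto simp: x_def y_def)
qed

lemma gen_bessel_solution:
  assumes "0 < t0"
    and "(\<forall>t\<ge>t0. x t = gen_bessel_J \<nu> \<mu> t) \<or> (\<forall>t\<ge>t0. x t = gen_bessel_Y \<nu> \<mu> t)"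
  shows "\<exists>y. \<forall>t\<ge>t0. (x has_real_derivative y t) (at t within {t0..}) \<and>
    (y has_real_derivative - ((2 - \<mu>) / t * y t) - (1 - \<nu>\<^sup>2 / t\<^sup>2) * x t) (at t within {t0..}) \<and>
    (x t \<noteq> 0 \<or> y t \<noteq> 0)"
proof -
  let ?k = "(\<mu> - 1) / 2"
  have "0 \<le> gen_order \<nu> \<mu>" by (simp add: gen_order_def)
  then obtain u v where uv: "bessel_solution (gen_order \<nu> \<mu>) u v" "\<forall>t\<ge>t0. x t = t powr ?k * u t"
    using assms(2) bessel_solution_J bessel_solution_Y
    unfolding gen_bessel_J_def gen_bessel_Y_def by metis
  define y where "y t = t powr (?k - 1) * (?k * u t + v t)" for t
  have "(x has_real_derivative y t) (at t within {t0..}) \<and>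
    (y has_real_derivative - ((2 - \<mu>) / t * y t) - (1 - \<nu>\<^sup>2 / t\<^sup>2) * x t) (at t within {t0..}) \<and>
    (x t \<noteq> 0 \<or> y t \<noteq> 0)" if t: "t0 \<le> t" for t
  proof -
    have t': "0 < t" using assms t by simp
    note eqs = gen_bessel_equation[OF uv(1) t', folded y_def]
    have xt: "x t = t powr ?k * u t" using uv(2) t by simp
    have "(x has_real_derivative y t) (at t within {t0..})"
      by (rule has_field_derivative_transform_within[OF has_field_derivative_at_within[OF eqs(1)] zero_less_one])
         (use t uv(2) in auto)
    then show ?thesis using eqs(2,3) unfolding xt by (auto intro: has_field_derivative_at_within)
  qed
  then show ?thesis by blast
qed

theorem theorem1:
  fixes \<mu> \<nu> \<tau>0 :: real and x \<phi> :: "real \<Rightarrow> real"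
  assumes "0 < \<mu>" and "\<mu> < 2" and "\<tau>0 > 0"
    and "(\<forall>t\<ge>\<tau>0. x t = gen_bessel_J \<nu> \<mu> t) \<or> (\<forall>t\<ge>\<tau>0. x t = gen_bessel_Y \<nu> \<mu> t)"
    and "continuous_on {\<tau>0..} \<phi>"
    and "\<forall>t\<ge>\<tau>0. tan_eq_quotient (\<phi> t) (deriv_on {\<tau>0..} x t) (x t)"
  shows "(\<exists>g \<phi>0 T. \<exists>j\<in>{0, 1::nat}. \<phi>0 > 0 \<and> T \<ge> \<tau>0 \<and>
            phase_curve T x = polar_graph g {..- \<phi>0} \<and>
            (\<lambda>t. \<phi> t + real j * pi) ` {T..} = {..- \<phi>0} \<and>
            (\<forall>t\<ge>T. (x t, deriv_on {\<tau>0..} x t) =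
               polar_point (g (\<phi> t + real j * pi)) (\<phi> t + real j * pi)) \<and>
            is_spiral g {..- \<phi>0} \<and>
            comparable at_bot g (\<lambda>\<theta>. \<bar>\<theta>\<bar> powr (- ((2 - \<mu>) / 2))) \<and>
            (is_wavy_spiral g {..- \<phi>0} \<longleftrightarrow> \<nu> \<noteq> 0)) \<and>
         has_phase_dim \<tau>0 x (4 / (4 - \<mu>)) \<and>
         has_box_dim (phase_curve \<tau>0 x) (4 / (4 - \<mu>))"
proof -
  obtain y where xy: "\<And>t. \<tau>0 \<le> t \<Longrightarrow> (x has_real_derivative y t) (at t within {\<tau>0..})"
    "\<And>t. \<tau>0 \<le> t \<Longrightarrow> (y has_real_derivative - ((2 - \<mu>) / t * y t) - (1 - \<nu>\<^sup>2 / t\<^sup>2) * x t) (at t within {\<tau>0..})"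
    "\<And>t. \<tau>0 \<le> t \<Longrightarrow> x t \<noteq> 0 \<or> y t \<noteq> 0"
    using gen_bessel_solution[OF assms(3,4)] by blast
  have deriv: "deriv_on {T..} x t = y t" if "\<tau>0 \<le> T" "T \<le> t" for T t
    using that xy(1)[of t] by (intro deriv_on_atLeast_eqI) (auto intro: DERIV_subset)
  have contx: "continuous_on {\<tau>0..} x" and conty: "continuous_on {\<tau>0..} y"
    using xy(1,2) by (auto intro!: DERIV_continuous_on)
  define r where "r t = sqrt ((x t)\<^sup>2 + (y t)\<^sup>2)" for t
  obtain j :: nat where j: "j \<in> {0, 1}"
    "\<And>t. \<tau>0 \<le> t \<Longrightarrow> (x t, y t) = polar_point (r t) (\<phi> t + real j * pi)"
  proof -
    have "\<And>t. \<tau>0 \<le> t \<Longrightarrow> tan_eq_quotient (\<phi> t) (y t) (x t)"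
      using assms(6) deriv by auto
    from polar_lift[OF contx conty assms(5) xy(3) this] that show ?thesis
      unfolding r_def by blast
  qed
  define \<theta> where "\<theta> t = - (\<phi> t + real j * pi)" for t
  have polar: "(x t, y t) = polar_point (r t) (- \<theta> t)" if "\<tau>0 \<le> t" for t
    using j(2)[OF that] by (simp only: \<theta>_def minus_minus)
  interpret pruefer_system "2 - \<mu>" "\<nu>\<^sup>2" \<tau>0 r \<theta>
    unfolding r_def[abs_def]
  proof (rule pruefer_system_of_solution[OF _ _ _ assms(3) xy(3,1,2)])
    show "continuous_on {\<tau>0..} \<theta>"
      unfolding \<theta>_def[abs_def] by (intro continuous_intros assms(5))
  qed (use assms polar in \<open>auto simp: r_def\<close>)
  have phase: "phase_curve T x = curve ` {T..}" if "\<tau>0 \<le> T" for T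
    unfolding phase_curve_def
  proof (rule image_cong)
    fix t assume "t \<in> {T..}"
    then show "(x t, deriv_on {T..} x t) = curve t"
      using deriv[OF that, of t] polar[of t] that by (auto simp: curve_def polar_point_def)
  qed simp
  have "2 + (2 - \<mu>) = 4 - \<mu>" by simp
  then have dim: "has_box_dim (phase_curve \<tau>0 x) (4 / (4 - \<mu>))"
    using has_box_dim_curve unfolding phase[OF order_refl] by metis
  have "C1_on {\<tau>0..} x" by (rule C1_on_atLeastI[OF xy(1) conty])
  then have phase_dim: "has_phase_dim \<tau>0 x (4 / (4 - \<mu>))"
    using dim by (simp add: has_phase_dim_def)
  \<comment> \<open>The angle at \<open>T\<close> must be positive as well, for \<open>- \<theta> T\<close> to bound the range of a spiral.\<close>
  obtain T where T: "t2 \<le> T" "\<theta> T = max 1 (\<theta> t2)"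
    using \<theta>_surj[of t2 "max 1 (\<theta> t2)"] by (auto simp: t2_def)
  have T': "t1 \<le> T" "\<tau>0 \<le> T" "0 < \<theta> T" using T t1_bounds by (auto simp: t2_def)
  define g where "g s = r (the_inv_into {T..} \<theta> (- s))" for s
  have "inj_on \<theta> {T..}"
    by (rule strict_mono_on_imp_inj_on) (use T' \<theta>_less in \<open>auto intro!: strict_mono_onI\<close>)
  then have g: "g (- \<theta> t) = r t" if "T \<le> t" for t
    using that by (simp add: g_def the_inv_into_f_f)
  have image: "(\<lambda>t. - \<theta> t) ` {T..} = {..- \<theta> T}" by (rule \<theta>_image[OF T'(1)])
  have point: "polar_point (g (- \<theta> t)) (- \<theta> t) = (x t, y t)" if "T \<le> t" for t
    using polar[of t] g[OF that] that T' by simp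
  have "polar_graph g {..- \<theta> T} = (\<lambda>t. (x t, y t)) ` {T..}"
    unfolding polar_graph_def image[symmetric] image_image
    by (rule image_cong) (use point in auto)
  also have "\<dots> = phase_curve T x"
    unfolding phase_curve_def by (rule image_cong) (use deriv T' in auto)
  finally have graph: "phase_curve T x = polar_graph g {..- \<theta> T}" by simp
  have shift: "\<phi> t + real j * pi = - \<theta> t" for t by (simp add: \<theta>_def)
  have wavy_iff: "is_wavy_spiral g {..- \<theta> T} \<longleftrightarrow> \<nu> \<noteq> 0"
    using wavy[OF _ T(1) T'(3) g] not_wavy[OF _ T'(1) g] by auto
  show ?thesis
  proof (rule conjI[OF _ conjI[OF phase_dim dim]], rule exI[of _ g], rule exI[of _ "\<theta> T"],
      rule exI[of _ T], rule bexI[OF _ j(1)], intro conjI graph)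
    show "0 < \<theta> T" "\<tau>0 \<le> T" by (rule T')+
    show "(\<lambda>t. \<phi> t + real j * pi) ` {T..} = {..- \<theta> T}" unfolding shift by (rule image)
    show "\<forall>t\<ge>T. (x t, deriv_on {\<tau>0..} x t) = polar_point (g (\<phi> t + real j * pi)) (\<phi> t + real j * pi)"
      unfolding shift using point deriv[OF order_refl] T' by auto
    show "is_spiral g {..- \<theta> T}" by (rule is_spiral_radius[OF T(1) T'(3) g])
    show "comparable at_bot g (\<lambda>\<theta>. \<bar>\<theta>\<bar> powr (- ((2 - \<mu>) / 2)))"
      by (rule comparable_radius[OF T'(1,3) g])
    show "is_wavy_spiral g {..- \<theta> T} \<longleftrightarrow> \<nu> \<noteq> 0" by (rule wavy_iff)
  qed
qed

end
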